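(* Let $L>0$, $\kappa_1>0$, $\kappa_2\in\mathbb{R}\setminus\{0\}$, and let $u$ be a dissipative solution (in the sense defined in the context) of the initial boundary value problem $$\begin{cases}\partial_{tt}^2u=-\kappa_1^2\,\partial_{xxxx}^4u-\Phi'(u), & t>0,\ 0<x<L,\\ \partial_xu(t,0)=\partial_xu(t,L)=0, & t>0,\\ \partial_{xxx}^3u(t,0)=\partial_{xxx}^3u(t,L)=0,& t>0,\\ u(0,x)=v_0(x),\quad \partial_tu(0,x)=v_1(x),& 0<x<L.\end{cases}$$ Assume that: (1) $v_0$ and $v_1$ are constant functions with $|v_0|<1$; (2) there exists a time $\bar t>0$ such that $|u(\bar t,x)|>1$ for every $x\in[0,L]$; (3) $u\in C^1([0,\infty)\times[0,L])$; (4) $u$ is energy preserving, i.e. $E[u](t)=E[u](0)$ for almost every $t>0$. Then for every $t\ge\bar t$ the function $x\mapsto u(t,x)$ is constant on $[0,L]$.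
   Context: The potential $\Phi:\mathbb{R}\to\mathbb{R}$ is $\Phi(u)=\kappa_2^2u^2/2$ if $|u|\le1$ and $\Phi(u)=\kappa_2^2/2$ if $|u|>1$; hence $\Phi'(u)=\kappa_2^2u$ for $|u|<1$ and $\Phi'(u)=0$ for $|u|>1$. $\partial\Phi(u)$ denotes the (Clarke) subdifferential of the Lipschitz function $\Phi$: $\partial\Phi(u)=\{\Phi'(u)\}$ for $u\ne\pm1$, $\partial\Phi(1)=[0,\kappa_2^2]$, $\partial\Phi(-1)=[-\kappa_2^2,0]$. The initial data satisfy $v_0\in H^2(0,L)$, $v_1\in L^2(0,L)$. Energy: $E[u](t)=\int_0^L\Big(\tfrac{(\partial_tu(t,x))^2+\kappa_1^2(\partial_{xx}^2u(t,x))^2}{2}+\Phi(u(t,x))\Big)dx$, and $E[u](0)=\int_0^L\Big(\tfrac{v_1^2+\kappa_1^2(\partial_{xx}^2v_0)^2}{2}+\Phi(v_0)\Big)dx$. A function $u:[0,\infty)\times[0,L]\to\mathbb{R}$ is a dissipative solution of the problem if (i) $u\in C([0,\infty)\times[0,L])$; (ii) $\partial_tu,\ \partial_{xx}^2u\in L^\infty(0,\infty;L^2(0,L))$ and $u\in L^\infty(0,T;H^2(0,L))$ for every $T>0$; (iii) $\partial_xu(t,0)=\partial_xu(t,L)=0$ for almost every $t>0$; (iv) $u$ is a weak solution: there is a measurable function $h_u$ with $h_u(t,x)\in\partial\Phi(u(t,x))$ for almost every $(t,x)$ such that for every $\varphi\in C^\infty(\mathbb{R}^2)$ with compact support and $\partial_x\varphi(\cdot,0)=\partial_x\varphi(\cdot,L)=0$,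 $$\int_0^\infty\!\!\int_0^L\big(u\,\partial_{tt}^2\varphi+\kappa_1^2\,\partial_{xx}^2u\,\partial_{xx}^2\varphi+h_u\varphi\big)\,dx\,dt-\int_0^Lv_1(x)\varphi(0,x)\,dx+\int_0^Lv_0(x)\,\partial_t\varphi(0,x)\,dx=0;$$ (v) $E[u](t)\le E[u](0)$ for almost every $t>0$. *)

theory Defs
  imports "HOL-Analysis.Analysis"
begin

section \<open>Smooth functions and weak derivatives\<close>

definition pderiv_at :: "'a::euclidean_space \<Rightarrow> ('a \<Rightarrow> real) \<Rightarrow> 'a \<Rightarrow> real" where
  "pderiv_at b f = (\<lambda>p. frechet_derivative f (at p) b)"

definition pderivs :: "'a::euclidean_space list \<Rightarrow> ('a \<Rightarrow> real) \<Rightarrow> 'a \<Rightarrow> real" where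
  "pderivs bs f = foldr pderiv_at bs f"

primrec Ck :: "nat \<Rightarrow> ('a::euclidean_space \<Rightarrow> real) \<Rightarrow> bool" where
  "Ck 0 f \<longleftrightarrow> continuous_on UNIV f"
| "Ck (Suc k) f \<longleftrightarrow> (\<forall>p. f differentiable (at p)) \<and> (\<forall>b\<in>Basis. Ck k (pderiv_at b f))"

definition Cc_infinity :: "('a::euclidean_space \<Rightarrow> real) set" where
  "Cc_infinity = {\<phi>. (\<forall>k. Ck k \<phi>) \<and> compact (closure {p. \<phi> p \<noteq> 0})}"

definition locally_integrable_on :: "('a::euclidean_space \<Rightarrow> real) \<Rightarrow> 'a set \<Rightarrow> bool" where
  "locally_integrable_on f \<Omega> \<longleftrightarrow>
     (\<forall>K. compact K \<and> K \<subseteq> \<Omega> \<longrightarrow> integrable (lebesgue_on K) f)"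

text \<open>For an open set \<open>\<Omega>\<close> and a list \<open>bs\<close> of basis vectors: \<open>g\<close> is a version of the distributional
  derivative of \<open>f\<close> on \<open>\<Omega>\<close> in the directions \<open>bs\<close>.\<close>

definition has_weak_derivs ::
    "('a::euclidean_space \<Rightarrow> real) \<Rightarrow> 'a list \<Rightarrow> ('a \<Rightarrow> real) \<Rightarrow> 'a set \<Rightarrow> bool" where
  "has_weak_derivs f bs g \<Omega> \<longleftrightarrow>
     locally_integrable_on f \<Omega> \<and> locally_integrable_on g \<Omega> \<and>
     (\<forall>\<psi>\<in>Cc_infinity. closure {p. \<psi> p \<noteq> 0} \<subseteq> \<Omega> \<longrightarrow>
        (\<integral>p. f p * pderivs bs \<psi> p \<partial>lebesgue_on \<Omega>) =
        (-1) ^ length bs * (\<integral>p. g p * \<psi> p \<partial>lebesgue_on \<Omega>))"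

text \<open>The weak derivative is determined only up to a null set; it is used below only in contexts
  that are insensitive to the choice of the version.\<close>

definition weak_derivs ::
    "'a::euclidean_space set \<Rightarrow> 'a list \<Rightarrow> ('a \<Rightarrow> real) \<Rightarrow> 'a \<Rightarrow> real" where
  "weak_derivs \<Omega> bs f = (SOME g. has_weak_derivs f bs g \<Omega>)"


section \<open>Function spaces\<close>

definition L2_space :: "'a::euclidean_space set \<Rightarrow> ('a \<Rightarrow> real) set" where
  "L2_space S = {f. f \<in> borel_measurable (lebesgue_on S) \<and>
                    integrable (lebesgue_on S) (\<lambda>x. (f x)\<^sup>2)}"

definition L2_norm_on :: "'a::euclidean_space set \<Rightarrow> ('a \<Rightarrow> real) \<Rightarrow> real" where
  "L2_norm_on S f = sqrt (\<integral>x. (f x)\<^sup>2 \<partial>lebesgue_on S)"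

definition H2_space :: "real set \<Rightarrow> (real \<Rightarrow> real) set" where
  "H2_space S = {f \<in> L2_space S. (\<exists>g\<in>L2_space S. has_weak_derivs f [1] g S) \<and>
                                 (\<exists>g\<in>L2_space S. has_weak_derivs f [1, 1] g S)}"

definition H2_norm_on :: "real set \<Rightarrow> (real \<Rightarrow> real) \<Rightarrow> real" where
  "H2_norm_on S f = sqrt ((L2_norm_on S f)\<^sup>2 + (L2_norm_on S (weak_derivs S [1] f))\<^sup>2
                           + (L2_norm_on S (weak_derivs S [1, 1] f))\<^sup>2)"

text \<open>\<open>L\<^sup>\<infinity>(I; L\<^sup>2(J))\<close> and \<open>L\<^sup>\<infinity>(I; H\<^sup>2(J))\<close>. Since \<open>L\<^sup>2(J)\<close> and \<open>H\<^sup>2(J)\<close> are separable, strong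
  (Bochner) measurability in time amounts to joint measurability of a representative on \<open>I \<times> J\<close>.\<close>

definition Linf_L2 :: "real set \<Rightarrow> real set \<Rightarrow> (real \<times> real \<Rightarrow> real) set" where
  "Linf_L2 I J = {g. g \<in> borel_measurable (lebesgue_on (I \<times> J)) \<and>
     (\<exists>C. AE t in lebesgue_on I. (\<lambda>x. g (t, x)) \<in> L2_space J \<and> L2_norm_on J (\<lambda>x. g (t, x)) \<le> C)}"

definition Linf_H2 :: "real set \<Rightarrow> real set \<Rightarrow> (real \<times> real \<Rightarrow> real) set" where
  "Linf_H2 I J = {g. g \<in> borel_measurable (lebesgue_on (I \<times> J)) \<and>
     (\<exists>C. AE t in lebesgue_on I. (\<lambda>x. g (t, x)) \<in> H2_space J \<and> H2_norm_on J (\<lambda>x. g (t, x)) \<le> C)}"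

definition C1_on :: "(real \<times> real) set \<Rightarrow> (real \<times> real \<Rightarrow> real) \<Rightarrow> bool" where
  "C1_on S f \<longleftrightarrow> (\<exists>f' :: real \<times> real \<Rightarrow> (real \<times> real) \<Rightarrow>\<^sub>L real.
     (\<forall>p\<in>S. (f has_derivative blinfun_apply (f' p)) (at p within S)) \<and> continuous_on S f')"


section \<open>The potential and its Clarke subdifferential\<close>

text \<open>The explicit values of the subdifferential of the potential are computed in
  \<open>clarke_subdiff_Phi_smooth\<close>, \<open>clarke_subdiff_Phi_1\<close> and \<open>clarke_subdiff_Phi_minus_1\<close>.\<close>

definition Phi :: "real \<Rightarrow> real \<Rightarrow> real" where
  "Phi \<kappa>2 u = (if \<bar>u\<bar> \<le> 1 then \<kappa>2\<^sup>2 * u\<^sup>2 / 2 else \<kappa>2\<^sup>2 / 2)"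

definition clarke_dderiv :: "(real \<Rightarrow> real) \<Rightarrow> real \<Rightarrow> real \<Rightarrow> ereal" where
  "clarke_dderiv f x d =
     Limsup (nhds x \<times>\<^sub>F at_right 0) (\<lambda>(y, s). ereal ((f (y + s * d) - f y) / s))"

definition clarke_subdiff :: "(real \<Rightarrow> real) \<Rightarrow> real \<Rightarrow> real set" where
  "clarke_subdiff f x = {\<xi>. \<forall>d. ereal (\<xi> * d) \<le> clarke_dderiv f x d}"

lemma Phi_has_deriv:
  assumes "\<bar>u\<bar> \<noteq> 1"
  shows "(Phi k has_real_derivative (if \<bar>u\<bar> < 1 then k\<^sup>2 * u else 0)) (at u)"
proof (cases "\<bar>u\<bar> < 1")
  case True
  have "((\<lambda>u. k\<^sup>2 * u\<^sup>2 / 2) has_real_derivative k\<^sup>2 * u) (at u)"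
    by (auto intro!: derivative_eq_intros)
  moreover have "open {u::real. \<bar>u\<bar> < 1}"
    by (intro open_Collect_less continuous_intros)
  ultimately have "(Phi k has_real_derivative k\<^sup>2 * u) (at u)"
    by (rule has_field_derivative_transform_within_open) (use True in \<open>auto simp: Phi_def\<close>)
  with True show ?thesis by simp
next
  case False
  have "((\<lambda>u. k\<^sup>2 / 2) has_real_derivative 0) (at u)"
    by (auto intro!: derivative_eq_intros)
  moreover have "open {u::real. \<bar>u\<bar> > 1}"
    by (intro open_Collect_less continuous_intros)
  ultimately have "(Phi k has_real_derivative 0) (at u)"
    by (rule has_field_derivative_transform_within_open) (use False assms in \<open>auto simp: Phi_def\<close>)
  with False show ?thesis by simp
qed

lemma clarke_filter_tendsto:
  "((\<lambda>p. fst p) \<longlongrightarrow> x) (nhds x \<times>\<^sub>F at_right (0::real))"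
  "((\<lambda>p. snd p) \<longlongrightarrow> 0) (nhds (x::real) \<times>\<^sub>F at_right (0::real))"
proof -
  show "((\<lambda>p. fst p) \<longlongrightarrow> x) (nhds x \<times>\<^sub>F at_right (0::real))"
    by (rule filterlim_fst)
  have "filterlim snd (at_right (0::real)) (nhds x \<times>\<^sub>F at_right (0::real))"
    by (rule filterlim_snd)
  then show "((\<lambda>p. snd p) \<longlongrightarrow> 0) (nhds x \<times>\<^sub>F at_right (0::real))"
    by (rule filterlim_mono) (auto simp: at_within_def)
qed

lemma clarke_filter_pos:
  "eventually (\<lambda>p. snd p > 0) (nhds (x::real) \<times>\<^sub>F at_right (0::real))"
proof -
  have "filterlim snd (at_right (0::real)) (nhds x \<times>\<^sub>F at_right (0::real))"
    by (rule filterlim_snd)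
  then show ?thesis
    using eventually_at_right_less[of "0::real"] by (auto simp: filterlim_iff)
qed

lemma clarke_dderiv_eqI:
  assumes "eventually (\<lambda>p. snd p > 0 \<longrightarrow>
      (f (fst p + snd p * d) - f (fst p)) / snd p = g p) (nhds x \<times>\<^sub>F at_right 0)"
    and "(g \<longlongrightarrow> c) (nhds x \<times>\<^sub>F at_right 0)"
  shows "clarke_dderiv f x d = ereal c"
  unfolding clarke_dderiv_def
proof (rule lim_imp_Limsup)
  show "\<not> trivial_limit (nhds x \<times>\<^sub>F at_right (0::real))"
    by (simp add: prod_filter_eq_bot)
  have "((\<lambda>p. ereal (g p)) \<longlongrightarrow> ereal c) (nhds x \<times>\<^sub>F at_right 0)"
    using assms(2) by simp
  then show "((\<lambda>(y, s). ereal ((f (y + s * d) - f y) / s)) \<longlongrightarrow> ereal c) (nhds x \<times>\<^sub>F at_right 0)"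
    by (rule Lim_transform_eventually)
      (use assms(1) clarke_filter_pos[of x] in \<open>eventually_elim, auto simp: case_prod_unfold\<close>)
qed

lemma clarke_dderiv_leI:
  assumes "eventually (\<lambda>p. snd p > 0 \<longrightarrow>
      (f (fst p + snd p * d) - f (fst p)) / snd p \<le> g p) (nhds x \<times>\<^sub>F at_right 0)"
    and "(g \<longlongrightarrow> c) (nhds x \<times>\<^sub>F at_right 0)"
  shows "clarke_dderiv f x d \<le> ereal c"
proof -
  have "clarke_dderiv f x d \<le> Limsup (nhds x \<times>\<^sub>F at_right 0) (\<lambda>p. ereal (g p))"
    unfolding clarke_dderiv_def
    by (rule Limsup_mono)
      (use assms(1) clarke_filter_pos[of x] in \<open>eventually_elim, auto simp: case_prod_unfold\<close>)
  also have "\<dots> = ereal c"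
    by (rule lim_imp_Limsup) (use assms(2) in \<open>auto simp: prod_filter_eq_bot\<close>)
  finally show ?thesis .
qed

lemma clarke_dderiv_geI:
  assumes y: "(y \<longlongrightarrow> x) (at_right (0::real))"
    and g: "(g \<longlongrightarrow> c) (at_right 0)"
    and le: "eventually (\<lambda>s. s > 0 \<longrightarrow> g s \<le> (f (y s + s * d) - f (y s)) / s) (at_right 0)"
  shows "ereal c \<le> clarke_dderiv f x d"
proof (rule ccontr)
  assume "\<not> ereal c \<le> clarke_dderiv f x d"
  then obtain z where z: "clarke_dderiv f x d < z" "z < ereal c"
    using dense by (metis not_le)
  have lim: "filterlim (\<lambda>s. (y s, s)) (nhds x \<times>\<^sub>F at_right 0) (at_right 0)"
    by (intro filterlim_Pair y filterlim_ident)
  have "((\<lambda>s. ereal (g s)) \<longlongrightarrow> ereal c) (at_right 0)" using g by simp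
  then have "eventually (\<lambda>s. z < ereal (g s)) (at_right 0)"
    using z(2) by (rule order_tendstoD)
  then have ev: "eventually (\<lambda>s. z < ereal ((f (y s + s * d) - f (y s)) / s)) (at_right 0)"
    using le eventually_at_right_less[of "0::real"]
    by eventually_elim (metis ereal_less_eq(3) less_le_trans)
  have "eventually (\<lambda>p. (case p of (y, s) \<Rightarrow> ereal ((f (y + s * d) - f y) / s)) < z)
      (nhds x \<times>\<^sub>F at_right 0)"
    using z(1) unfolding clarke_dderiv_def by (rule Limsup_lessD)
  from eventually_compose_filterlim[OF this lim] ev
  have "eventually (\<lambda>s::real. False) (at_right 0)"
    by eventually_elim simp
  then show False by simp
qed

lemma clarke_subdiff_of_linear:
  assumes "\<And>d. clarke_dderiv f x d = ereal (c * d)"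
  shows "clarke_subdiff f x = {c}"
proof -
  have "\<xi> = c" if "\<And>d. \<xi> * d \<le> c * d" for \<xi>
    using that[of 1] that[of "-1"] by simp
  then show ?thesis by (auto simp: clarke_subdiff_def assms)
qed

lemma clarke_subdiff_Phi_smooth:
  assumes "\<bar>u\<bar> \<noteq> 1"
  shows "clarke_subdiff (Phi k) u = {deriv (Phi k) u}"
proof -
  have sum: "((\<lambda>p. fst p + snd p * d) \<longlongrightarrow> u) (nhds u \<times>\<^sub>F at_right (0::real))" for d
    by (rule tendsto_eq_intros clarke_filter_tendsto | simp)+
  have "clarke_subdiff (Phi k) u = {if \<bar>u\<bar> < 1 then k\<^sup>2 * u else 0}"
  proof (rule clarke_subdiff_of_linear)
    fix d
    show "clarke_dderiv (Phi k) u d = ereal ((if \<bar>u\<bar> < 1 then k\<^sup>2 * u else 0) * d)"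
    proof (cases "\<bar>u\<bar> < 1")
      case True
      have "eventually (\<lambda>p. \<bar>fst p\<bar> < 1) (nhds u \<times>\<^sub>F at_right (0::real))"
        by (rule order_tendstoD(2)[OF tendsto_rabs[OF clarke_filter_tendsto(1)] True])
      moreover have "eventually (\<lambda>p. \<bar>fst p + snd p * d\<bar> < 1) (nhds u \<times>\<^sub>F at_right (0::real))"
        by (rule order_tendstoD(2)[OF tendsto_rabs[OF sum] True])
      ultimately have "eventually (\<lambda>p. snd p > 0 \<longrightarrow>
          (Phi k (fst p + snd p * d) - Phi k (fst p)) / snd p = k\<^sup>2 * (2 * fst p * d + snd p * d\<^sup>2) / 2)
          (nhds u \<times>\<^sub>F at_right 0)"
        by eventually_elim (auto simp: Phi_def field_simps power2_eq_square)
      moreover have "((\<lambda>p. k\<^sup>2 * (2 * fst p * d + snd p * d\<^sup>2) / 2) \<longlongrightarrow> k\<^sup>2 * u * d)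
          (nhds u \<times>\<^sub>F at_right 0)"
        by (rule tendsto_eq_intros clarke_filter_tendsto | simp)+
      ultimately have "clarke_dderiv (Phi k) u d = ereal (k\<^sup>2 * u * d)"
        by (rule clarke_dderiv_eqI)
      with True show ?thesis by simp
    next
      case False
      with assms have gt: "1 < \<bar>u\<bar>" by simp
      have "eventually (\<lambda>p. \<bar>fst p\<bar> > 1) (nhds u \<times>\<^sub>F at_right (0::real))"
        by (rule order_tendstoD(1)[OF tendsto_rabs[OF clarke_filter_tendsto(1)] gt])
      moreover have "eventually (\<lambda>p. \<bar>fst p + snd p * d\<bar> > 1) (nhds u \<times>\<^sub>F at_right (0::real))"
        by (rule order_tendstoD(1)[OF tendsto_rabs[OF sum] gt])
      ultimately have "eventually (\<lambda>p. snd p > 0 \<longrightarrow>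
          (Phi k (fst p + snd p * d) - Phi k (fst p)) / snd p = 0) (nhds u \<times>\<^sub>F at_right 0)"
        by eventually_elim (auto simp: Phi_def)
      then have "clarke_dderiv (Phi k) u d = ereal 0"
        by (rule clarke_dderiv_eqI) simp
      with False show ?thesis by simp
    qed
  qed
  with Phi_has_deriv[OF assms] show ?thesis by (metis DERIV_imp_deriv)
qed

lemma Phi_mono: "0 \<le> y \<Longrightarrow> y \<le> z \<Longrightarrow> Phi k y \<le> Phi k z"
  by (auto simp: Phi_def intro!: mult_left_mono mult_left_le power_mono power_le_one)

lemma Phi_diff_le:
  assumes "0 \<le> y" "y \<le> z"
  shows "Phi k z - Phi k y \<le> k\<^sup>2 * (z\<^sup>2 - y\<^sup>2) / 2"
proof -
  have "k\<^sup>2 * 1 \<le> k\<^sup>2 * z\<^sup>2" if "1 < z"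
    using that by (intro mult_left_mono) auto
  moreover have "k\<^sup>2 * y\<^sup>2 \<le> k\<^sup>2 * z\<^sup>2"
    using assms by (intro mult_left_mono power_mono) auto
  ultimately show ?thesis using assms by (auto simp: Phi_def field_simps)
qed

lemma Phi_minus [simp]: "Phi k (- u) = Phi k u"
  by (simp add: Phi_def)

lemma clarke_dderiv_Phi_1:
  "clarke_dderiv (Phi k) 1 d = ereal (if d \<ge> 0 then k\<^sup>2 * d else 0)"
proof -
  have sum: "((\<lambda>p. fst p + snd p * d) \<longlongrightarrow> 1) (nhds 1 \<times>\<^sub>F at_right (0::real))"
    by (rule tendsto_eq_intros clarke_filter_tendsto | simp)+
  have ev1: "eventually (\<lambda>p. 0 < fst p) (nhds (1::real) \<times>\<^sub>F at_right (0::real))"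
    by (rule order_tendstoD(1)[OF clarke_filter_tendsto(1)]) simp
  have ev2: "eventually (\<lambda>p. 0 < fst p + snd p * d) (nhds (1::real) \<times>\<^sub>F at_right (0::real))"
    by (rule order_tendstoD(1)[OF sum]) simp
  show ?thesis
  proof (cases "d \<ge> 0")
    case True
    have "eventually (\<lambda>p. snd p > 0 \<longrightarrow>
        (Phi k (fst p + snd p * d) - Phi k (fst p)) / snd p \<le> k\<^sup>2 * (2 * fst p * d + snd p * d\<^sup>2) / 2)
        (nhds 1 \<times>\<^sub>F at_right 0)"
      using ev1 ev2
    proof eventually_elim
      case (elim p)
      show ?case
      proof
        assume s: "snd p > 0"
        then have "Phi k (fst p + snd p * d) - Phi k (fst p)
            \<le> k\<^sup>2 * ((fst p + snd p * d)\<^sup>2 - (fst p)\<^sup>2) / 2"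
          using elim True by (intro Phi_diff_le) auto
        also have "\<dots> = k\<^sup>2 * (2 * fst p * d + snd p * d\<^sup>2) / 2 * snd p"
          by (simp add: algebra_simps power2_eq_square)
        finally show "(Phi k (fst p + snd p * d) - Phi k (fst p)) / snd p
            \<le> k\<^sup>2 * (2 * fst p * d + snd p * d\<^sup>2) / 2"
          using s by (simp add: divide_le_eq)
      qed
    qed
    moreover have "((\<lambda>p. k\<^sup>2 * (2 * fst p * d + snd p * d\<^sup>2) / 2) \<longlongrightarrow> k\<^sup>2 * d)
        (nhds 1 \<times>\<^sub>F at_right 0)"
      by (rule tendsto_eq_intros clarke_filter_tendsto | simp)+
    ultimately have le: "clarke_dderiv (Phi k) 1 d \<le> ereal (k\<^sup>2 * d)"
      by (rule clarke_dderiv_leI)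
    have lim: "((\<lambda>s::real. 1 - s * d) \<longlongrightarrow> 1) (at_right 0)"
      by (auto intro!: tendsto_eq_intros)
    have "eventually (\<lambda>s. s > 0 \<longrightarrow> k\<^sup>2 * (2 * d - s * d\<^sup>2) / 2
        \<le> (Phi k ((1 - s * d) + s * d) - Phi k (1 - s * d)) / s) (at_right 0)"
      using order_tendstoD(1)[OF lim zero_less_one]
    proof eventually_elim
      case (elim s)
      with True show ?case
        by (auto simp: Phi_def field_simps power2_eq_square)
    qed
    moreover have "((\<lambda>s::real. k\<^sup>2 * (2 * d - s * d\<^sup>2) / 2) \<longlongrightarrow> k\<^sup>2 * d) (at_right 0)"
      by (auto intro!: tendsto_eq_intros)
    ultimately have "ereal (k\<^sup>2 * d) \<le> clarke_dderiv (Phi k) 1 d"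
      using lim by (intro clarke_dderiv_geI)
    with le True show ?thesis by (simp add: antisym)
  next
    case False
    have "eventually (\<lambda>p. snd p > 0 \<longrightarrow>
        (Phi k (fst p + snd p * d) - Phi k (fst p)) / snd p \<le> 0) (nhds 1 \<times>\<^sub>F at_right 0)"
      using ev1 ev2
    proof eventually_elim
      case (elim p)
      show ?case
      proof
        assume s: "snd p > 0"
        then have "snd p * d \<le> 0" using False by (simp add: mult_le_0_iff)
        then have "Phi k (fst p + snd p * d) \<le> Phi k (fst p)"
          using elim by (intro Phi_mono) auto
        then show "(Phi k (fst p + snd p * d) - Phi k (fst p)) / snd p \<le> 0"
          using s by (simp add: divide_le_0_iff)
      qed
    qed
    then have le: "clarke_dderiv (Phi k) 1 d \<le> ereal 0"
      by (rule clarke_dderiv_leI) simp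
    have lim: "((\<lambda>s::real. 1 - s * d) \<longlongrightarrow> 1) (at_right 0)"
      by (auto intro!: tendsto_eq_intros)
    have "eventually (\<lambda>s. s > 0 \<longrightarrow> 0
        \<le> (Phi k ((1 - s * d) + s * d) - Phi k (1 - s * d)) / s) (at_right 0)"
    proof (intro always_eventually allI impI)
      fix s :: real assume "s > 0"
      then have "s * d < 0" using False by (simp add: mult_less_0_iff)
      then show "0 \<le> (Phi k ((1 - s * d) + s * d) - Phi k (1 - s * d)) / s"
        by (simp add: Phi_def)
    qed
    then have "ereal 0 \<le> clarke_dderiv (Phi k) 1 d"
      using lim by (intro clarke_dderiv_geI) auto
    with le False show ?thesis by (simp add: antisym)
  qed
qed

lemma clarke_subdiff_Phi_1: "clarke_subdiff (Phi k) 1 = {0..k\<^sup>2}"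
proof (intro set_eqI iffI)
  fix \<xi> assume "\<xi> \<in> clarke_subdiff (Phi k) 1"
  then have "\<xi> * d \<le> (if d \<ge> 0 then k\<^sup>2 * d else 0)" for d
    by (auto simp: clarke_subdiff_def clarke_dderiv_Phi_1)
  from this[of 1] this[of "-1"] show "\<xi> \<in> {0..k\<^sup>2}" by simp
next
  fix \<xi> assume "\<xi> \<in> {0..k\<^sup>2}"
  then show "\<xi> \<in> clarke_subdiff (Phi k) 1"
    by (auto simp: clarke_subdiff_def clarke_dderiv_Phi_1 mult_right_mono mult_nonneg_nonpos)
qed

lemma clarke_dderiv_even:
  assumes "\<And>z. f (- z) = f z"
  shows "clarke_dderiv f (- x) d = clarke_dderiv f x (- d)"
proof -
  have le: "clarke_dderiv f (- x) d \<le> clarke_dderiv f x (- d)" for x d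
    unfolding clarke_dderiv_def Limsup_le_iff
  proof (intro allI impI)
    fix z
    assume "z > Limsup (nhds x \<times>\<^sub>F at_right 0) (\<lambda>(y, s). ereal ((f (y + s * - d) - f y) / s))"
    then have ev: "\<forall>\<^sub>F p in nhds x \<times>\<^sub>F at_right 0.
        (case p of (y, s) \<Rightarrow> ereal ((f (y + s * - d) - f y) / s)) < z"
      by (rule Limsup_lessD)
    have "((\<lambda>p. - fst p) \<longlongrightarrow> - (- x)) (nhds (- x) \<times>\<^sub>F at_right (0::real))"
      by (intro tendsto_minus clarke_filter_tendsto)
    then have "filterlim (\<lambda>p. (- fst p, snd p)) (nhds x \<times>\<^sub>F at_right 0)
        (nhds (- x) \<times>\<^sub>F at_right (0::real))"
      by (intro filterlim_Pair filterlim_snd) simp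
    from eventually_compose_filterlim[OF ev this]
    show "\<forall>\<^sub>F p in nhds (- x) \<times>\<^sub>F at_right 0.
        (case p of (y, s) \<Rightarrow> ereal ((f (y + s * d) - f y) / s)) < z"
    proof eventually_elim
      case (elim p)
      have "f (- fst p - snd p * d) = f (fst p + snd p * d)"
        using assms[of "fst p + snd p * d"] by (simp add: algebra_simps)
      with elim show ?case by (simp add: case_prod_unfold assms)
    qed
  qed
  show ?thesis using le[of x d] le[of "- x" "- d"] by simp
qed

lemma clarke_subdiff_Phi_minus_1: "clarke_subdiff (Phi k) (-1) = {- (k\<^sup>2)..0}"
proof -
  have "\<xi> \<in> clarke_subdiff (Phi k) (-1) \<longleftrightarrow> - \<xi> \<in> clarke_subdiff (Phi k) 1" for \<xi>
  proof -
    have "\<xi> \<in> clarke_subdiff (Phi k) (-1) \<longleftrightarrow> (\<forall>d. ereal (\<xi> * d) \<le> clarke_dderiv (Phi k) 1 (- d))"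
      by (simp add: clarke_subdiff_def clarke_dderiv_even)
    also have "\<dots> \<longleftrightarrow> (\<forall>d. ereal (\<xi> * - d) \<le> clarke_dderiv (Phi k) 1 d)"
      by (metis minus_minus)
    finally show ?thesis by (simp add: clarke_subdiff_def)
  qed
  then show ?thesis unfolding clarke_subdiff_Phi_1 by force
qed


section \<open>Dissipative solutions\<close>

abbreviation e_t :: "real \<times> real" where "e_t \<equiv> (1, 0)"
abbreviation e_x :: "real \<times> real" where "e_x \<equiv> (0, 1)"

definition space_time :: "real \<Rightarrow> (real \<times> real) set" where
  "space_time L = {0<..} \<times> {0<..<L}"

definition energy :: "real \<Rightarrow> real \<Rightarrow> real \<Rightarrow> (real \<times> real \<Rightarrow> real) \<Rightarrow> real \<Rightarrow> real" where
  "energy \<kappa>1 \<kappa>2 L u t =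
     (\<integral>x. ((weak_derivs (space_time L) [e_t] u (t, x))\<^sup>2
          + \<kappa>1\<^sup>2 * (weak_derivs (space_time L) [e_x, e_x] u (t, x))\<^sup>2) / 2
         + Phi \<kappa>2 (u (t, x)) \<partial>lebesgue_on {0<..<L})"

definition initial_energy ::
    "real \<Rightarrow> real \<Rightarrow> real \<Rightarrow> (real \<Rightarrow> real) \<Rightarrow> (real \<Rightarrow> real) \<Rightarrow> real" where
  "initial_energy \<kappa>1 \<kappa>2 L v0 v1 =
     (\<integral>x. ((v1 x)\<^sup>2 + \<kappa>1\<^sup>2 * (weak_derivs {0<..<L} [1, 1] v0 x)\<^sup>2) / 2
         + Phi \<kappa>2 (v0 x) \<partial>lebesgue_on {0<..<L})"

definition weak_solution ::
    "real \<Rightarrow> real \<Rightarrow> real \<Rightarrow> (real \<Rightarrow> real) \<Rightarrow> (real \<Rightarrow> real) \<Rightarrow> (real \<times> real \<Rightarrow> real) \<Rightarrow> bool" where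
  "weak_solution \<kappa>1 \<kappa>2 L v0 v1 u \<longleftrightarrow>
     (\<exists>h. h \<in> borel_measurable (lebesgue_on (space_time L)) \<and>
       (AE p in lebesgue_on (space_time L). h p \<in> clarke_subdiff (Phi \<kappa>2) (u p)) \<and>
       (\<forall>\<phi>\<in>Cc_infinity. (\<forall>t. pderiv_at e_x \<phi> (t, 0) = 0 \<and> pderiv_at e_x \<phi> (t, L) = 0) \<longrightarrow>
          (\<integral>p. u p * pderivs [e_t, e_t] \<phi> p
               + \<kappa>1\<^sup>2 * weak_derivs (space_time L) [e_x, e_x] u p * pderivs [e_x, e_x] \<phi> p
               + h p * \<phi> p \<partial>lebesgue_on (space_time L))
          - (\<integral>x. v1 x * \<phi> (0, x) \<partial>lebesgue_on {0<..<L})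
          + (\<integral>x. v0 x * pderiv_at e_t \<phi> (0, x) \<partial>lebesgue_on {0<..<L}) = 0))"

text \<open>The boundary condition is stated with classical one-sided derivatives: for almost every \<open>t\<close>
  the continuous function \<open>u(t, \<cdot>)\<close> is in \<open>H\<^sup>2(0, L)\<close>, hence in \<open>C\<^sup>1([0, L])\<close>.\<close>

definition dissipative_solution ::
    "real \<Rightarrow> real \<Rightarrow> real \<Rightarrow> (real \<Rightarrow> real) \<Rightarrow> (real \<Rightarrow> real) \<Rightarrow> (real \<times> real \<Rightarrow> real) \<Rightarrow> bool" where
  "dissipative_solution \<kappa>1 \<kappa>2 L v0 v1 u \<longleftrightarrow>
     continuous_on ({0..} \<times> {0..L}) u \<and>
     (\<exists>g\<in>Linf_L2 {0<..} {0<..<L}. has_weak_derivs u [e_t] g (space_time L)) \<and>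
     (\<exists>g\<in>Linf_L2 {0<..} {0<..<L}. has_weak_derivs u [e_x, e_x] g (space_time L)) \<and>
     (\<forall>T>0. u \<in> Linf_H2 {0<..<T} {0<..<L}) \<and>
     (AE t in lebesgue_on {0<..}.
        ((\<lambda>x. u (t, x)) has_real_derivative 0) (at 0 within {0..L}) \<and>
        ((\<lambda>x. u (t, x)) has_real_derivative 0) (at L within {0..L})) \<and>
     weak_solution \<kappa>1 \<kappa>2 L v0 v1 u \<and>
     (AE t in lebesgue_on {0<..}. energy \<kappa>1 \<kappa>2 L u t \<le> initial_energy \<kappa>1 \<kappa>2 L v0 v1)"

end

theory Submission
  imports Defs
begin

text \<open>Before the first time \<open>t\<^sub>0\<close> at which \<open>\<bar>u\<bar> = 1\<close> somewhere, the reaction term is linear, so testing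
  the equation with functions of \<open>t\<close> alone shows that the spatial mean \<open>m\<close> of \<open>u\<close> solves
  \<open>m'' = - \<kappa>2\<^sup>2 m\<close>. The energy of the constant state \<open>m\<close> is therefore conserved and equal to the
  initial energy, and the energy inequality for \<open>u\<close> becomes equality in Cauchy-Schwarz: \<open>u\<close> and its
  time derivative do not depend on \<open>x\<close> up to \<open>t\<^sub>0\<close>. Let \<open>u = \<plusminus>1\<close> and \<open>\<partial>\<^sub>t u = w\<close> at \<open>t\<^sub>0\<close>.
  If \<open>w \<noteq> 0\<close>, then \<open>u\<close> leaves \<open>[-1, 1]\<close> for all \<open>x\<close> simultaneously, since it is \<open>C\<^sup>1\<close>; there the
  equation is free, \<open>m'\<close> is constant, and the same energy argument gives \<open>\<partial>\<^sub>t u = w\<close> forever after.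
  If \<open>w = 0\<close>, the whole energy is potential, so from \<open>tbar\<close> on there is no room for kinetic or bending
  energy: \<open>u\<close> is stationary and \<open>\<partial>\<^sub>x\<^sub>x u = 0\<close>, which with the Neumann condition makes it constant.
  No uniqueness theorem for the plate equation is needed.\<close>

section \<open>Smooth functions\<close>

text \<open>Only the spatial mean obeys an ordinary differential equation, so the
  \<open>x\<close>-dependent part of \<open>u\<close> has to be excluded by energy alone. For a
  given mean and mean velocity, Cauchy-Schwarz makes the \<open>x\<close>-independent state the
  cheapest one while the potential is quadratic or constant. That state already uses up the whole
  initial energy, so nothing remains for deviations from it.

  Second time derivatives of \<open>u\<close> are avoided: ramps in time yield the equation
  integrated twice, with kernel \<open>max 0 (a - t)\<close>, and this is differentiated afterwards
  in \<open>a\<close>. The same ramps, now in space, later give vanishing second differences.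

  At \<open>t0\<close> the velocity cannot point back inside, because \<open>u\<close> comes from
  inside. If it points outwards, a continuation argument keeps \<open>u\<close> outside: at a first
  time where the outward velocity failed to be positive, the energy argument would still apply and
  return the velocity at \<open>t0\<close>. If it is zero, the motion between \<open>t0\<close> and
  \<open>tbar\<close> is not followed at all, since \<open>h\<close> is not determined by
  \<open>u\<close> on \<open>|u| = 1\<close>; the hypothesis at \<open>tbar\<close> restarts the
  argument there.\<close>

definition smooth :: "('a::euclidean_space \<Rightarrow> real) \<Rightarrow> bool" where
  "smooth f \<longleftrightarrow> (\<forall>k. Ck k f)"

lemma pderiv_at_eq:
  assumes "\<And>p. (f has_derivative f' p) (at p)"
  shows "pderiv_at b f = (\<lambda>p. f' p b)"
  unfolding pderiv_at_def using frechet_derivative_at[OF assms] by metis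

lemma pderiv_at_real:
  assumes "\<And>x. (f has_real_derivative f' x) (at x)"
  shows "pderiv_at 1 f = f'"
  using pderiv_at_eq[of f "\<lambda>x. (*) (f' x)" 1] assms by (simp add: has_field_derivative_def)

lemma Ck_Suc_imp: "Ck (Suc k) f \<Longrightarrow> Ck k f"
proof (induction k arbitrary: f)
  case 0
  then show ?case
    by (auto intro!: differentiable_imp_continuous_on simp: differentiable_on_def)
next
  case (Suc k)
  then show ?case by (metis Ck.simps(2))
qed

lemma smooth_iff:
  "smooth f \<longleftrightarrow> (\<forall>p. f differentiable (at p)) \<and> (\<forall>b\<in>Basis. smooth (pderiv_at b f))"
  unfolding smooth_def by (metis Ck.simps(2) Ck_Suc_imp)

lemma smooth_differentiable: "smooth f \<Longrightarrow> f differentiable (at p)"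
  using smooth_iff by blast

lemma smooth_continuous_on: "smooth f \<Longrightarrow> continuous_on A f"
  unfolding smooth_def using Ck.simps(1) continuous_on_subset by blast

lemma smooth_pderiv_at: "smooth f \<Longrightarrow> b \<in> Basis \<Longrightarrow> smooth (pderiv_at b f)"
  using smooth_iff by blast

text \<open>Coinduction suits functions whose derivatives of high order have no handy closed form
  but stay in a family that is easy to describe, such as \<open>range poly_exp\<close>.\<close>

lemma smooth_coinduct:
  assumes "f \<in> F" and "\<And>f p. f \<in> F \<Longrightarrow> f differentiable (at p)"
    and "\<And>f b. f \<in> F \<Longrightarrow> b \<in> Basis \<Longrightarrow> pderiv_at b f \<in> F"
  shows "smooth f"
proof -
  have "\<forall>f\<in>F. Ck k f" for k
  proof (induction k)
    case 0
    then show ?case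
      using assms(2) by (auto intro!: differentiable_imp_continuous_on simp: differentiable_on_def)
  next
    case (Suc k)
    then show ?case using assms(2,3) by simp
  qed
  then show ?thesis using assms(1) by (simp add: smooth_def)
qed

lemma smooth_const: "smooth (\<lambda>p. c)"
proof (rule smooth_coinduct[of _ "{f. \<exists>c. f = (\<lambda>p. c)}"])
  fix f :: "'a \<Rightarrow> real" and b assume "f \<in> {f. \<exists>c. f = (\<lambda>p. c)}"
  then obtain c where f: "f = (\<lambda>p. c)" by auto
  show "f differentiable (at p)" for p by (simp add: f)
  have "pderiv_at b f = (\<lambda>p. 0)"
    unfolding f by (rule pderiv_at_eq) simp
  then show "pderiv_at b f \<in> {f. \<exists>c. f = (\<lambda>p. c)}" by auto
qed auto

lemma pderiv_at_has_derivative: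
  "f differentiable (at p) \<Longrightarrow> (f has_derivative (\<lambda>b. pderiv_at b f p)) (at p)"
  by (simp add: frechet_derivative_works pderiv_at_def)

lemma pderiv_at_add:
  assumes "\<And>p. f differentiable (at p)" "\<And>p. g differentiable (at p)"
  shows "pderiv_at b (\<lambda>p. f p + g p) = (\<lambda>p. pderiv_at b f p + pderiv_at b g p)"
  by (rule pderiv_at_eq) (intro has_derivative_add pderiv_at_has_derivative assms)

lemma pderiv_at_mult:
  assumes "\<And>p. f differentiable (at p)" "\<And>p. g differentiable (at p)"
  shows "pderiv_at b (\<lambda>p. f p * g p) = (\<lambda>p. f p * pderiv_at b g p + pderiv_at b f p * g p)"
  by (rule pderiv_at_eq) (intro has_derivative_mult pderiv_at_has_derivative assms)

lemma Ck_add: "Ck k f \<Longrightarrow> Ck k g \<Longrightarrow> Ck k (\<lambda>p. f p + g p)"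
proof (induction k arbitrary: f g)
  case 0
  then show ?case by (auto intro: continuous_intros)
next
  case (Suc k)
  then show ?case by (auto simp: pderiv_at_add)
qed

lemma Ck_mult: "Ck k f \<Longrightarrow> Ck k g \<Longrightarrow> Ck k (\<lambda>p. f p * g p)"
proof (induction k arbitrary: f g)
  case 0
  then show ?case by (auto intro: continuous_intros)
next
  case (Suc k)
  \<comment> \<open>The product rule leaves one factor undifferentiated, and the induction
    hypothesis wants that factor at order \<open>k\<close>.\<close>
  have "Ck k f" "Ck k g" using Suc.prems Ck_Suc_imp by auto
  with Suc show ?case by (auto simp: pderiv_at_mult intro!: Ck_add)
qed

lemma has_derivative_compose_pderiv:
  fixes g :: "real \<Rightarrow> real"
  assumes "f differentiable (at p)" "g differentiable (at (f p))"
  shows "((\<lambda>p. g (f p)) has_derivative (\<lambda>b. pderiv_at 1 g (f p) * pderiv_at b f p)) (at p)"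
proof -
  have g: "(g has_derivative (\<lambda>b. pderiv_at b g (f p))) (at (f p))"
    using assms(2) by (rule pderiv_at_has_derivative)
  have "pderiv_at b g (f p) = pderiv_at 1 g (f p) * b" for b
    using linear_scale[OF has_derivative_linear[OF g], of b 1] by (simp add: mult.commute)
  then have "(g has_derivative (\<lambda>b. pderiv_at 1 g (f p) * b)) (at (f p))"
    using g by (metis (no_types, lifting) ext)
  from has_derivative_compose[OF pderiv_at_has_derivative[OF assms(1)] this]
  show ?thesis .
qed

lemma Ck_compose:
  fixes g :: "real \<Rightarrow> real"
  shows "Ck k f \<Longrightarrow> Ck k g \<Longrightarrow> Ck k (\<lambda>p. g (f p))"
proof (induction k arbitrary: f g)
  case 0
  then show ?case by (auto intro: continuous_on_compose2)
next
  case (Suc k)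
  have "Ck k f" using Suc.prems Ck_Suc_imp by auto
  moreover have "pderiv_at b (\<lambda>p. g (f p)) = (\<lambda>p. pderiv_at 1 g (f p) * pderiv_at b f p)" for b
    by (rule pderiv_at_eq) (use Suc.prems in \<open>auto intro!: has_derivative_compose_pderiv\<close>)
  moreover have "(\<lambda>p. g (f p)) differentiable (at p)" for p
    using has_derivative_compose_pderiv[of f p g] Suc.prems by (auto simp: differentiable_def)
  ultimately show ?case
    using Suc by (auto intro!: Ck_mult)
qed

lemma smooth_add: "smooth f \<Longrightarrow> smooth g \<Longrightarrow> smooth (\<lambda>p. f p + g p)"
  by (simp add: smooth_def Ck_add)

lemma smooth_mult: "smooth f \<Longrightarrow> smooth g \<Longrightarrow> smooth (\<lambda>p. f p * g p)"
  by (simp add: smooth_def Ck_mult)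

lemma smooth_compose: "smooth f \<Longrightarrow> smooth g \<Longrightarrow> smooth (\<lambda>p. g (f p))"
  for g :: "real \<Rightarrow> real"
  by (simp add: smooth_def Ck_compose)

lemma smooth_inner: "smooth (\<lambda>p. p \<bullet> b)"
proof -
  have "pderiv_at b' (\<lambda>p. p \<bullet> b) = (\<lambda>p. b' \<bullet> b)" for b' :: 'a
    by (rule pderiv_at_eq) (auto intro!: derivative_eq_intros)
  then show ?thesis
    unfolding smooth_iff[of "\<lambda>p. p \<bullet> b"] by (auto intro: smooth_const)
qed

lemma smooth_prod: "(\<And>i. i \<in> I \<Longrightarrow> smooth (f i)) \<Longrightarrow> smooth (\<lambda>p. \<Prod>i\<in>I. f i p)"
  by (induction I rule: infinite_finite_induct) (auto intro: smooth_const smooth_mult)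

lemma smooth_affine: "smooth (\<lambda>x::real. m * x + c)"
  using smooth_inner[of m] by (auto intro!: smooth_add smooth_const simp: mult.commute)

lemma smooth_real_antiderivative:
  assumes "\<And>x. (f has_real_derivative f' x) (at x)" and "smooth f'"
  shows "smooth f"
  unfolding smooth_iff[of f] using assms pderiv_at_real[OF assms(1)]
  by (auto simp: differentiable_def has_field_derivative_def)

lemma smooth_has_real_derivative:
  fixes f :: "real \<Rightarrow> real"
  assumes "smooth f" shows "(f has_real_derivative pderiv_at 1 f x) (at x)"
  using has_derivative_compose_pderiv[of "\<lambda>x. x" x f] smooth_differentiable[OF assms]
  by (simp add: has_field_derivative_def pderiv_at_eq[of "\<lambda>x. x" "\<lambda>_ x. x"])

text \<open>A family containing \<open>exp (- 1 / x)\<close> (extended by \<open>0\<close>) and closed under differentiation.\<close>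

definition poly_exp :: "real poly \<Rightarrow> real \<Rightarrow> real" where
  "poly_exp P x = (if x > 0 then poly P (1 / x) * exp (- 1 / x) else 0)"

text \<open>Substituting y = 1/x turns the right-hand limit at 0 into the limit of a polynomial over
  the exponential at infinity.\<close>

lemma poly_exp_tendsto_0: "(poly_exp P \<longlongrightarrow> 0) (at 0)"
proof -
  have "((\<lambda>y. poly P y * exp (- y)) \<longlongrightarrow> (\<Sum>i\<le>degree P. coeff P i * 0)) at_top"
  proof -
    have "((\<lambda>y. \<Sum>i\<le>degree P. coeff P i * (y ^ i / exp y)) \<longlongrightarrow> (\<Sum>i\<le>degree P. coeff P i * 0)) at_top"
      by (intro tendsto_intros tendsto_power_div_exp_0)
    then show ?thesis
      by (simp add: poly_altdef sum_distrib_right exp_minus divide_inverse mult.assoc)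
  qed
  then have "((\<lambda>x. poly P (inverse x) * exp (- inverse x)) \<longlongrightarrow> 0) (at_right 0)"
    using filterlim_compose[OF _ filterlim_inverse_at_top_right, of "\<lambda>y. poly P y * exp (- y)"] by simp
  then have "(poly_exp P \<longlongrightarrow> 0) (at_right 0)"
    by (rule Lim_transform_eventually)
      (auto simp: eventually_at_filter poly_exp_def inverse_eq_divide)
  moreover have "(poly_exp P \<longlongrightarrow> 0) (at_left 0)"
    by (rule Lim_transform_eventually[OF tendsto_const])
      (auto simp: eventually_at_filter poly_exp_def)
  ultimately show ?thesis by (simp add: filterlim_split_at)
qed

text \<open>With y = 1/x one has dy/dx = - y^2, so P(y) exp(-y) has the derivative y^2 (P - P')(y)
  exp(-y); the factor y^2 is \<open>monom 1 2\<close>.\<close>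

lemma poly_exp_has_derivative:
  "(poly_exp P has_real_derivative poly_exp (monom 1 2 * (P - pderiv P)) x) (at x)"
proof -
  consider "x > 0" | "x < 0" | "x = 0" by linarith
  then show ?thesis
  proof cases
    case 1
    have "((\<lambda>x. poly P (1 / x) * exp (- 1 / x)) has_real_derivative
       poly_exp (monom 1 2 * (P - pderiv P)) x) (at x)"
      using 1 by (auto intro!: derivative_eq_intros DERIV_chain2[OF poly_DERIV] 
        simp: poly_exp_def poly_monom field_simps power2_eq_square)
    then show ?thesis
      by (rule has_field_derivative_transform_within_open[of _ _ _ "{0<..}"])
        (use 1 in \<open>auto simp: poly_exp_def\<close>)
  next
    case 2
    have "((\<lambda>x. 0) has_real_derivative poly_exp (monom 1 2 * (P - pderiv P)) x) (at x)"
      using 2 by (simp add: poly_exp_def)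
    then show ?thesis
      by (rule has_field_derivative_transform_within_open[of _ _ _ "{..<0}"])
        (use 2 in \<open>auto simp: poly_exp_def\<close>)
  next
    case 3
    \<comment> \<open>Dividing by \<open>h\<close> multiplies the polynomial in 1/h by its variable,
      so the difference quotient at 0 is again a member of the family and tends to 0.\<close>
    have "(\<lambda>h. (poly_exp P (0 + h) - poly_exp P 0) / h) = poly_exp (pCons 0 P)"
      by (auto simp: poly_exp_def fun_eq_iff)
    then have "(poly_exp P has_real_derivative 0) (at 0)"
      using poly_exp_tendsto_0 by (simp add: DERIV_def)
    then show ?thesis by (simp add: 3 poly_exp_def)
  qed
qed

lemma smooth_poly_exp: "smooth (poly_exp P)"
proof (rule smooth_coinduct[of _ "range poly_exp"])
  fix f :: "real \<Rightarrow> real" and b :: real assume "f \<in> range poly_exp"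
  then obtain P where f: "f = poly_exp P" by auto
  show "f differentiable (at p)" for p
    using poly_exp_has_derivative[of P p] f by (auto simp: differentiable_def has_field_derivative_def)
  show "pderiv_at b f \<in> range poly_exp" if "b \<in> Basis"
    using that pderiv_at_real[OF poly_exp_has_derivative, of P] by (simp add: f)
qed simp

text \<open>It reaches the value 1 only in the limit at infinity. Thus
  \<open>smooth_step (n * x)\<close> tends to the indicator of x > 0 as \<open>n\<close>
  grows.\<close>

definition smooth_step :: "real \<Rightarrow> real" where
  "smooth_step x = (if x > 0 then exp (- 1 / x) else 0)"

lemma smooth_smooth_step: "smooth smooth_step"
proof -
  have "smooth_step = poly_exp 1" by (auto simp: smooth_step_def poly_exp_def)
  then show ?thesis using smooth_poly_exp by metis
qed

lemma smooth_step_bounds: "0 \<le> smooth_step x" "smooth_step x \<le> 1"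
  and smooth_step_eq_0_iff: "smooth_step x = 0 \<longleftrightarrow> x \<le> 0"
  by (auto simp: smooth_step_def)

lemma smooth_step_affine: "smooth (\<lambda>x. smooth_step (m * x + c))"
  by (intro smooth_compose[OF _ smooth_smooth_step] smooth_affine)

section \<open>The fundamental lemma of the calculus of variations\<close>

lemma continuous_imp_borel_measurable_lebesgue:
  fixes f :: "'a::euclidean_space \<Rightarrow> real"
  shows "continuous_on UNIV f \<Longrightarrow> f \<in> borel_measurable lebesgue"
  by (intro measurable_completion) (simp add: borel_measurable_continuous_onI)

text \<open>Boxes form an intersection-stable generator of the Borel sets, so a Dynkin argument
  carries the vanishing from boxes to all Borel sets, and a density is determined almost everywhere
  by its integrals over them.\<close>

lemma AE_lebesgue_eq_0_of_box_integrals: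
  fixes f :: "'a::euclidean_space \<Rightarrow> real"
  assumes f: "integrable lebesgue f" and box: "\<And>a b. (\<integral>x\<in>box a b. f x \<partial>lebesgue) = 0"
  shows "AE x in lebesgue. f x = 0"
proof -
  \<comment> \<open>The Dynkin argument runs over Borel sets, so \<open>f\<close> is replaced by a
    Borel version.\<close>
  obtain g where g[measurable]: "g \<in> borel_measurable lborel" and fg: "AE x in lborel. f x = g x"
    using completion_ex_borel_measurable_real[of f lborel] f by auto
  have fg': "AE x in lebesgue. f x = g x"
    using fg by (rule AE_completion)
  have "integrable lebesgue g"
    using f by (rule integrable_cong_AE_imp) (use g fg' in \<open>auto intro: measurable_completion\<close>)
  then have gi: "integrable lborel g"
    by (simp add: integrable_completion)
  have si: "set_integrable lborel A g" if "A \<in> sets borel" for A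
    unfolding set_integrable_def using that gi by (intro integrable_mult_indicator) auto
  have gbox: "(\<integral>x\<in>box a b. g x \<partial>lborel) = 0" for a b
  proof -
    have "(\<integral>x\<in>box a b. g x \<partial>lborel) = (\<integral>x\<in>box a b. g x \<partial>lebesgue)"
      unfolding set_lebesgue_integral_def by (rule integral_completion[symmetric]) simp
    also have "\<dots> = (\<integral>x\<in>box a b. f x \<partial>lebesgue)"
      unfolding set_lebesgue_integral_def
    proof (rule integral_cong_AE)
      have b: "indicator (box a b) \<in> borel_measurable lebesgue"
        by (intro borel_measurable_indicator) auto
      show "(\<lambda>x. indicat_real (box a b) x *\<^sub>R g x) \<in> borel_measurable lebesgue"
        by (rule borel_measurable_scaleR[OF b measurable_completion[OF g]])
      show "(\<lambda>x. indicat_real (box a b) x *\<^sub>R f x) \<in> borel_measurable lebesgue"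
        by (rule borel_measurable_scaleR[OF b borel_measurable_integrable[OF f]])
    qed (use fg' in auto)
    finally show ?thesis using box by simp
  qed
  \<comment> \<open>Complements in the Dynkin argument need the integral over the whole space, which
    is an increasing union of boxes.\<close>
  have UNIV0: "(\<integral>x\<in>UNIV. g x \<partial>lborel) = 0"
  proof -
    let ?A = "\<lambda>i::nat. box (- (real i *\<^sub>R One)) (real i *\<^sub>R One) :: 'a set"
    have "incseq ?A"
      unfolding incseq_def by (intro allI impI subset_box_imp) (auto simp: inner_sum_left_Basis)
    then have "(\<lambda>i. \<integral>x\<in>?A i. g x \<partial>lborel) \<longlonglongrightarrow> (\<integral>x\<in>(\<Union>i. ?A i). g x \<partial>lborel)"
      by (intro set_integral_cont_up) (auto intro: si)
    then have "(\<lambda>i::nat. 0) \<longlonglongrightarrow> (\<integral>x\<in>UNIV. g x \<partial>lborel)"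
      by (simp only: gbox UN_box_eq_UNIV)
    then show ?thesis by (simp add: LIMSEQ_const_iff)
  qed
  have all: "(\<integral>x\<in>A. g x \<partial>lborel) = 0" if "A \<in> sets borel" for A
  proof -
    let ?G = "range (\<lambda>(a, b). box a b :: 'a set)"
    have "Int_stable ?G" "?G \<subseteq> Pow UNIV" "A \<in> sigma_sets UNIV ?G"
      using that by (auto simp: borel_eq_box Int_stable_def box_Int_box)
    then show ?thesis
    proof (induction rule: sigma_sets_induct_disjoint)
      case (compl A)
      then have A: "A \<in> sets borel" by (simp add: borel_eq_box)
      have "(\<integral>x\<in>UNIV. g x \<partial>lborel) = (\<integral>x\<in>A \<union> (UNIV - A). g x \<partial>lborel)" by simp
      also have "\<dots> = (\<integral>x\<in>A. g x \<partial>lborel) + (\<integral>x\<in>UNIV - A. g x \<partial>lborel)"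
        using A by (intro set_integral_Un si) auto
      finally show ?case using compl UNIV0 by simp
    next
      case (union A)
      then have "range A \<subseteq> sets borel" by (simp add: borel_eq_box)
      then have "(\<integral>x\<in>(\<Union>i. A i). g x \<partial>lborel) = (\<Sum>i. (\<integral>x\<in>A i. g x \<partial>lborel))"
        using union(1) by (intro lebesgue_integral_countable_add si) (auto simp: disjoint_family_on_def)
      then show ?case using union by simp
    next
      case (basic A)
      then show ?case using gbox by auto
    next
      case empty
      show ?case by (simp add: set_lebesgue_integral_def)
    qed
  qed
  have "AE x in lborel. g x = 0"
    by (rule density_unique_real[OF gi, of "\<lambda>x. 0"]) (auto simp: all)
  with fg have "AE x in lborel. f x = 0" by eventually_elim simp
  then show ?thesis by (rule AE_completion)
qed

text \<open>Smooth approximations from below of the indicator of the open box, with the support kept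
  in the closed box for every \<open>n\<close>.\<close>

definition box_bump :: "nat \<Rightarrow> 'a::euclidean_space \<Rightarrow> 'a \<Rightarrow> 'a \<Rightarrow> real" where
  "box_bump n a b p = (\<Prod>i\<in>Basis. smooth_step (real n * (p \<bullet> i - a \<bullet> i)) *
                                  smooth_step (real n * (b \<bullet> i - p \<bullet> i)))"

lemma smooth_box_bump: "smooth (box_bump n a b)"
proof -
  have "smooth (\<lambda>p::'a. smooth_step (real n * (p \<bullet> i - a \<bullet> i)) * smooth_step (real n * (b \<bullet> i - p \<bullet> i)))" for i
    using smooth_compose[OF smooth_inner[of i] smooth_step_affine[of "real n" "- real n * (a \<bullet> i)"]]
      smooth_compose[OF smooth_inner[of i] smooth_step_affine[of "- real n" "real n * (b \<bullet> i)"]]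
    by (intro smooth_mult) (simp_all add: algebra_simps)
  then show ?thesis
    unfolding box_bump_def[abs_def] by (intro smooth_prod)
qed

lemma box_bump_nonzero_iff: "0 < n \<Longrightarrow> box_bump n a b p \<noteq> 0 \<longleftrightarrow> p \<in> box a b"
  by (auto simp: box_bump_def smooth_step_eq_0_iff box_def mult_le_0_iff not_le)

lemma box_bump_bounds: "0 \<le> box_bump n a b p" "box_bump n a b p \<le> 1"
  unfolding box_bump_def
  by (auto intro!: prod_nonneg prod_le_1 mult_le_one mult_nonneg_nonneg smooth_step_bounds)

lemma box_bump_support: "closure {p. box_bump n a b p \<noteq> 0} \<subseteq> cbox a b"
proof (cases "n = 0")
  case True
  \<comment> \<open>For \<open>n = 0\<close> every factor is 0, and there is at least one factor
    because \<open>Basis\<close> is not empty.\<close>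
  have "box_bump n a b p = 0" for p
    using nonempty_Basis by (simp add: True box_bump_def smooth_step_def)
  then show ?thesis by simp
next
  case False
  then have "{p. box_bump n a b p \<noteq> 0} \<subseteq> cbox a b"
    using box_subset_cbox[of a b] by (auto simp: box_bump_nonzero_iff)
  then show ?thesis by (rule closure_minimal) (rule closed_cbox)
qed

lemma box_bump_Cc_infinity: "box_bump n a b \<in> Cc_infinity"
proof -
  have "bounded (closure {p. box_bump n a b p \<noteq> 0})"
    by (rule bounded_subset[OF bounded_cbox box_bump_support])
  then have "compact (closure {p. box_bump n a b p \<noteq> 0})"
    by (simp only: compact_eq_bounded_closed closed_closure simp_thms)
  then show ?thesis
    using smooth_box_bump[of n a b] unfolding Cc_infinity_def smooth_def by blast
qed

lemma box_bump_tendsto: "(\<lambda>n. box_bump n a b p) \<longlonglongrightarrow> indicator (box a b) p"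
proof -
  have step: "(\<lambda>n. smooth_step (real n * x)) \<longlonglongrightarrow> (if 0 < x then 1 else 0)" for x
  proof (cases "0 < x")
    case True
    have "(\<lambda>n. exp (- (1 / x) * (1 / real n))) \<longlonglongrightarrow> exp (- (1 / x) * 0)"
      by (intro tendsto_intros lim_1_over_n)
    then have "(\<lambda>n. smooth_step (real n * x)) \<longlonglongrightarrow> exp (- (1 / x) * 0)"
      by (rule Lim_transform_eventually)
        (use True in \<open>auto simp: smooth_step_def mult.commute intro!: eventually_sequentiallyI[of 1]\<close>)
    with True show ?thesis by simp
  next
    case False
    then show ?thesis by (simp add: smooth_step_def zero_less_mult_iff not_less)
  qed
  have "(\<lambda>n. box_bump n a b p) \<longlonglongrightarrow>
    (\<Prod>i\<in>Basis. (if 0 < p \<bullet> i - a \<bullet> i then 1 else 0) * (if 0 < b \<bullet> i - p \<bullet> i then 1 else 0))"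
    unfolding box_bump_def by (intro tendsto_prod tendsto_mult step)
  moreover have "(\<Prod>i\<in>Basis. (if 0 < p \<bullet> i - a \<bullet> i then 1 else 0) * (if 0 < b \<bullet> i - p \<bullet> i then 1 else 0))
      = (indicator (box a b) p :: real)"
    by (auto simp: indicator_def box_def intro!: prod.neutral)
  ultimately show ?thesis by simp
qed

section \<open>Integration on subsets and against test functions\<close>

lemma integrable_lebesgue_on_iff:
  "S \<in> sets lebesgue \<Longrightarrow> integrable (lebesgue_on S) f \<longleftrightarrow> integrable lebesgue (\<lambda>x. indicator S x * f x)"
  for f :: "'a::euclidean_space \<Rightarrow> real"
  by (subst integrable_restrict_space) auto

lemma integral_lebesgue_on_eq:
  "S \<in> sets lebesgue \<Longrightarrow> integral\<^sup>L (lebesgue_on S) f = (\<integral>x. indicator S x * f x \<partial>lebesgue)"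
  for f :: "'a::euclidean_space \<Rightarrow> real"
  by (subst integral_restrict_space) auto

lemma AE_lebesgue_on_iff:
  "S \<in> sets lebesgue \<Longrightarrow> (AE x in lebesgue_on S. P x) \<longleftrightarrow> (AE x in lebesgue. x \<in> S \<longrightarrow> P x)"
  by (subst AE_restrict_space_iff) auto

lemma open_sets_lebesgue: "open S \<Longrightarrow> S \<in> sets lebesgue"
  by auto

lemma Cc_infinityD:
  assumes "\<psi> \<in> Cc_infinity"
  shows "smooth \<psi>" "compact (closure {p. \<psi> p \<noteq> 0})"
  using assms by (auto simp: Cc_infinity_def smooth_def)

text \<open>The compact set \<open>K\<close> is decoupled from the support of \<open>\<psi>\<close>,
  so that a derivative of a test function can be handled with the support of the test function
  itself.\<close>

lemma locally_integrable_times_test_aux: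
  fixes g \<psi> :: "'a::euclidean_space \<Rightarrow> real"
  assumes \<Omega>: "open \<Omega>" and g: "locally_integrable_on g \<Omega>"
    and K: "compact K" "K \<subseteq> \<Omega>" and \<psi>: "continuous_on UNIV \<psi>" "\<And>p. p \<notin> K \<Longrightarrow> \<psi> p = 0"
  shows "integrable (lebesgue_on \<Omega>) (\<lambda>p. g p * \<psi> p)"
proof -
  obtain B where B: "\<And>p. p \<in> K \<Longrightarrow> \<bar>\<psi> p\<bar> \<le> B"
    using compact_imp_bounded[OF compact_continuous_image[OF continuous_on_subset[OF \<psi>(1)] K(1)]]
    by (auto simp: bounded_iff)
  have gK: "integrable lebesgue (\<lambda>x. indicator K x * g x)"
    using g K integrable_lebesgue_on_iff[of K g] fmeasurableD[OF lmeasurable_compact[OF K(1)]]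
    unfolding locally_integrable_on_def by blast
  have \<psi>m: "\<psi> \<in> borel_measurable lebesgue"
    using \<psi>(1) by (rule continuous_imp_borel_measurable_lebesgue)
  have "integrable lebesgue (\<lambda>x. B * (indicator K x * g x))"
    using gK by simp
  then have "integrable lebesgue (\<lambda>x. \<psi> x * (indicator K x * g x))"
  proof (rule Bochner_Integration.integrable_bound)
    show "AE x in lebesgue. norm (\<psi> x * (indicator K x * g x)) \<le> norm (B * (indicator K x * g x))"
      proof (intro AE_I2)
      fix x
      have "\<bar>\<psi> x\<bar> * \<bar>g x\<bar> \<le> \<bar>B\<bar> * \<bar>g x\<bar>" if "x \<in> K"
        using B[OF that] by (intro mult_right_mono) auto
      then show "norm (\<psi> x * (indicator K x * g x)) \<le> norm (B * (indicator K x * g x))"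
        by (auto simp: indicator_def abs_mult)
    qed
  qed (use \<psi>m gK in \<open>auto intro!: borel_measurable_times\<close>)
  moreover have "(\<lambda>p. indicator \<Omega> p * (g p * \<psi> p)) = (\<lambda>p. \<psi> p * (indicator K p * g p))"
    using \<psi>(2) K(2) by (auto simp: indicator_def fun_eq_iff)
  ultimately show ?thesis
    by (simp only: integrable_lebesgue_on_iff[OF open_sets_lebesgue[OF \<Omega>]])
qed

lemma locally_integrable_times_test:
  fixes g \<psi> :: "'a::euclidean_space \<Rightarrow> real"
  assumes "open \<Omega>" "locally_integrable_on g \<Omega>" "\<psi> \<in> Cc_infinity" "closure {p. \<psi> p \<noteq> 0} \<subseteq> \<Omega>"
  shows "integrable (lebesgue_on \<Omega>) (\<lambda>p. g p * \<psi> p)"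
  using assms Cc_infinityD[OF assms(3)] closure_subset[of "{p. \<psi> p \<noteq> 0}"]
  by (intro locally_integrable_times_test_aux[of _ _ "closure {p. \<psi> p \<noteq> 0}"])
    (auto intro: smooth_continuous_on)

text \<open>Box bumps and dominated convergence give zero integrals over boxes with closure in
  \<open>\<Omega>\<close>. Cut down to one such box, \<open>f\<close> is integrable on the whole
  space and the box criterion applies; countably many boxes exhaust \<open>\<Omega>\<close>.\<close>

lemma fundamental_lemma_calculus_of_variations:
  fixes f :: "'a::euclidean_space \<Rightarrow> real"
  assumes \<Omega>: "open \<Omega>" and f: "locally_integrable_on f \<Omega>"
    and test: "\<And>\<psi>. \<psi> \<in> Cc_infinity \<Longrightarrow> closure {p. \<psi> p \<noteq> 0} \<subseteq> \<Omega> \<Longrightarrow>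
                 (\<integral>p. f p * \<psi> p \<partial>lebesgue_on \<Omega>) = 0"
  shows "AE p in lebesgue_on \<Omega>. f p = 0"
proof -
  have int: "integrable lebesgue (\<lambda>x. indicator K x * f x)" if "compact K" "K \<subseteq> \<Omega>" for K
    using f that integrable_lebesgue_on_iff[of K f] fmeasurableD[OF lmeasurable_compact[OF that(1)]]
    unfolding locally_integrable_on_def by blast
  have box0: "(\<integral>p. indicator (box a b) p * f p \<partial>lebesgue) = 0" if ab: "cbox a b \<subseteq> \<Omega>" for a b
  proof -
    have "(\<integral>p. f p * box_bump n a b p \<partial>lebesgue_on \<Omega>) = 0" for n
      using ab box_bump_support by (intro test box_bump_Cc_infinity) blast
    then have 0: "(\<integral>p. box_bump n a b p * (indicator (cbox a b) p * f p) \<partial>lebesgue) = 0" for n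
    proof -
      have "(\<lambda>p. indicator \<Omega> p * (f p * box_bump n a b p)) = (\<lambda>p. box_bump n a b p * (indicator (cbox a b) p * f p))"
        using ab box_bump_support[of n a b] closure_subset[of "{p. box_bump n a b p \<noteq> 0}"] 
        by (auto simp: indicator_def fun_eq_iff)
      then show ?thesis
        using \<open>(\<integral>p. f p * box_bump n a b p \<partial>lebesgue_on \<Omega>) = 0\<close>
        by (simp only: integral_lebesgue_on_eq[OF open_sets_lebesgue[OF \<Omega>]])
    qed
    have bm: "box_bump n a b \<in> borel_measurable lebesgue" for n
      using smooth_continuous_on[OF smooth_box_bump] by (rule continuous_imp_borel_measurable_lebesgue)
    have "(\<lambda>n. \<integral>p. box_bump n a b p * (indicator (cbox a b) p * f p) \<partial>lebesgue)
        \<longlonglongrightarrow> (\<integral>p. indicator (box a b) p * (indicator (cbox a b) p * f p) \<partial>lebesgue)"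
    proof (rule integral_dominated_convergence[where w="\<lambda>p. norm (indicator (cbox a b) p * f p)"])
      show "AE p in lebesgue. (\<lambda>n. box_bump n a b p * (indicator (cbox a b) p * f p))
          \<longlonglongrightarrow> indicator (box a b) p * (indicator (cbox a b) p * f p)"
        by (intro AE_I2 tendsto_mult box_bump_tendsto tendsto_const)
      show "AE p in lebesgue. norm (box_bump n a b p * (indicator (cbox a b) p * f p))
          \<le> norm (indicator (cbox a b) p * f p)" for n
        using box_bump_bounds[of n a b] by (intro AE_I2) (auto simp: abs_mult intro!: mult_left_le_one_le)
      have IM: "(\<lambda>p. indicator (cbox a b) p * f p) \<in> borel_measurable lebesgue"
        using int[of "cbox a b"] ab by auto
      have b: "indicator (box a b) \<in> borel_measurable lebesgue"
        by (intro borel_measurable_indicator) auto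
      show "(\<lambda>p. box_bump n a b p * (indicator (cbox a b) p * f p)) \<in> borel_measurable lebesgue" for n
        by (rule borel_measurable_times[OF bm IM])
      show "(\<lambda>p. indicator (box a b) p * (indicator (cbox a b) p * f p)) \<in> borel_measurable lebesgue"
        by (rule borel_measurable_times[OF b IM])
    qed (use int[of "cbox a b"] ab in auto)
    then have "(\<integral>p. indicator (box a b) p * (indicator (cbox a b) p * f p) \<partial>lebesgue) = 0"
      by (simp add: 0 LIMSEQ_const_iff)
    moreover have "indicator (box a b) p * (indicator (cbox a b) p * f p) = indicator (box a b) p * f p" for p
      using box_subset_cbox[of a b] by (auto simp: indicator_def)
    ultimately show ?thesis by simp
  qed
  have cb: "AE p in lebesgue. p \<in> cbox c d \<longrightarrow> f p = 0" if cd: "cbox c d \<subseteq> \<Omega>" for c d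
  proof -
    have i: "integrable lebesgue (\<lambda>x. indicator (box c d) x *\<^sub>R (indicator (cbox c d) x * f x))"
      using int[of "cbox c d"] cd by (intro integrable_mult_indicator) auto
    have e: "indicator (box c d) p *\<^sub>R (indicator (cbox c d) p * f p) = indicator (box c d) p * f p" for p
      using box_subset_cbox[of c d] by (auto simp: indicator_def)
    have "(\<integral>x\<in>box a b. indicator (box c d) x * f x \<partial>lebesgue) = 0" for a b
    proof -
      obtain a' b' where ab': "box a b \<inter> box c d = box a' b'" using box_Int_box[of a b c d] by blast
      have eq: "(\<integral>x\<in>box a b. indicator (box c d) x * f x \<partial>lebesgue) = (\<integral>p. indicator (box a' b') p * f p \<partial>lebesgue)"
        unfolding set_lebesgue_integral_def ab'[symmetric]
        by (intro Bochner_Integration.integral_cong) (simp_all add: indicator_inter_arith)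
      show ?thesis
      \<comment> \<open>The corners of an empty intersection say nothing about its position; only a
        non-empty open box has the corresponding \<open>cbox\<close> as its closure.\<close>
      proof (cases "box a' b' = {}")
        case False
        then have "cbox a' b' = closure (box a' b')" by simp
        also have "\<dots> \<subseteq> cbox c d"
          using ab' box_subset_cbox[of c d] by (intro closure_minimal) auto
        finally show ?thesis using box0[of a' b'] cd eq by simp
      qed (simp add: eq)
    qed
    then have "AE p in lebesgue. indicator (box c d) p * f p = 0"
      using i unfolding e by (intro AE_lebesgue_eq_0_of_box_integrals) auto
    moreover have "AE p in lebesgue. p \<notin> cbox c d - box c d"
      using negligible_frontier_interval[of c d]
      by (intro AE_not_in) (simp add: negligible_iff_null_sets)
    ultimately show ?thesis by eventually_elim (auto simp: indicator_def split: if_splits)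
  qed
  \<comment> \<open>Corners of the boxes of a cover by rational boxes: the cover must be countable
    for the exceptional null sets to be united.\<close>
  define a' where "a' = (\<lambda>f :: 'a \<Rightarrow> real \<times> real. (\<Sum>(i::'a)\<in>Basis. fst (f i) *\<^sub>R i))"
  define b' where "b' = (\<lambda>f :: 'a \<Rightarrow> real \<times> real. (\<Sum>(i::'a)\<in>Basis. snd (f i) *\<^sub>R i))"
  define I where "I = {f\<in>Basis \<rightarrow>\<^sub>E \<rat> \<times> \<rat>. cbox (a' f) (b' f) \<subseteq> \<Omega>}"
  have cov: "\<Omega> = (\<Union>f\<in>I. cbox (a' f) (b' f))"
    unfolding I_def a'_def b'_def by (rule open_UNION_cbox[OF \<Omega>])
  have "countable I"
    unfolding I_def by (intro countable_Collect countable_PiE) (auto intro!: countable_SIGMA simp: countable_rat)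
  then have "AE p in lebesgue. \<forall>i\<in>I. p \<in> cbox (a' i) (b' i) \<longrightarrow> f p = 0"
    by (subst AE_ball_countable) (auto simp: I_def intro: cb)
  then have "AE p in lebesgue. p \<in> \<Omega> \<longrightarrow> f p = 0"
    by eventually_elim (use cov in blast)
  then show ?thesis using \<Omega> by (simp add: AE_lebesgue_on_iff)
qed

text \<open>This makes the arbitrary choice in \<open>weak_derivs\<close> harmless: any known
  version may replace it almost everywhere.\<close>

lemma weak_derivs_unique:
  fixes f g g' :: "'a::euclidean_space \<Rightarrow> real"
  assumes \<Omega>: "open \<Omega>" and g: "has_weak_derivs f bs g \<Omega>" and g': "has_weak_derivs f bs g' \<Omega>"
  shows "AE p in lebesgue_on \<Omega>. g p = g' p"
proof -
  have li: "locally_integrable_on g \<Omega>" "locally_integrable_on g' \<Omega>"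
    using g g' by (auto simp: has_weak_derivs_def)
  have "AE p in lebesgue_on \<Omega>. g p - g' p = 0"
  proof (rule fundamental_lemma_calculus_of_variations[OF \<Omega>])
    show "locally_integrable_on (\<lambda>p. g p - g' p) \<Omega>"
      using li by (auto simp: locally_integrable_on_def)
    fix \<psi> :: "'a \<Rightarrow> real" assume \<psi>: "\<psi> \<in> Cc_infinity" "closure {p. \<psi> p \<noteq> 0} \<subseteq> \<Omega>"
    have "(-1) ^ length bs * (\<integral>p. g p * \<psi> p \<partial>lebesgue_on \<Omega>) = (-1) ^ length bs * (\<integral>p. g' p * \<psi> p \<partial>lebesgue_on \<Omega>)"
      using g g' \<psi> by (auto simp: has_weak_derivs_def)
    then have "(\<integral>p. g p * \<psi> p \<partial>lebesgue_on \<Omega>) = (\<integral>p. g' p * \<psi> p \<partial>lebesgue_on \<Omega>)" by simp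
    then show "(\<integral>p. (g p - g' p) * \<psi> p \<partial>lebesgue_on \<Omega>) = 0"
      using locally_integrable_times_test[OF \<Omega> li(1) \<psi>] locally_integrable_times_test[OF \<Omega> li(2) \<psi>]
      by (simp add: left_diff_distrib)
  qed
  then show ?thesis by eventually_elim simp
qed

lemma has_weak_derivs_weak_derivs:
  "has_weak_derivs f bs g \<Omega> \<Longrightarrow> has_weak_derivs f bs (weak_derivs \<Omega> bs f) \<Omega>"
  unfolding weak_derivs_def by (rule someI[where P="\<lambda>g. has_weak_derivs f bs g \<Omega>"])

section \<open>Ramps, cutoffs and tensor products\<close>

lemma ex_antiderivative:
  fixes f :: "real \<Rightarrow> real"
  assumes "continuous_on UNIV f"
  shows "\<exists>F. \<forall>x. (F has_real_derivative f x) (at x)"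
proof (intro exI allI)
  fix x :: real
  \<comment> \<open>The interval contains the base point 0 and has \<open>x\<close> in its interior,
    so the derivative within it is a two-sided one.\<close>
  have "((\<lambda>u. LBINT y=ereal 0..ereal u. f y) has_vector_derivative f x) (at x within {-\<bar>x\<bar>-1..\<bar>x\<bar>+1})"
    by (rule interval_integral_FTC2) (auto intro: continuous_on_subset[OF assms])
  moreover have "at x within {-\<bar>x\<bar>-1..\<bar>x\<bar>+1} = at x"
    by (rule at_within_interior) auto
  ultimately show "((\<lambda>u. LBINT y=ereal 0..ereal u. f y) has_real_derivative f x) (at x)"
    by (simp add: has_real_derivative_iff_has_vector_derivative)
qed

lemma DERIV_0_imp_eq_on_convex:
  fixes f :: "real \<Rightarrow> real"
  assumes "convex S" and "\<And>z. z \<in> S \<Longrightarrow> (f has_real_derivative 0) (at z)" and "x \<in> S" "y \<in> S"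
  shows "f x = f y"
proof -
  have "\<exists>c. \<forall>x\<in>S. f x = c"
    using assms(1) by (rule has_field_derivative_zero_constant) (rule has_field_derivative_at_within[OF assms(2)])
  then show ?thesis using assms(3,4) by auto
qed

text \<open>A smooth approximation of \<open>x \<mapsto> max 0 (- x)\<close>, whose second derivative
  is an approximation of the Dirac mass at \<open>0\<close>.\<close>

locale ramp =
  fixes R R' \<beta> :: "real \<Rightarrow> real"
  assumes smooth: "smooth R"
    and deriv: "(R has_real_derivative R' x) (at x)"
    and deriv2: "(R' has_real_derivative \<beta> x) (at x)"
    and \<beta>_nonneg: "0 \<le> \<beta> x"
    and \<beta>_left: "x \<le> 0 \<Longrightarrow> \<beta> x = 0"
    and R'_left: "x \<le> 0 \<Longrightarrow> R' x = - 1"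
    and R'_right: "1 \<le> x \<Longrightarrow> R' x = 0"
    and R_right: "1 \<le> x \<Longrightarrow> R x = 0"

text \<open>The second derivative comes first: a bump on (0, 1), scaled to mass 1 and integrated
  twice, with constants of integration that make \<open>R'\<close> and \<open>R\<close> vanish at
  1.\<close>

lemma ex_ramp: "\<exists>R R' \<beta>. ramp R R' \<beta>"
proof -
  define b where "b x = smooth_step x * smooth_step (1 - x)" for x
  have b: "smooth b"
    unfolding b_def[abs_def] using smooth_step_affine[of "-1" 1] smooth_smooth_step
    by (intro smooth_mult) simp_all
  have b_nonneg: "0 \<le> b x" for x by (simp add: b_def smooth_step_bounds)
  have b_0: "b x = 0 \<longleftrightarrow> x \<le> 0 \<or> 1 \<le> x" for x by (simp add: b_def smooth_step_eq_0_iff)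
  obtain F where F: "\<And>x. (F has_real_derivative b x) (at x)"
    using ex_antiderivative[OF smooth_continuous_on[OF b]] by auto
  have Fconst: "F x = F y" if "convex S" "x \<in> S" "y \<in> S" and "\<And>z. z \<in> S \<Longrightarrow> b z = 0" for S x y
    using DERIV_0_imp_eq_on_convex[of S F x y] F that by metis
  have "F 0 < F 1"
  proof (rule DERIV_pos_imp_increasing_open[of 0 1 F])
    show "\<exists>y. (F has_real_derivative y) (at x) \<and> 0 < y" if "0 < x" "x < 1" for x
      using F[of x] b_nonneg[of x] b_0[of x] that by (intro exI[of _ "b x"]) auto
    show "continuous_on {0..1} F"
      using F by (meson DERIV_continuous_on DERIV_subset subset_UNIV)
  qed simp
  \<comment> \<open>The mass of the bump; dividing by it makes \<open>R'\<close> climb from exactly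
    -1 to 0.\<close>
  define c where "c = F 1 - F 0"
  have c: "c > 0" using \<open>F 0 < F 1\<close> by (simp add: c_def)
  define \<beta> where "\<beta> x = b x / c" for x
  define R' where "R' x = (F x - F 1) / c" for x
  have R': "(R' has_real_derivative \<beta> x) (at x)" for x
    unfolding R'_def[abs_def] \<beta>_def using c by (auto intro!: derivative_eq_intros F)
  have "smooth \<beta>"
    unfolding \<beta>_def[abs_def] using smooth_mult[OF b smooth_const[of "1 / c"]] by simp
  then have sR': "smooth R'" using R' by (rule smooth_real_antiderivative[rotated])
  obtain G where G: "\<And>x. (G has_real_derivative R' x) (at x)"
    using ex_antiderivative[OF smooth_continuous_on[OF sR']] by auto
  define R where "R x = G x - G 1" for x
  have R: "(R has_real_derivative R' x) (at x)" for x
    unfolding R_def[abs_def] by (auto intro!: derivative_eq_intros G)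
  have R'_right: "R' x = 0" if "1 \<le> x" for x
    using Fconst[of "{1..}" x 1] that by (simp add: R'_def b_0)
  have "R x = 0" if "1 \<le> x" for x
    using DERIV_0_imp_eq_on_convex[of "{1..}" R x 1] R R'_right that
    by (metis R_def atLeast_iff convex_real_interval(1) diff_self order_refl)
  moreover have "R' x = - 1" if "x \<le> 0" for x
    using Fconst[of "{..0}" x 0] that c by (simp add: R'_def b_0 c_def field_simps)
  moreover have "smooth R" using R sR' by (rule smooth_real_antiderivative)
  ultimately have "ramp R R' \<beta>"
    using R R' R'_right b_nonneg c b_0 by unfold_locales (auto simp: \<beta>_def)
  then show ?thesis by blast
qed

context ramp
begin

lemma R'_mono: "x \<le> y \<Longrightarrow> R' x \<le> R' y"
  by (rule DERIV_nonneg_imp_nondecreasing) (use deriv2 \<beta>_nonneg in blast)+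

lemma R'_bounds: "- 1 \<le> R' x" "R' x \<le> 0"
  using R'_mono[of 0 x] R'_left[of x] R'_left[of 0] R'_mono[of x 1] R'_right[of x] R'_right[of 1]
  by linarith+

lemma R_antimono: "x \<le> y \<Longrightarrow> R y \<le> R x"
  by (rule DERIV_nonpos_imp_nonincreasing) (use deriv R'_bounds(2) in blast)+

lemma R_plus_mono: "x \<le> y \<Longrightarrow> R x + x \<le> R y + y"
proof (rule DERIV_nonneg_imp_nondecreasing[of x y "\<lambda>z. R z + z"])
  fix z assume "x \<le> z" "z \<le> y"
  have "((\<lambda>z. R z + z) has_real_derivative R' z + 1) (at z)"
    by (auto intro!: derivative_eq_intros deriv)
  then show "\<exists>y. ((\<lambda>z. R z + z) has_real_derivative y) (at z) \<and> 0 \<le> y"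
    using R'_bounds(1)[of z] by (intro exI[of _ "R' z + 1"]) auto
qed

lemma R_left: "x \<le> 0 \<Longrightarrow> R x = R 0 - x"
proof -
  assume x: "x \<le> 0"
  have "((\<lambda>z. R z + z) has_real_derivative 0) (at z)" if "z \<in> {..0}" for z
    using R'_left[of z] that by (auto intro!: derivative_eq_intros deriv)
  from DERIV_0_imp_eq_on_convex[of "{..0}" "\<lambda>z. R z + z" x 0, OF _ this] x show "R x = R 0 - x"
    by auto
qed

text \<open>The slope of \<open>R\<close> lies in [-1, 0], which squeezes \<open>R\<close> between
  \<open>max 0 (- x)\<close> and a translate by 1. After scaling by \<open>N\<close> the gap is at
  most 1/N.\<close>

lemma R_bounds: "max 0 (- x) \<le> R x" "R x \<le> max 0 (1 - x)"
proof -
  have *: "0 \<le> R x" for x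
    using R_antimono[of x 1] R_right[of 1] R_right[of x] by (cases "x \<le> 1") auto
  show "max 0 (- x) \<le> R x"
    using *[of x] *[of 0] R_left[of x] by (cases "x \<le> 0") auto
  show "R x \<le> max 0 (1 - x)"
    using R_plus_mono[of x 1] R_right[of 1] R_right[of x] by (cases "x \<le> 1") auto
qed

text \<open>At \<open>x = 1\<close> the function \<open>R'\<close> is known to be constant only to
  the right, so its derivative is read off from one-sided difference quotients.\<close>

lemma \<beta>_right: "1 \<le> x \<Longrightarrow> \<beta> x = 0"
proof -
  assume x: "1 \<le> x"
  have "\<forall>\<^sub>F h in at_right 0. (R' (x + h) - R' x) / h = 0"
    using eventually_at_right_less[of "0::real"] by eventually_elim (use x R'_right in auto)
  then have "((\<lambda>h. (R' (x + h) - R' x) / h) \<longlongrightarrow> 0) (at_right 0)"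
    by (rule tendsto_eventually)
  moreover have "((\<lambda>h. (R' (x + h) - R' x) / h) \<longlongrightarrow> \<beta> x) (at_right 0)"
    using deriv2[of x] by (auto simp: DERIV_def intro: filterlim_mono at_le)
  ultimately show "\<beta> x = 0" using tendsto_unique[of "at_right (0::real)"] by auto
qed

lemma smooth_R': "smooth R'"
proof -
  have "pderiv_at 1 R = R'" using deriv by (rule pderiv_at_real)
  then show ?thesis using smooth_pderiv_at[OF smooth, of 1] by simp
qed

lemma smooth_\<beta>: "smooth \<beta>"
proof -
  have "pderiv_at 1 R' = \<beta>" using deriv2 by (rule pderiv_at_real)
  then show ?thesis using smooth_pderiv_at[OF smooth_R', of 1] by simp
qed

lemma scaled_deriv:
  assumes "0 < N"
  shows "((\<lambda>t. R (N * (t - a)) / N) has_real_derivative R' (N * (t - a))) (at t)"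
    and "((\<lambda>t. R' (N * (t - a))) has_real_derivative N * \<beta> (N * (t - a))) (at t)"
proof -
  have l: "((\<lambda>t. N * (t - a)) has_real_derivative N) (at t)"
    by (auto intro!: derivative_eq_intros)
  show "((\<lambda>t. R (N * (t - a)) / N) has_real_derivative R' (N * (t - a))) (at t)"
    using DERIV_cdivide[OF DERIV_chain2[OF deriv l], of N] assms by simp
  show "((\<lambda>t. R' (N * (t - a))) has_real_derivative N * \<beta> (N * (t - a))) (at t)"
    using DERIV_chain2[OF deriv2 l] by (simp add: mult.commute)
qed

lemma scaled_bounds:
  assumes "0 < N"
  shows "max 0 (a - t) \<le> R (N * (t - a)) / N" "R (N * (t - a)) / N \<le> max 0 (a + 1 / N - t)"
proof -
  have "max 0 (a - t) * N = max 0 (- (N * (t - a)))" "max 0 (a + 1 / N - t) * N = max 0 (1 - N * (t - a))"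
    using assms by (auto simp: max_def field_simps zero_le_mult_iff)
  then show "max 0 (a - t) \<le> R (N * (t - a)) / N" "R (N * (t - a)) / N \<le> max 0 (a + 1 / N - t)"
    using R_bounds[of "N * (t - a)"] assms by (auto simp: field_simps)
qed

lemma scaled_tendsto: "(\<lambda>n. R (real (Suc n) * (t - a)) / real (Suc n)) \<longlonglongrightarrow> max 0 (a - t)"
proof (rule tendsto_sandwich[OF _ _ tendsto_const])
  have "(\<lambda>n. max 0 (a + 1 / real (Suc n) - t)) \<longlonglongrightarrow> max 0 (a + 0 - t)"
    by (intro tendsto_intros LIMSEQ_Suc[OF lim_1_over_n])
  then show "(\<lambda>n. max 0 (a + 1 / real (Suc n) - t)) \<longlonglongrightarrow> max 0 (a - t)" by simp
qed (use scaled_bounds[of "real (Suc _)"] in auto)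

text \<open>The kernels are non-negative, have mass 1 and live on [a, a + 1/(n+1)]. Being one-sided,
  they recover \<open>U a\<close> without looking at times before \<open>a\<close>, which admits
  \<open>a = 0\<close>.\<close>

lemma scaled_approximates_identity:
  fixes U :: "real \<Rightarrow> real"
  assumes U: "continuous_on {a..a + 1} U"
  shows "(\<lambda>n. integral {a..a + 1} (\<lambda>t. real (Suc n) * \<beta> (real (Suc n) * (t - a)) * U t)) \<longlonglongrightarrow> U a"
proof (rule LIMSEQ_I)
  fix e :: real assume e: "e > 0"
  let ?k = "\<lambda>n t. real (Suc n) * \<beta> (real (Suc n) * (t - a))"
  obtain d where d: "d > 0" "\<And>t. t \<in> {a..a+1} \<Longrightarrow> dist t a < d \<Longrightarrow> dist (U t) (U a) < e / 2"
    using U e unfolding continuous_on_iff by (metis atLeastAtMost_iff half_gt_zero le_add_same_cancel1 order_refl zero_le_one)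
  have mass: "(?k n has_integral 1) {a..a+1}" for n
  proof -
    have "(?k n has_integral R' (real (Suc n) * (a + 1 - a)) - R' (real (Suc n) * (a - a))) {a..a+1}"
      by (rule fundamental_theorem_of_calculus)
        (auto simp flip: has_real_derivative_iff_has_vector_derivative intro!: DERIV_subset[OF scaled_deriv(2)])
    then show ?thesis using R'_left[of 0] R'_right[of "real (Suc n)"] by simp
  qed
  have ck: "continuous_on A (?k n)" for n A
    by (intro continuous_intros continuous_on_compose2[OF smooth_continuous_on[OF smooth_\<beta>, of UNIV]]) auto
  \<comment> \<open>From this index on the kernels are supported within distance \<open>d\<close> of
    \<open>a\<close>.\<close>
  obtain n0 where n0: "inverse (real (Suc n0)) < d" using reals_Archimedean[OF d(1)] by auto
  show "\<exists>no. \<forall>n\<ge>no. norm (integral {a..a + 1} (\<lambda>t. ?k n t * U t) - U a) < e"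
  proof (intro exI allI impI)
    fix n assume n: "n0 \<le> n"
    have "inverse (real (Suc n)) \<le> inverse (real (Suc n0))" using n by (intro le_imp_inverse_le) auto
    then have nd: "1 < real (Suc n) * d" 
      using n0 d(1) by (auto simp: field_simps intro: less_le_trans[of 1 "d + d * real n0"] mult_left_mono)
    have i1: "(\<lambda>t. ?k n t * U t) integrable_on {a..a+1}"
      by (intro integrable_continuous_real continuous_intros ck U)
    have i2: "((\<lambda>t. ?k n t * U a) has_integral 1 * U a) {a..a+1}"
      by (intro has_integral_mult_left mass)
    have i3: "((\<lambda>t. ?k n t * (e/2)) has_integral 1 * (e/2)) {a..a+1}"
      by (intro has_integral_mult_left mass)
    have A: "integral {a..a + 1} (\<lambda>t. ?k n t * U t) - U a
        = integral {a..a + 1} (\<lambda>t. ?k n t * U t - ?k n t * U a)"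
      using i1 i2 by (subst Henstock_Kurzweil_Integration.integral_diff) (auto dest: integral_unique)
    have B: "norm (integral {a..a + 1} (\<lambda>t. ?k n t * U t - ?k n t * U a)) \<le> integral {a..a + 1} (\<lambda>t. ?k n t * (e/2))"
    proof (rule integral_norm_bound_integral)
      fix t assume t: "t \<in> {a..a+1}"
      show "norm (?k n t * U t - ?k n t * U a) \<le> ?k n t * (e/2)"
      proof (cases "dist t a < d")
        case True
        have "norm (?k n t * U t - ?k n t * U a) = ?k n t * dist (U t) (U a)"
          by (simp add: dist_real_def abs_mult \<beta>_nonneg flip: right_diff_distrib)
        also have "\<dots> \<le> ?k n t * (e/2)"
          using d(2)[OF t True] by (intro mult_left_mono) (auto simp: \<beta>_nonneg)
        finally show ?thesis .
      next
        case False
        then have "d \<le> t - a" using t by (auto simp: dist_real_def)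
        then have "real (Suc n) * d \<le> real (Suc n) * (t - a)" by (intro mult_left_mono) auto
        then have "\<beta> (real (Suc n) * (t - a)) = 0" using nd by (intro \<beta>_right) linarith
        then show ?thesis by simp
      qed
    qed (use Henstock_Kurzweil_Integration.integrable_diff[OF i1 has_integral_integrable[OF i2]] has_integral_integrable[OF i3] in \<open>simp_all only:\<close>)
    show "norm (integral {a..a + 1} (\<lambda>t. ?k n t * U t) - U a) < e"
      using B integral_unique[OF i3] e unfolding A by linarith
  qed
qed

lemma smooth_scaled: "smooth (\<lambda>t. R (N * (t - a)) / N)"
  using smooth_mult[OF smooth_compose[OF smooth_affine[of N "- N * a"] smooth] smooth_const[of "1 / N"]]
  by (simp add: algebra_simps)

end

text \<open>\<open>exp 1\<close> is the reciprocal of \<open>smooth_step 1\<close>, so the argument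
  of the outer step is at most 0 once \<open>x \<ge> 1\<close>. The division by
  \<open>smooth_step 1\<close> normalises the value for \<open>x \<le> 0\<close> to 1.\<close>

definition smooth_cutoff :: "real \<Rightarrow> real" where
  "smooth_cutoff x = smooth_step (1 - exp 1 * smooth_step x) / smooth_step 1"

lemma smooth_smooth_cutoff: "smooth smooth_cutoff"
proof -
  have "smooth (\<lambda>x. smooth_step (- exp 1 * smooth_step x + 1) * (1 / smooth_step 1))"
    by (intro smooth_mult smooth_const smooth_compose[OF smooth_smooth_step smooth_step_affine])
  then show ?thesis by (simp add: smooth_cutoff_def[abs_def])
qed

lemma smooth_cutoff_left: "x \<le> 0 \<Longrightarrow> smooth_cutoff x = 1"
  by (simp add: smooth_cutoff_def smooth_step_def)

lemma smooth_cutoff_right: "1 \<le> x \<Longrightarrow> smooth_cutoff x = 0"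
proof -
  assume x: "1 \<le> x"
  have "exp 1 * exp (- 1 / x) \<ge> (1::real)"
    using x by (simp add: field_simps flip: exp_add)
  then show ?thesis using x by (simp add: smooth_cutoff_def smooth_step_def)
qed

lemma ex_smooth_plateau:
  fixes a b :: real
  shows "\<exists>\<eta>. smooth \<eta> \<and> (\<forall>x\<in>{a..b}. \<eta> x = 1) \<and> (\<forall>x. x \<notin> {a - 1..b + 1} \<longrightarrow> \<eta> x = 0)"
proof (intro exI conjI)
  show "smooth (\<lambda>x. smooth_cutoff (1 * x + (- b)) * smooth_cutoff ((-1) * x + a))"
    by (intro smooth_mult smooth_compose[OF smooth_affine smooth_smooth_cutoff])
qed (auto simp: smooth_cutoff_left smooth_cutoff_right not_le)

lemma Cc_infinityI:
  fixes \<phi> :: "'a::euclidean_space \<Rightarrow> real"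
  assumes "smooth \<phi>" "compact K" "\<And>p. p \<notin> K \<Longrightarrow> \<phi> p = 0"
  shows "\<phi> \<in> Cc_infinity" "closure {p. \<phi> p \<noteq> 0} \<subseteq> K"
proof -
  show K: "closure {p. \<phi> p \<noteq> 0} \<subseteq> K"
    using assms(2,3) by (intro closure_minimal) (auto intro: compact_imp_closed)
  have "bounded (closure {p. \<phi> p \<noteq> 0})"
    by (rule bounded_subset[OF compact_imp_bounded[OF assms(2)] K])
  then have "compact (closure {p. \<phi> p \<noteq> 0})"
    by (simp only: compact_eq_bounded_closed closed_closure simp_thms)
  then show "\<phi> \<in> Cc_infinity"
    using assms(1) unfolding Cc_infinity_def smooth_def by blast
qed

section \<open>Tensor products of functions of time and of space\<close>

lemma Basis_real_pair: "(1, 0) \<in> (Basis :: (real \<times> real) set)" "(0, 1) \<in> (Basis :: (real \<times> real) set)"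
  by (auto simp: Basis_prod_def)

lemma smooth_tensor:
  fixes \<theta> \<eta> :: "real \<Rightarrow> real"
  assumes "smooth \<theta>" "smooth \<eta>"
  shows "smooth (\<lambda>p :: real \<times> real. \<theta> (fst p) * \<eta> (snd p))"
  using smooth_compose[OF smooth_inner[of e_t] assms(1)] smooth_compose[OF smooth_inner[of e_x] assms(2)]
  by (intro smooth_mult) (auto simp: inner_prod_def)

lemma pderiv_at_tensor:
  assumes "\<And>t. (\<theta> has_real_derivative \<theta>' t) (at t)" "\<And>x. (\<eta> has_real_derivative \<eta>' x) (at x)"
  shows "pderiv_at e_t (\<lambda>p. \<theta> (fst p) * \<eta> (snd p)) = (\<lambda>p. \<theta>' (fst p) * \<eta> (snd p))"
    and "pderiv_at e_x (\<lambda>p. \<theta> (fst p) * \<eta> (snd p)) = (\<lambda>p. \<theta> (fst p) * \<eta>' (snd p))"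
proof -
  have "((\<lambda>p. \<theta> (fst p) * \<eta> (snd p)) has_derivative
     (\<lambda>b. \<theta> (fst p) * (\<eta>' (snd p) * snd b) + \<theta>' (fst p) * fst b * \<eta> (snd p))) (at p)" for p
    by (intro has_derivative_mult has_derivative_compose[OF has_derivative_fst[OF has_derivative_ident]
        assms(1)[unfolded has_field_derivative_def]]
        has_derivative_compose[OF has_derivative_snd[OF has_derivative_ident]
        assms(2)[unfolded has_field_derivative_def]])
  from pderiv_at_eq[OF this]
  show "pderiv_at e_t (\<lambda>p. \<theta> (fst p) * \<eta> (snd p)) = (\<lambda>p. \<theta>' (fst p) * \<eta> (snd p))"
    and "pderiv_at e_x (\<lambda>p. \<theta> (fst p) * \<eta> (snd p)) = (\<lambda>p. \<theta> (fst p) * \<eta>' (snd p))"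
    by auto
qed

section \<open>Testing the weak formulation with ramps in time\<close>

lemma clarke_subdiff_Phi_cases:
  assumes "\<xi> \<in> clarke_subdiff (Phi k) v"
  shows "\<bar>v\<bar> < 1 \<Longrightarrow> \<xi> = k\<^sup>2 * v" "1 < \<bar>v\<bar> \<Longrightarrow> \<xi> = 0" "\<bar>\<xi>\<bar> \<le> k\<^sup>2"
proof -
  have d: "\<xi> = (if \<bar>v\<bar> < 1 then k\<^sup>2 * v else 0)" if "\<bar>v\<bar> \<noteq> 1"
    using assms clarke_subdiff_Phi_smooth[OF that] DERIV_imp_deriv[OF Phi_has_deriv[OF that, of k]] by auto
  then show "\<bar>v\<bar> < 1 \<Longrightarrow> \<xi> = k\<^sup>2 * v" "1 < \<bar>v\<bar> \<Longrightarrow> \<xi> = 0" by auto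
  consider "\<bar>v\<bar> \<noteq> 1" | "v = 1" | "v = - 1" by linarith
  then show "\<bar>\<xi>\<bar> \<le> k\<^sup>2"
  proof cases
    case 1
    then show ?thesis using d by (auto simp: abs_mult intro: mult_left_le)
  qed (use assms clarke_subdiff_Phi_1[of k] clarke_subdiff_Phi_minus_1[of k] in auto)
qed

lemma integrable_times_bounded:
  fixes f g :: "'a \<Rightarrow> real"
  assumes g: "integrable M g" and f: "f \<in> borel_measurable M" and B: "AE x in M. \<bar>f x\<bar> \<le> B"
  shows "integrable M (\<lambda>x. f x * g x)"
proof (rule Bochner_Integration.integrable_bound)
  show "integrable M (\<lambda>x. B * g x)" using g by simp
  show "AE x in M. norm (f x * g x) \<le> norm (B * g x)"
    using B by eventually_elim (auto simp: abs_mult intro!: mult_right_mono)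
qed (intro borel_measurable_times f borel_measurable_integrable[OF g])

lemma integrable_lebesgue_on_superset:
  fixes f :: "'a::euclidean_space \<Rightarrow> real"
  assumes "A \<in> sets lebesgue" "B \<in> sets lebesgue" "A \<subseteq> B" "\<And>x. x \<in> B - A \<Longrightarrow> f x = 0"
  shows "integrable (lebesgue_on B) f \<longleftrightarrow> integrable (lebesgue_on A) f"
    and "integral\<^sup>L (lebesgue_on B) f = integral\<^sup>L (lebesgue_on A) f"
proof -
  have eq: "(\<lambda>x. indicator B x * f x) = (\<lambda>x. indicator A x * f x)"
    using assms(3,4) by (auto simp: indicator_def fun_eq_iff)
  show "integrable (lebesgue_on B) f \<longleftrightarrow> integrable (lebesgue_on A) f"
    "integral\<^sup>L (lebesgue_on B) f = integral\<^sup>L (lebesgue_on A) f"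
    unfolding integrable_lebesgue_on_iff[OF assms(1)] integrable_lebesgue_on_iff[OF assms(2)]
      integral_lebesgue_on_eq[OF assms(1)] integral_lebesgue_on_eq[OF assms(2)] eq by simp_all
qed

section \<open>Continuous integrands on boxes and space-time strips\<close>

lemma lebesgue_on_box_continuous:
  fixes f :: "'a::euclidean_space \<Rightarrow> real"
  assumes "continuous_on (cbox a b) f"
  shows "integrable (lebesgue_on (box a b)) f"
    and "integral\<^sup>L (lebesgue_on (box a b)) f = integral (cbox a b) f"
proof -
  have "f absolutely_integrable_on cbox a b"
    using assms by (rule absolutely_integrable_continuous)
  then have "f absolutely_integrable_on box a b"
    by (rule set_integrable_subset) (auto simp: box_subset_cbox)
  then show i: "integrable (lebesgue_on (box a b)) f"
    by (simp add: integrable_restrict_space set_integrable_def)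
  show "integral\<^sup>L (lebesgue_on (box a b)) f = integral (cbox a b) f"
    using lebesgue_integral_eq_integral[OF i] by (simp add: integral_open_interval)
qed

lemma lebesgue_on_interval_continuous:
  fixes f :: "real \<Rightarrow> real"
  assumes "continuous_on {a..b} f"
  shows "integrable (lebesgue_on {a<..<b}) f"
    and "integral\<^sup>L (lebesgue_on {a<..<b}) f = integral {a..b} f"
  using lebesgue_on_box_continuous[of a b f] assms by (simp_all add: cbox_interval box_real)

abbreviation strip :: "real \<Rightarrow> real \<Rightarrow> real \<Rightarrow> (real \<times> real) set" where
  "strip L a b \<equiv> {a<..<b} \<times> {0<..<L}"

lemma strip_eq_box: "strip L a b = box (a, 0) (b, L)"
  by (auto simp: box_prod box_real)

lemma strip_lmeasurable: "strip L a b \<in> lmeasurable"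
  unfolding strip_eq_box by simp

lemma strip_lebesgue: "strip L a b \<in> sets lebesgue"
  using strip_lmeasurable by (rule fmeasurableD)

lemma space_time_open: "open (space_time L)"
  unfolding space_time_def by (intro open_Times) auto

lemma space_time_lebesgue: "space_time L \<in> sets lebesgue"
  by (intro open_sets_lebesgue space_time_open)

lemma strip_subset_space_time: "0 \<le> a \<Longrightarrow> strip L a b \<subseteq> space_time L"
  by (auto simp: space_time_def)

lemma strip_continuous:
  fixes f :: "real \<times> real \<Rightarrow> real"
  assumes "continuous_on ({a..b} \<times> {0..L}) f"
  shows "integrable (lebesgue_on (strip L a b)) f"
    and "integral\<^sup>L (lebesgue_on (strip L a b)) f = integral {a..b} (\<lambda>t. integral {0..L} (\<lambda>x. f (t, x)))"
proof -
  have c: "continuous_on (cbox (a, 0) (b, L)) f"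
    using assms by (simp add: cbox_Pair_eq box_real)
  show "integrable (lebesgue_on (strip L a b)) f"
    unfolding strip_eq_box by (rule lebesgue_on_box_continuous[OF c])
  show "integral\<^sup>L (lebesgue_on (strip L a b)) f = integral {a..b} (\<lambda>t. integral {0..L} (\<lambda>x. f (t, x)))"
    unfolding strip_eq_box lebesgue_on_box_continuous(2)[OF c] integral_prod_continuous[OF c]
    by (simp add: cbox_interval)
qed

text \<open>\<open>ut\<close> is the classical time derivative of \<open>u\<close>, \<open>g\<close> a Borel version of its weak derivative
  \<open>\<partial>\<^sub>x\<^sub>x u\<close>, and \<open>c0\<close>, \<open>c1\<close> are the constant values of the initial data. Unlike the arbitrary versions
  chosen by \<open>weak_derivs\<close>, \<open>g\<close> is jointly measurable, so that Tonelli's theorem applies.\<close>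

locale plate =
  fixes L \<kappa>1 \<kappa>2 c0 c1 :: real and u ut g h :: "real \<times> real \<Rightarrow> real"
  assumes L_pos: "0 < L" and \<kappa>1_pos: "0 < \<kappa>1" and \<kappa>2_nz: "\<kappa>2 \<noteq> 0"
    and u_cont: "continuous_on ({0..} \<times> {0..L}) u"
    and ut_cont: "continuous_on ({0..} \<times> {0..L}) ut"
    and u_deriv: "\<lbrakk>0 \<le> t; 0 \<le> x; x \<le> L\<rbrakk> \<Longrightarrow>
        ((\<lambda>t. u (t, x)) has_real_derivative ut (t, x)) (at t within {0..})"
    and g_meas: "g \<in> borel_measurable borel"
    and g_int: "integrable (lebesgue_on (strip L 0 T)) g"
    and h_meas: "h \<in> borel_measurable (lebesgue_on (space_time L))"
    and h_subdiff: "AE p in lebesgue_on (space_time L). h p \<in> clarke_subdiff (Phi \<kappa>2) (u p)"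
    and weak_xx: "\<lbrakk>\<psi> \<in> Cc_infinity; closure {p. \<psi> p \<noteq> 0} \<subseteq> space_time L\<rbrakk> \<Longrightarrow>
        (\<integral>p. u p * pderivs [e_x, e_x] \<psi> p \<partial>lebesgue_on (space_time L)) =
        (\<integral>p. g p * \<psi> p \<partial>lebesgue_on (space_time L))"
    and weak: "\<lbrakk>\<phi> \<in> Cc_infinity; \<And>t. pderiv_at e_x \<phi> (t, 0) = 0; \<And>t. pderiv_at e_x \<phi> (t, L) = 0\<rbrakk> \<Longrightarrow>
        (\<integral>p. u p * pderivs [e_t, e_t] \<phi> p + \<kappa>1\<^sup>2 * g p * pderivs [e_x, e_x] \<phi> p + h p * \<phi> p
            \<partial>lebesgue_on (space_time L))
          - c1 * (\<integral>x. \<phi> (0, x) \<partial>lebesgue_on {0<..<L})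
          + c0 * (\<integral>x. pderiv_at e_t \<phi> (0, x) \<partial>lebesgue_on {0<..<L}) = 0"
    and energy_bound: "AE t in lebesgue. 0 < t \<longrightarrow>
        integrable (lebesgue_on {0<..<L}) (\<lambda>x. (g (t, x))\<^sup>2) \<and>
        integral {0..L} (\<lambda>x. (ut (t, x))\<^sup>2 / 2 + Phi \<kappa>2 (u (t, x)))
          + \<kappa>1\<^sup>2 / 2 * (\<integral>x. (g (t, x))\<^sup>2 \<partial>lebesgue_on {0<..<L})
        \<le> L * (c1\<^sup>2 + \<kappa>2\<^sup>2 * c0\<^sup>2) / 2"
    and neumann: "AE t in lebesgue. 0 < t \<longrightarrow>
        ((\<lambda>x. u (t, x)) has_real_derivative 0) (at 0 within {0..L})"
begin

lemma h_bound: "AE p in lebesgue_on (space_time L). \<bar>h p\<bar> \<le> \<kappa>2\<^sup>2"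
  using h_subdiff by eventually_elim (rule clarke_subdiff_Phi_cases(3))

lemma h_int: "integrable (lebesgue_on (strip L 0 T)) h"
proof (rule finite_measure.integrable_const_bound[where B="\<kappa>2\<^sup>2"])
  show "finite_measure (lebesgue_on (strip L 0 T))"
    by (intro finite_measure_lebesgue_on strip_lmeasurable)
  show "h \<in> borel_measurable (lebesgue_on (strip L 0 T))"
    using h_meas by (rule measurable_restrict_mono) (simp add: strip_subset_space_time)
  have "AE p in lebesgue. p \<in> space_time L \<longrightarrow> \<bar>h p\<bar> \<le> \<kappa>2\<^sup>2"
    using h_bound by (simp only: AE_lebesgue_on_iff[OF space_time_lebesgue])
  then have "AE p in lebesgue. p \<in> strip L 0 T \<longrightarrow> \<bar>h p\<bar> \<le> \<kappa>2\<^sup>2"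
    by eventually_elim (use strip_subset_space_time[of 0 T L] in blast)
  then show "AE p in lebesgue_on (strip L 0 T). norm (h p) \<le> \<kappa>2\<^sup>2"
    by (simp only: AE_lebesgue_on_iff[OF strip_lebesgue] real_norm_def)
qed

lemma slice_cont:
  assumes "0 \<le> t" shows "continuous_on {0..L} (\<lambda>x. u (t, x))" "continuous_on {0..L} (\<lambda>x. ut (t, x))"
  using assms
  by (auto intro!: continuous_on_compose2[OF u_cont] continuous_on_compose2[OF ut_cont] continuous_intros)

text \<open>Test with \<open>\<theta>\<^sub>n(t) \<eta>(x)\<close>, where \<open>\<theta>\<^sub>n\<close> tends to \<open>max 0 (a - t)\<close> and \<open>\<theta>\<^sub>n''\<close> to the Dirac mass at \<open>a\<close>.\<close>

lemma duhamel:
  fixes \<eta> \<eta>' \<eta>'' :: "real \<Rightarrow> real"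
  assumes a: "0 \<le> a" and \<eta>: "smooth \<eta>" and supp: "\<And>x. x \<notin> {lo..hi} \<Longrightarrow> \<eta> x = 0"
    and \<eta>': "\<And>x. (\<eta> has_real_derivative \<eta>' x) (at x)" "\<And>x. (\<eta>' has_real_derivative \<eta>'' x) (at x)"
    and \<eta>'_boundary: "\<eta>' 0 = 0" "\<eta>' L = 0"
  shows "integral {0..L} (\<lambda>x. u (a, x) * \<eta> x) = (c0 + a * c1) * integral {0..L} \<eta>
    - (\<integral>p. max 0 (a - fst p) * (h p * \<eta> (snd p) + \<kappa>1\<^sup>2 * g p * \<eta>'' (snd p)) \<partial>lebesgue_on (space_time L))"
proof -
  obtain R R' \<beta> where "ramp R R' \<beta>" using ex_ramp by blast
  then interpret ramp R R' \<beta> .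
  \<comment> \<open>The ramp grows linearly towards negative times and needs a cutoff to become a
    test function. The plateau starts at -1 rather than 0, so that the time derivatives at 0 are
    still those of the ramp.\<close>
  obtain l where l: "smooth l" "\<And>x. x \<in> {- 1..a + 2} \<Longrightarrow> l x = 1" "\<And>x. x \<notin> {- 1 - 1..a + 2 + 1} \<Longrightarrow> l x = 0"
    using ex_smooth_plateau[of "-1" "a + 2"] by blast
  define N where "N n = real (Suc n)" for n
  have N: "1 \<le> N n" and N0: "0 < N n" for n by (simp_all add: N_def)
  define \<rho> where "\<rho> n t = R (N n * (t - a)) / N n" for n t
  define k where "k n t = N n * \<beta> (N n * (t - a))" for n t
  define w where "w p = h p * \<eta> (snd p) + \<kappa>1\<^sup>2 * g p * \<eta>'' (snd p)" for p
  define E where "E = integral {0..L} \<eta>"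
  define U where "U t = integral {0..L} (\<lambda>x. u (t, x) * \<eta> x)" for t
  have s\<eta>': "smooth \<eta>'" and s\<eta>'': "smooth \<eta>''"
    using pderiv_at_real[OF \<eta>'(1)] pderiv_at_real[OF \<eta>'(2)] smooth_pderiv_at[OF \<eta>, of 1] smooth_pderiv_at[of \<eta>' 1]
    by auto
  have big: "N n * (t - a) \<ge> 1" if "t \<ge> a + 1" for t n
    using mult_mono[of 1 "N n" 1 "t - a"] N[of n] that by simp
  have \<rho>_0: "\<rho> n t = 0" and k_0: "k n t = 0" if "t \<ge> a + 1" for n t
    using R_right[OF big[OF that]] \<beta>_right[OF big[OF that]] by (auto simp: \<rho>_def k_def)
  have k_left: "k n t = 0" if "t \<le> a" for n t
    using \<beta>_left[of "N n * (t - a)"] that N[of n] by (simp add: k_def mult_le_0_iff)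
  have \<rho>_bounds: "0 \<le> \<rho> n t" "\<rho> n t \<le> a + 1" if "0 \<le> t" for n t
  proof -
    have N': "0 < N n" "1 / N n \<le> 1" using N[of n] by simp_all
    have "max 0 (a + 1 / N n - t) \<le> a + 1" using N'(2) that a by (intro max.boundedI) linarith+
    then show "\<rho> n t \<le> a + 1"
      unfolding \<rho>_def using scaled_bounds(2)[OF N'(1), of t a] by (rule order_trans[rotated])
    show "0 \<le> \<rho> n t"
      unfolding \<rho>_def using scaled_bounds(1)[OF N'(1), of a t] by (rule order_trans[rotated]) simp
  qed
  have s\<rho>: "smooth (\<rho> n)" for n
    unfolding \<rho>_def by (rule smooth_scaled)
  have ck: "continuous_on A (k n)" for n A
    unfolding k_def
    by (intro continuous_intros continuous_on_compose2[OF smooth_continuous_on[OF smooth_\<beta>, of UNIV]]) auto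
  have c\<eta>: "continuous_on A (\<lambda>p. \<eta> (snd p))" for A :: "(real \<times> real) set"
    by (intro continuous_on_compose2[OF smooth_continuous_on[OF \<eta>, of UNIV]] continuous_intros) auto

  have m: "(\<lambda>p. f (snd p)) \<in> borel_measurable (lebesgue_on S)" "(\<lambda>p. f (fst p)) \<in> borel_measurable (lebesgue_on S)"
    if "smooth f" for f :: "real \<Rightarrow> real" and S :: "(real \<times> real) set"
    by (intro measurable_restrict_space1 continuous_imp_borel_measurable_lebesgue
        continuous_on_compose2[OF smooth_continuous_on[OF that, of UNIV]] continuous_intros, simp)+
  have bdd: "\<exists>B. \<forall>x\<in>{0..L}. \<bar>f x\<bar> \<le> B" if "smooth f" for f :: "real \<Rightarrow> real"
    using compact_imp_bounded[OF compact_continuous_image[OF smooth_continuous_on[OF that] compact_Icc[of 0 L]]]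
    by (auto simp: bounded_iff)
  have times: "integrable (lebesgue_on (strip L 0 T)) (\<lambda>p. f (snd p) * v p)"
    if f: "smooth f" and v: "integrable (lebesgue_on (strip L 0 T)) v" for f v T
  proof -
    obtain B where "\<forall>x\<in>{0..L}. \<bar>f x\<bar> \<le> B" using bdd[OF f] by auto
    then show ?thesis using f
      by (intro integrable_times_bounded[OF v, of _ B] m AE_I2) (auto simp: space_restrict_space)
  qed
  have wi: "integrable (lebesgue_on (strip L 0 T)) w" for T
    using times[OF \<eta> h_int[of T]] times[OF s\<eta>'' g_int[of T]] unfolding w_def[abs_def]
    by (auto simp: mult.assoc mult.commute[of "\<eta>'' _"] mult.commute[of "\<eta> _"])
  have sub: "strip L 0 (a + 1) \<subseteq> space_time L" by (rule strip_subset_space_time) simp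
  note sup = integrable_lebesgue_on_superset[OF strip_lebesgue space_time_lebesgue sub]

  \<comment> \<open>The weak formulation for fixed \<open>n\<close>. From time \<open>a + 1\<close>
    on the ramp and its second derivative vanish, which reduces the integrals to bounded
    strips.\<close>
  have eqn: "integral {a..a + 1} (\<lambda>t. k n t * U t)
      + (\<integral>p. \<rho> n (fst p) * w p \<partial>lebesgue_on (strip L 0 (a + 1))) - c1 * (\<rho> n 0 * E) - c0 * E = 0" for n
  proof -
    define \<theta> where "\<theta> t = \<rho> n t * l t" for t
    have s\<theta>: "smooth \<theta>" unfolding \<theta>_def[abs_def] by (intro smooth_mult s\<rho> l)
    define \<theta>' where "\<theta>' = pderiv_at 1 \<theta>"
    define \<theta>'' where "\<theta>'' = pderiv_at 1 \<theta>'"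
    have s\<theta>': "smooth \<theta>'" unfolding \<theta>'_def using s\<theta> by (rule smooth_pderiv_at) simp
    have d\<theta>: "(\<theta> has_real_derivative \<theta>' t) (at t)" for t
      unfolding \<theta>'_def using s\<theta> by (rule smooth_has_real_derivative)
    have d\<theta>': "(\<theta>' has_real_derivative \<theta>'' t) (at t)" for t
      unfolding \<theta>''_def using s\<theta>' by (rule smooth_has_real_derivative)
    have \<theta>: "\<theta> t = \<rho> n t" if "- 1 \<le> t" for t
      using l(2)[of t] \<rho>_0[of t n] that by (cases "t \<le> a + 2") (auto simp: \<theta>_def)
    have \<theta>': "\<theta>' t = R' (N n * (t - a))" if "- 1 < t" for t
    proof -
      have "(\<theta> has_real_derivative R' (N n * (t - a))) (at t)"
        using scaled_deriv(1)[OF N0]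
        by (rule has_field_derivative_transform_within_open[where S="{-1<..}"])
          (use that \<theta> in \<open>auto simp: \<rho>_def\<close>)
      then show ?thesis using d\<theta> DERIV_unique by blast
    qed
    have \<theta>'': "\<theta>'' t = k n t" if "- 1 < t" for t
    proof -
      have "(\<theta>' has_real_derivative k n t) (at t)"
        using scaled_deriv(2)[OF N0] unfolding k_def
        by (rule has_field_derivative_transform_within_open[where S="{-1<..}"])
          (use that \<theta>' in auto)
      then show ?thesis using d\<theta>' DERIV_unique by blast
    qed
    define \<phi> where "\<phi> = (\<lambda>p :: real \<times> real. \<theta> (fst p) * \<eta> (snd p))"
    have Cc: "\<phi> \<in> Cc_infinity"
      unfolding \<phi>_def
    proof (rule Cc_infinityI(1)[OF smooth_tensor[OF s\<theta> \<eta>], of "{- 2..a + 3} \<times> {lo..hi}"])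
      show "compact ({- 2..a + 3} \<times> {lo..hi})" by (intro compact_Times compact_Icc)
      show "\<theta> (fst p) * \<eta> (snd p) = 0" if "p \<notin> {- 2..a + 3} \<times> {lo..hi}" for p
        using that l(3)[of "fst p"] supp[of "snd p"] by (cases p) (auto simp: \<theta>_def)
    qed
    have \<phi>_t: "pderiv_at e_t \<phi> = (\<lambda>p. \<theta>' (fst p) * \<eta> (snd p))"
      and \<phi>_x: "pderiv_at e_x \<phi> = (\<lambda>p. \<theta> (fst p) * \<eta>' (snd p))"
      unfolding \<phi>_def by (rule pderiv_at_tensor[OF d\<theta> \<eta>'(1)])+
    have \<phi>_tt: "pderivs [e_t, e_t] \<phi> = (\<lambda>p. \<theta>'' (fst p) * \<eta> (snd p))"
      using pderiv_at_tensor(1)[OF d\<theta>' \<eta>'(1)] by (simp add: pderivs_def \<phi>_t)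
    have \<phi>_xx: "pderivs [e_x, e_x] \<phi> = (\<lambda>p. \<theta> (fst p) * \<eta>'' (snd p))"
      using pderiv_at_tensor(2)[OF d\<theta> \<eta>'(2)] by (simp add: pderivs_def \<phi>_x)
    have W: "(\<integral>p. u p * pderivs [e_t, e_t] \<phi> p + \<kappa>1\<^sup>2 * g p * pderivs [e_x, e_x] \<phi> p + h p * \<phi> p
            \<partial>lebesgue_on (space_time L))
          - c1 * (\<integral>x. \<phi> (0, x) \<partial>lebesgue_on {0<..<L})
          + c0 * (\<integral>x. pderiv_at e_t \<phi> (0, x) \<partial>lebesgue_on {0<..<L}) = 0"
      by (rule weak[OF Cc]) (simp_all add: \<phi>_x \<eta>'_boundary)
    have c1: "(\<integral>x. \<phi> (0, x) \<partial>lebesgue_on {0<..<L}) = \<rho> n 0 * E"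
      using lebesgue_on_interval_continuous(2)[OF smooth_continuous_on[OF \<eta>], of 0 L]
      by (simp add: \<phi>_def E_def \<theta>)
    \<comment> \<open>As \<open>0 \<le> a\<close>, the ramp has slope exactly -1 at time 0; this
      turns the \<open>c0\<close> term of the weak formulation into \<open>- c0 * E\<close>.\<close>
    have "R' (N n * (0 - a)) = - 1"
      using N[of n] a by (intro R'_left) (simp add: mult_nonneg_nonneg)
    then have c0: "(\<integral>x. pderiv_at e_t \<phi> (0, x) \<partial>lebesgue_on {0<..<L}) = - E"
      using lebesgue_on_interval_continuous(2)[OF smooth_continuous_on[OF \<eta>], of 0 L]
      by (simp add: \<phi>_t E_def \<theta>')
    let ?F = "\<lambda>p. u p * (k n (fst p) * \<eta> (snd p))"
    have cF: "continuous_on ({a..a+1} \<times> {0..L}) ?F"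
      by (intro continuous_intros c\<eta> continuous_on_compose2[OF ck[of UNIV]] continuous_on_subset[OF u_cont])
        (use a in auto)
    have F0: "?F p = 0" if "p \<in> space_time L - strip L a (a + 1)" for p
      using that k_left[of "fst p" n] k_0[of "fst p" n] by (cases p) (auto simp: space_time_def not_less)
    have supF: "integrable (lebesgue_on (space_time L)) ?F \<longleftrightarrow> integrable (lebesgue_on (strip L a (a + 1))) ?F"
      "integral\<^sup>L (lebesgue_on (space_time L)) ?F = integral\<^sup>L (lebesgue_on (strip L a (a + 1))) ?F"
      by (rule integrable_lebesgue_on_superset[OF strip_lebesgue space_time_lebesgue strip_subset_space_time[OF a]];
          rule F0; assumption)+
    have Fi: "integrable (lebesgue_on (space_time L)) ?F"
      unfolding supF(1) by (rule strip_continuous[OF cF])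
    have FI: "integral\<^sup>L (lebesgue_on (space_time L)) ?F = integral {a..a + 1} (\<lambda>t. k n t * U t)"
      unfolding supF(2) strip_continuous(2)[OF cF] U_def
      by (intro Henstock_Kurzweil_Integration.integral_cong)
        (simp add: mult.left_commute[of "u _"])
    have \<rho>w0: "\<rho> n (fst p) * w p = 0" if "p \<in> space_time L - strip L 0 (a + 1)" for p
      using that \<rho>_0[of "fst p" n] by (cases p) (auto simp: space_time_def not_less)
    have sup\<rho>: "integrable (lebesgue_on (space_time L)) (\<lambda>p. \<rho> n (fst p) * w p) \<longleftrightarrow>
        integrable (lebesgue_on (strip L 0 (a + 1))) (\<lambda>p. \<rho> n (fst p) * w p)"
      "(\<integral>p. \<rho> n (fst p) * w p \<partial>lebesgue_on (space_time L)) =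
        (\<integral>p. \<rho> n (fst p) * w p \<partial>lebesgue_on (strip L 0 (a + 1)))"
      by (rule sup; rule \<rho>w0; assumption)+
    have \<rho>wi: "integrable (lebesgue_on (strip L 0 (a + 1))) (\<lambda>p. \<rho> n (fst p) * w p)"
      using \<rho>_bounds
      by (intro integrable_times_bounded[OF wi, of _ _ "a + 1"] m s\<rho> AE_I2)
        (auto simp: space_restrict_space)
    have "(\<integral>p. u p * pderivs [e_t, e_t] \<phi> p + \<kappa>1\<^sup>2 * g p * pderivs [e_x, e_x] \<phi> p + h p * \<phi> p
            \<partial>lebesgue_on (space_time L)) = (\<integral>p. ?F p + \<rho> n (fst p) * w p \<partial>lebesgue_on (space_time L))"
    proof (rule Bochner_Integration.integral_cong[OF refl])
      fix p assume "p \<in> space (lebesgue_on (space_time L))"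
      then have "0 < fst p" by (auto simp: space_restrict_space space_time_def)
      then show "u p * pderivs [e_t, e_t] \<phi> p + \<kappa>1\<^sup>2 * g p * pderivs [e_x, e_x] \<phi> p + h p * \<phi> p
          = ?F p + \<rho> n (fst p) * w p"
        unfolding \<phi>_tt \<phi>_xx by (simp add: \<theta>'' \<theta> \<phi>_def w_def algebra_simps)
    qed
    also have "\<dots> = integral\<^sup>L (lebesgue_on (space_time L)) ?F + (\<integral>p. \<rho> n (fst p) * w p \<partial>lebesgue_on (space_time L))"
      using Fi \<rho>wi sup\<rho>(1) by (intro Bochner_Integration.integral_add) auto
    finally show ?thesis
      using W unfolding FI c1 c0 sup\<rho>(2) by simp
  qed
  have cU: "continuous_on {a..a+1} U"
    unfolding U_def
    by (rule integral_continuous_on_param[of _ 0 L, unfolded cbox_interval])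
      (auto simp: case_prod_unfold intro!: continuous_intros c\<eta> continuous_on_subset[OF u_cont] a order_trans[OF a])
  have lim1: "(\<lambda>n. integral {a..a + 1} (\<lambda>t. k n t * U t)) \<longlonglongrightarrow> U a"
    using scaled_approximates_identity[OF cU] by (simp only: k_def N_def)
  have lim2: "(\<lambda>n. \<integral>p. \<rho> n (fst p) * w p \<partial>lebesgue_on (strip L 0 (a + 1)))
      \<longlonglongrightarrow> (\<integral>p. max 0 (a - fst p) * w p \<partial>lebesgue_on (strip L 0 (a + 1)))"
  proof (rule integral_dominated_convergence[where w="\<lambda>p. norm ((a + 1) * w p)"])
    show "(\<lambda>p. \<rho> n (fst p) * w p) \<in> borel_measurable (lebesgue_on (strip L 0 (a + 1)))" for n
      by (intro borel_measurable_times m s\<rho> borel_measurable_integrable[OF wi])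
    show "(\<lambda>p. max 0 (a - fst p) * w p) \<in> borel_measurable (lebesgue_on (strip L 0 (a + 1)))"
      by (intro borel_measurable_times borel_measurable_integrable[OF wi] measurable_restrict_space1
          continuous_imp_borel_measurable_lebesgue continuous_intros)
    show "AE p in lebesgue_on (strip L 0 (a + 1)). (\<lambda>n. \<rho> n (fst p) * w p) \<longlonglongrightarrow> max 0 (a - fst p) * w p"
      unfolding \<rho>_def N_def by (intro AE_I2 tendsto_mult_right scaled_tendsto)
    show "AE p in lebesgue_on (strip L 0 (a + 1)). norm (\<rho> n (fst p) * w p) \<le> norm ((a + 1) * w p)" for n
    proof (rule AE_I2)
      fix p assume "p \<in> space (lebesgue_on (strip L 0 (a + 1)))"
      then have "0 \<le> fst p" by (auto simp: space_restrict_space)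
      then show "norm (\<rho> n (fst p) * w p) \<le> norm ((a + 1) * w p)"
        using \<rho>_bounds[of "fst p" n] by (auto simp: abs_mult intro!: mult_right_mono)
    qed
    show "integrable (lebesgue_on (strip L 0 (a + 1))) (\<lambda>p. norm ((a + 1) * w p))"
      using wi by (intro integrable_norm integrable_mult_right)
  qed
  have lim3: "(\<lambda>n. \<rho> n 0) \<longlonglongrightarrow> a"
    using scaled_tendsto[of 0 a] a by (simp add: \<rho>_def N_def)
  \<comment> \<open>In the limit all time derivatives have moved to the kernel: what remains is the
    equation integrated twice in time.\<close>
  have "(\<lambda>n. integral {a..a + 1} (\<lambda>t. k n t * U t)
      + (\<integral>p. \<rho> n (fst p) * w p \<partial>lebesgue_on (strip L 0 (a + 1))) - c1 * (\<rho> n 0 * E) - c0 * E)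
     \<longlonglongrightarrow> U a + (\<integral>p. max 0 (a - fst p) * w p \<partial>lebesgue_on (strip L 0 (a + 1))) - c1 * (a * E) - c0 * E"
    by (intro tendsto_intros lim1 lim2 lim3)
  then have "U a + (\<integral>p. max 0 (a - fst p) * w p \<partial>lebesgue_on (strip L 0 (a + 1))) - c1 * (a * E) - c0 * E = 0"
    unfolding eqn by (simp add: LIMSEQ_const_iff)
  moreover have "(\<integral>p. max 0 (a - fst p) * w p \<partial>lebesgue_on (space_time L))
      = (\<integral>p. max 0 (a - fst p) * w p \<partial>lebesgue_on (strip L 0 (a + 1)))"
    by (rule sup(2)) (auto simp: space_time_def)
  ultimately show ?thesis
    by (simp add: U_def E_def w_def algebra_simps)
qed

end

section \<open>The spatial mean and the energy\<close>

lemma Phi_continuous: "continuous_on A (Phi k)"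
proof -
  have "Phi k = (\<lambda>v. k\<^sup>2 / 2 * min 1 (v\<^sup>2))"
  proof
    fix v :: real
    have "min 1 (v\<^sup>2) = (if \<bar>v\<bar> \<le> 1 then v\<^sup>2 else 1)"
      by (metis abs_square_le_1 min.absorb1 min.absorb2 linear)
    then show "Phi k v = k\<^sup>2 / 2 * min 1 (v\<^sup>2)" by (simp add: Phi_def)
  qed
  then show ?thesis by (simp only:) (intro continuous_intros)
qed

lemma pderiv_at_outside_support:
  fixes f :: "real \<Rightarrow> real"
  assumes "smooth f" "x \<notin> closure {p. f p \<noteq> 0}"
  shows "pderiv_at 1 f x = 0"
proof -
  have "((\<lambda>_. 0) has_real_derivative 0) (at x)" by simp
  then have "(f has_real_derivative 0) (at x)"
    by (rule has_field_derivative_transform_within_open[where S="- closure {p. f p \<noteq> 0}"])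
      (use assms(2) closure_subset[of "{p. f p \<noteq> 0}"] in auto)
  then show ?thesis
    using smooth_has_real_derivative[OF assms(1)] DERIV_unique by blast
qed

lemma continuous_imp_locally_integrable_on:
  fixes f :: "'a::euclidean_space \<Rightarrow> real"
  assumes "continuous_on \<Omega> f" shows "locally_integrable_on f \<Omega>"
  unfolding locally_integrable_on_def
proof (intro allI impI)
  fix K assume K: "compact K \<and> K \<subseteq> \<Omega>"
  then have "integrable lborel (\<lambda>x. indicator K x * f x)"
    using borel_integrable_compact[of K f] assms continuous_on_subset by (auto simp: real_scaleR_def)
  then have "integrable lebesgue (\<lambda>x. indicator K x * f x)"
    using integrable_completion[OF borel_measurable_integrable] by blast
  then show "integrable (lebesgue_on K) f"
    using K fmeasurableD[OF lmeasurable_compact, of K] integrable_lebesgue_on_iff[of K f] by blast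
qed

text \<open>A violation at \<open>t\<close> would persist, by continuity, on an interval to the
  right of \<open>t\<close>, which is not null. Looking to the right covers \<open>t = a\<close> as
  well.\<close>

lemma continuous_AE_le_imp_le:
  fixes f :: "real \<Rightarrow> real"
  assumes cont: "continuous_on {a..} f" and ae: "AE t in lebesgue. a < t \<longrightarrow> f t \<le> c" and t: "a \<le> t"
  shows "f t \<le> c"
proof (rule ccontr)
  assume "\<not> f t \<le> c"
  then obtain d where d: "d > 0" "\<And>s. s \<in> {a..} \<Longrightarrow> dist s t < d \<Longrightarrow> dist (f s) (f t) < f t - c"
    using cont t unfolding continuous_on_iff by (metis atLeast_iff diff_gt_0_iff_gt not_le)
  have "s \<notin> {t<..<t + d}" if "a < s \<longrightarrow> f s \<le> c" for s
    using d(2)[of s] that t by (auto simp: dist_real_def)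
  then have "AE s in lebesgue. s \<notin> {t<..<t + d}"
    using ae by (auto elim: eventually_mono)
  then have "{t<..<t + d} \<in> null_sets lebesgue"
    by (subst AE_iff_null_sets) auto
  then show False using d(1) by (auto simp: null_sets_def)
qed

lemma real_deriv_unique_Icc:
  fixes f :: "real \<Rightarrow> real"
  assumes "a < b" "t \<in> {a..b}" "(f has_real_derivative d) (at t within {a..b})"
    "(f has_real_derivative e) (at t within {a..b})"
  shows "d = e"
  using vector_derivative_unique_within_closed_interval[of a b t f d e] assms
  by (simp add: has_real_derivative_iff_has_vector_derivative cbox_interval)

text \<open>The variance identity: it exhibits the defect in Cauchy-Schwarz against the constant 1
  as an integral of squares.\<close>

lemma integral_square_diff_mean:
  fixes f :: "real \<Rightarrow> real"
  assumes L: "0 < L" and f: "continuous_on {0..L} f"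
  shows "integral {0..L} (\<lambda>x. (f x - integral {0..L} f / L)\<^sup>2)
       = integral {0..L} (\<lambda>x. (f x)\<^sup>2) - (integral {0..L} f)\<^sup>2 / L"
proof -
  let ?m = "integral {0..L} f / L"
  have i: "f integrable_on {0..L}" "(\<lambda>x. (f x)\<^sup>2) integrable_on {0..L}"
    by (intro integrable_continuous_real continuous_intros f)+
  have "((\<lambda>x. (f x)\<^sup>2 - 2 * ?m * f x + ?m\<^sup>2) has_integral
      (integral {0..L} (\<lambda>x. (f x)\<^sup>2) - 2 * ?m * integral {0..L} f + (L - 0) *\<^sub>R ?m\<^sup>2)) {0..L}"
    by (intro has_integral_add has_integral_diff has_integral_mult_right integrable_integral i
        has_integral_const_real[of "?m\<^sup>2" 0 L, simplified] ) (use has_integral_const_real[of "?m\<^sup>2" 0 L] L in auto)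
  then have "integral {0..L} (\<lambda>x. (f x)\<^sup>2 - 2 * ?m * f x + ?m\<^sup>2) =
      integral {0..L} (\<lambda>x. (f x)\<^sup>2) - (integral {0..L} f)\<^sup>2 / L"
    using L by (auto dest!: integral_unique simp: power2_eq_square field_simps)
  then show ?thesis by (simp add: power2_diff algebra_simps)
qed

text \<open>The defect is the integral of the squared deviation from the average. If it is zero,
  continuity makes the deviation vanish at every point and not just almost everywhere.\<close>

lemma Cauchy_Schwarz_mean:
  fixes f :: "real \<Rightarrow> real"
  assumes L: "0 < L" and f: "continuous_on {0..L} f"
  shows "(integral {0..L} f)\<^sup>2 / L \<le> integral {0..L} (\<lambda>x. (f x)\<^sup>2)"
    and "integral {0..L} (\<lambda>x. (f x)\<^sup>2) \<le> (integral {0..L} f)\<^sup>2 / L \<Longrightarrow> x \<in> {0..L} \<Longrightarrow> f x = integral {0..L} f / L"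
proof -
  let ?q = "\<lambda>x. (f x - integral {0..L} f / L)\<^sup>2"
  have c: "continuous_on {0..L} ?q" by (intro continuous_intros f)
  have nn: "0 \<le> integral {0..L} ?q"
    by (intro Henstock_Kurzweil_Integration.integral_nonneg integrable_continuous_real c) auto
  then show "(integral {0..L} f)\<^sup>2 / L \<le> integral {0..L} (\<lambda>x. (f x)\<^sup>2)"
    using integral_square_diff_mean[OF assms] by simp
  assume "integral {0..L} (\<lambda>x. (f x)\<^sup>2) \<le> (integral {0..L} f)\<^sup>2 / L" "x \<in> {0..L}"
  then show "f x = integral {0..L} f / L"
    using nn integral_square_diff_mean[OF assms] integral_eq_0_iff[OF c L] by auto
qed

section \<open>Evolution of the mean and rigidity inside the reaction region\<close>

context plate
begin

text \<open>Despite the name there is no division by \<open>L\<close>: the average is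
  \<open>mean t / L\<close>, which explains the powers of \<open>L\<close> in the energy
  identities.\<close>

definition mean :: "real \<Rightarrow> real" where
  "mean t = integral {0..L} (\<lambda>x. u (t, x))"

definition mean' :: "real \<Rightarrow> real" where
  "mean' t = integral {0..L} (\<lambda>x. ut (t, x))"

lemma continuous_on_slice_integral:
  fixes f :: "real \<times> real \<Rightarrow> real"
  assumes "continuous_on ({0..} \<times> {0..L}) f"
  shows "continuous_on {0..} (\<lambda>t. integral {0..L} (\<lambda>x. f (t, x)))"
  using integral_continuous_on_param[of "{0..}" 0 L "\<lambda>t x. f (t, x)"] assms
  by (simp add: cbox_interval)

lemma mean_cont: "continuous_on {0..} mean" and mean'_cont: "continuous_on {0..} mean'"
  unfolding mean_def[abs_def] mean'_def[abs_def]
  by (intro continuous_on_slice_integral u_cont ut_cont)+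

lemma mean_deriv: "0 \<le> t \<Longrightarrow> (mean has_real_derivative mean' t) (at t within {0..})"
  unfolding mean_def[abs_def] mean'_def
  by (rule leibniz_rule_field_derivative[of "{0..}" 0 L "\<lambda>t x. u (t, x)" "\<lambda>t x. ut (t, x)", unfolded cbox_interval])
    (auto intro: u_deriv integrable_continuous_real slice_cont simp: ut_cont)

text \<open>The bending term is controlled only for almost every time. Without it the energy is
  continuous in time, so the bound extends to every time, including 0.\<close>

lemma energy_le:
  assumes "0 \<le> t"
  shows "integral {0..L} (\<lambda>x. (ut (t, x))\<^sup>2 / 2 + Phi \<kappa>2 (u (t, x))) \<le> L * (c1\<^sup>2 + \<kappa>2\<^sup>2 * c0\<^sup>2) / 2"
proof (rule continuous_AE_le_imp_le[OF _ _ assms])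
  show "continuous_on {0..} (\<lambda>t. integral {0..L} (\<lambda>x. (ut (t, x))\<^sup>2 / 2 + Phi \<kappa>2 (u (t, x))))"
    by (rule continuous_on_slice_integral[where f="\<lambda>p. (ut p)\<^sup>2 / 2 + Phi \<kappa>2 (u p)"])
      (intro continuous_intros ut_cont continuous_on_compose2[OF Phi_continuous[of UNIV] u_cont], auto)
  show "AE t in lebesgue. 0 < t \<longrightarrow> integral {0..L} (\<lambda>x. (ut (t, x))\<^sup>2 / 2 + Phi \<kappa>2 (u (t, x)))
      \<le> L * (c1\<^sup>2 + \<kappa>2\<^sup>2 * c0\<^sup>2) / 2"
    using energy_bound
  proof eventually_elim
    case (elim t)
    have "0 \<le> \<kappa>1\<^sup>2 / 2 * (\<integral>x. (g (t, x))\<^sup>2 \<partial>lebesgue_on {0<..<L})" by simp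
    with elim show ?case by linarith
  qed
qed

text \<open>For \<open>a = 0\<close> the time integral in \<open>duhamel\<close> vanishes.\<close>

lemma initial_value:
  assumes "0 \<le> x" "x \<le> L" shows "u (0, x) = c0"
proof -
  let ?f = "\<lambda>x. u (0, x) - c0"
  have cf: "continuous_on {0..L} ?f" by (intro continuous_intros slice_cont) simp
  have "AE x in lebesgue_on {0<..<L}. ?f x = 0"
  proof (rule fundamental_lemma_calculus_of_variations)
    show "locally_integrable_on ?f {0<..<L}"
      by (rule continuous_imp_locally_integrable_on[OF continuous_on_subset[OF cf]]) auto
    fix \<psi> :: "real \<Rightarrow> real" assume \<psi>: "\<psi> \<in> Cc_infinity" "closure {p. \<psi> p \<noteq> 0} \<subseteq> {0<..<L}"
    note s\<psi> = Cc_infinityD(1)[OF \<psi>(1)]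
    have s\<psi>': "smooth (pderiv_at 1 \<psi>)" using s\<psi> by (rule smooth_pderiv_at) simp
    have "integral {0..L} (\<lambda>x. u (0, x) * \<psi> x) = (c0 + 0 * c1) * integral {0..L} \<psi>
      - (\<integral>p. max 0 (0 - fst p) * (h p * \<psi> (snd p) + \<kappa>1\<^sup>2 * g p * pderiv_at 1 (pderiv_at 1 \<psi>) (snd p))
           \<partial>lebesgue_on (space_time L))"
    proof (rule duhamel[OF order_refl s\<psi> _ smooth_has_real_derivative[OF s\<psi>] smooth_has_real_derivative[OF s\<psi>']])
      show "\<psi> x = 0" if "x \<notin> {0..L}" for x
        using that \<psi>(2) closure_subset[of "{p. \<psi> p \<noteq> 0}"] by fastforce
      show "pderiv_at 1 \<psi> 0 = 0" "pderiv_at 1 \<psi> L = 0"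
        using \<psi>(2) by (auto intro!: pderiv_at_outside_support[OF s\<psi>])
    qed
    also have "(\<integral>p. max 0 (0 - fst p) * (h p * \<psi> (snd p) + \<kappa>1\<^sup>2 * g p * pderiv_at 1 (pderiv_at 1 \<psi>) (snd p))
           \<partial>lebesgue_on (space_time L)) = (\<integral>p. 0 \<partial>lebesgue_on (space_time L))"
      by (intro Bochner_Integration.integral_cong) (auto simp: space_restrict_space space_time_def)
    finally have e: "integral {0..L} (\<lambda>x. u (0, x) * \<psi> x) = c0 * integral {0..L} \<psi>" by simp
    have c\<psi>: "continuous_on {0..L} \<psi>" using s\<psi> by (rule smooth_continuous_on)
    have i: "(\<lambda>x. u (0, x) * \<psi> x) integrable_on {0..L}" "(\<lambda>x. c0 * \<psi> x) integrable_on {0..L}"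
      by (intro integrable_continuous_real continuous_intros c\<psi> slice_cont(1)[OF order_refl])+
    have "(\<integral>x. ?f x * \<psi> x \<partial>lebesgue_on {0<..<L}) = integral {0..L} (\<lambda>x. u (0, x) * \<psi> x - c0 * \<psi> x)"
      by (subst lebesgue_on_interval_continuous) (auto intro!: continuous_intros c\<psi> cf slice_cont(1) simp: left_diff_distrib)
    then show "(\<integral>x. ?f x * \<psi> x \<partial>lebesgue_on {0<..<L}) = 0"
      using e Henstock_Kurzweil_Integration.integral_diff[OF i] by simp
  qed simp
  \<comment> \<open>The integral of the square carries the continuous function from zero almost
    everywhere to zero at every point, end points included.\<close>
  then have "AE x in lebesgue_on {0<..<L}. (?f x)\<^sup>2 = 0" by eventually_elim simp
  then have "(\<integral>x. (?f x)\<^sup>2 \<partial>lebesgue_on {0<..<L}) = 0"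
    by (rule integral_eq_zero_AE)
  then have "integral {0..L} (\<lambda>x. (?f x)\<^sup>2) = 0"
    by (subst (asm) lebesgue_on_interval_continuous) (auto intro!: continuous_intros cf)
  then have "\<forall>x\<in>{0..L}. (?f x)\<^sup>2 = 0"
    by (subst (asm) integral_eq_0_iff) (auto intro!: continuous_intros cf L_pos)
  then show ?thesis using assms by simp
qed

text \<open>A plateau function equal to 1 near [0, L] stands in for the constant 1, which has no
  compact support; its second derivative is zero there and removes the bending term.\<close>

lemma mean_eq:
  assumes a: "0 \<le> a"
  shows "mean a = (c0 + a * c1) * L - (\<integral>p. max 0 (a - fst p) * h p \<partial>lebesgue_on (space_time L))"
proof -
  \<comment> \<open>The margin on both sides of [0, L] makes the first derivative vanish at 0 and
    \<open>L\<close>, as the boundary condition on test functions demands.\<close>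
  obtain \<eta> where \<eta>: "smooth \<eta>" "\<And>x. x \<in> {- 1..L + 1} \<Longrightarrow> \<eta> x = 1" "\<And>x. x \<notin> {- 1 - 1..L + 1 + 1} \<Longrightarrow> \<eta> x = 0"
    using ex_smooth_plateau[of "-1" "L + 1"] by blast
  define \<eta>' where "\<eta>' = pderiv_at 1 \<eta>"
  define \<eta>'' where "\<eta>'' = pderiv_at 1 \<eta>'"
  have s: "smooth \<eta>'" unfolding \<eta>'_def using \<eta>(1) by (rule smooth_pderiv_at) simp
  have d: "(\<eta> has_real_derivative \<eta>' x) (at x)" "(\<eta>' has_real_derivative \<eta>'' x) (at x)" for x
    using smooth_has_real_derivative[OF \<eta>(1)] smooth_has_real_derivative[OF s]
    by (simp_all add: \<eta>'_def \<eta>''_def)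
  have 1: "\<eta>' x = 0" if "x \<in> {- 1<..<L + 1}" for x
  proof -
    have "((\<lambda>_. 1) has_real_derivative 0) (at x)" by simp
    then have "(\<eta> has_real_derivative 0) (at x)"
      by (rule has_field_derivative_transform_within_open[where S="{- 1<..<L + 1}"]) (use that \<eta>(2) in auto)
    then show ?thesis using d(1) DERIV_unique by blast
  qed
  have 2: "\<eta>'' x = 0" if "x \<in> {- 1<..<L + 1}" for x
  proof -
    have "((\<lambda>_. 0) has_real_derivative 0) (at x)" by simp
    then have "(\<eta>' has_real_derivative 0) (at x)"
      by (rule has_field_derivative_transform_within_open[where S="{- 1<..<L + 1}"]) (use that 1 in auto)
    then show ?thesis using d(2) DERIV_unique by blast
  qed
  have "integral {0..L} (\<lambda>x. u (a, x) * \<eta> x) = (c0 + a * c1) * integral {0..L} \<eta>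
    - (\<integral>p. max 0 (a - fst p) * (h p * \<eta> (snd p) + \<kappa>1\<^sup>2 * g p * \<eta>'' (snd p)) \<partial>lebesgue_on (space_time L))"
    by (rule duhamel[OF a \<eta>(1) \<eta>(3) d]) (use 1 L_pos in auto)
  moreover have "integral {0..L} (\<lambda>x. u (a, x) * \<eta> x) = mean a"
    unfolding mean_def by (intro Henstock_Kurzweil_Integration.integral_cong) (simp add: \<eta>(2))
  moreover have "integral {0..L} \<eta> = integral {0..L} (\<lambda>x. 1)"
    by (intro Henstock_Kurzweil_Integration.integral_cong) (simp add: \<eta>(2))
  moreover have "(\<integral>p. max 0 (a - fst p) * (h p * \<eta> (snd p) + \<kappa>1\<^sup>2 * g p * \<eta>'' (snd p)) \<partial>lebesgue_on (space_time L))
      = (\<integral>p. max 0 (a - fst p) * h p \<partial>lebesgue_on (space_time L))"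
    by (intro Bochner_Integration.integral_cong) (auto simp: space_restrict_space space_time_def \<eta>(2) 2)
  ultimately show ?thesis using L_pos by simp
qed

text \<open>Off \<open>|u| = 1\<close> the subdifferential is a single point, so \<open>h\<close> is
  linear in \<open>u\<close> before \<open>T\<close> and zero afterwards. \<open>T = a\<close>
  describes the motion inside, \<open>T < a\<close> the motion after leaving. The kernel
  \<open>a - t\<close> is split so that \<open>a\<close> stands outside the integrands when the
  formula is differentiated.\<close>

lemma mean_eq_integral:
  assumes T: "0 \<le> T" "T \<le> a"
    and inside: "\<And>t x. 0 \<le> t \<Longrightarrow> t < T \<Longrightarrow> 0 \<le> x \<Longrightarrow> x \<le> L \<Longrightarrow> \<bar>u (t, x)\<bar> < 1"
    and outside: "\<And>t x. T < t \<Longrightarrow> t < a \<Longrightarrow> 0 \<le> x \<Longrightarrow> x \<le> L \<Longrightarrow> 1 < \<bar>u (t, x)\<bar>"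
  shows "mean a = (c0 + a * c1) * L - \<kappa>2\<^sup>2 * (a * integral {0..T} mean - integral {0..T} (\<lambda>t. t * mean t))"
proof -
  let ?F = "\<lambda>p. (a - fst p) * (\<kappa>2\<^sup>2 * u p)"
  have ae: "AE p in lebesgue_on (space_time L). max 0 (a - fst p) * h p = indicator (strip L 0 T) p * ?F p"
  proof -
    \<comment> \<open>At time \<open>T\<close> itself neither \<open>inside\<close> nor
      \<open>outside\<close> says anything, but a hyperplane is a null set.\<close>
    have "AE p :: real \<times> real in lebesgue. p \<notin> {p. p \<bullet> (1, 0) = T}"
      using negligible_standard_hyperplane[OF Basis_real_pair(1), of T]
      by (intro AE_not_in) (simp only: negligible_iff_null_sets)
    moreover have "AE p in lebesgue. p \<in> space_time L \<longrightarrow> h p \<in> clarke_subdiff (Phi \<kappa>2) (u p)"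
      using h_subdiff by (simp only: AE_lebesgue_on_iff[OF space_time_lebesgue])
    ultimately have "AE p in lebesgue. p \<in> space_time L \<longrightarrow>
        max 0 (a - fst p) * h p = indicator (strip L 0 T) p * ?F p"
    proof eventually_elim
      case (elim p)
      obtain t x where p: "p = (t, x)" by (cases p)
      show ?case
      proof
        assume "p \<in> space_time L"
        then have tx: "0 < t" "0 < x" "x < L" and s: "h p \<in> clarke_subdiff (Phi \<kappa>2) (u p)"
          using elim p by (auto simp: space_time_def)
        have "t \<noteq> T" using elim p by (auto simp: inner_prod_def)
        then consider "t < T" | "T < t" "t < a" | "T < t" "a \<le> t" by linarith
        then show "max 0 (a - fst p) * h p = indicator (strip L 0 T) p * ?F p"
        proof cases
          case 1
          then have "h p = \<kappa>2\<^sup>2 * u p"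
            using inside[of t x] tx p clarke_subdiff_Phi_cases(1)[OF s] by simp
          then show ?thesis using 1 T tx p by (simp add: indicator_def)
        next
          case 2
          then have "h p = 0"
            using outside[of t x] tx p clarke_subdiff_Phi_cases(2)[OF s] by simp
          then show ?thesis using 2 p by (simp add: indicator_def)
        next
          case 3
          then show ?thesis using p by (simp add: indicator_def)
        qed
      qed
    qed
    then show ?thesis by (simp only: AE_lebesgue_on_iff[OF space_time_lebesgue])
  qed
  have cF: "continuous_on ({0..T} \<times> {0..L}) ?F"
    by (intro continuous_intros continuous_on_subset[OF u_cont]) auto
  have sup: "integral\<^sup>L (lebesgue_on (space_time L)) (\<lambda>p. indicator (strip L 0 T) p * ?F p)
      = integral\<^sup>L (lebesgue_on (strip L 0 T)) (\<lambda>p. indicator (strip L 0 T) p * ?F p)"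
    "integrable (lebesgue_on (space_time L)) (\<lambda>p. indicator (strip L 0 T) p * ?F p)
      \<longleftrightarrow> integrable (lebesgue_on (strip L 0 T)) (\<lambda>p. indicator (strip L 0 T) p * ?F p)"
    by (rule integrable_lebesgue_on_superset[OF strip_lebesgue space_time_lebesgue strip_subset_space_time[OF order_refl]]; simp)+
  have ind: "indicator (strip L 0 T) p * ?F p = ?F p" if "p \<in> space (lebesgue_on (strip L 0 T))" for p
    using that by (simp add: space_restrict_space)
  have iF: "integrable (lebesgue_on (strip L 0 T)) (\<lambda>p. indicator (strip L 0 T) p * ?F p)"
    using strip_continuous(1)[OF cF] by (subst Bochner_Integration.integrable_cong[OF refl ind])
  have "(\<integral>p. max 0 (a - fst p) * h p \<partial>lebesgue_on (space_time L))
      = (\<integral>p. indicator (strip L 0 T) p * ?F p \<partial>lebesgue_on (space_time L))"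
  proof (rule integral_cong_AE)
    show "(\<lambda>p. max 0 (a - fst p) * h p) \<in> borel_measurable (lebesgue_on (space_time L))"
      by (intro borel_measurable_times h_meas measurable_restrict_space1
          continuous_imp_borel_measurable_lebesgue continuous_intros)
    show "(\<lambda>p. indicator (strip L 0 T) p * ?F p) \<in> borel_measurable (lebesgue_on (space_time L))"
      using iF sup(2) by (intro borel_measurable_integrable) blast
  qed (rule ae)
  also have "\<dots> = integral\<^sup>L (lebesgue_on (strip L 0 T)) ?F"
    unfolding sup(1) by (rule Bochner_Integration.integral_cong[OF refl ind])
  also have "\<dots> = integral {0..T} (\<lambda>t. integral {0..L} (\<lambda>x. (a - t) * (\<kappa>2\<^sup>2 * u (t, x))))"
    using strip_continuous(2)[OF cF] by simp
  also have "\<dots> = integral {0..T} (\<lambda>t. \<kappa>2\<^sup>2 * (a * mean t - t * mean t))"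
    by (intro Henstock_Kurzweil_Integration.integral_cong) (simp add: mean_def, simp add: algebra_simps)
  also have "\<dots> = \<kappa>2\<^sup>2 * (a * integral {0..T} mean - integral {0..T} (\<lambda>t. t * mean t))"
  proof -
    have c: "continuous_on {0..T} mean" by (rule continuous_on_subset[OF mean_cont]) auto
    have "(\<lambda>t. a * mean t) integrable_on {0..T}" "(\<lambda>t. t * mean t) integrable_on {0..T}"
      by (intro integrable_continuous_real continuous_intros c)+
    then show ?thesis by (simp add: Henstock_Kurzweil_Integration.integral_diff)
  qed
  finally show ?thesis using mean_eq[of a] T by simp
qed

lemma mean_0: "mean 0 = c0 * L"
  using mean_eq_integral[of 0 0] by simp

lemma mean_deriv_within: "0 \<le> a \<Longrightarrow> t \<in> {a..b} \<Longrightarrow> (mean has_real_derivative mean' t) (at t within {a..b})"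
  by (rule DERIV_subset[OF mean_deriv]) auto

text \<open>Differentiate \<open>mean_eq_integral\<close>, taken with its \<open>T\<close> equal to
  \<open>a\<close>, at \<open>a = t\<close>: the two boundary terms \<open>t * mean t\<close>
  cancel.\<close>

lemma mean'_inside:
  assumes T: "0 < T" and inside: "\<And>t x. 0 \<le> t \<Longrightarrow> t < T \<Longrightarrow> 0 \<le> x \<Longrightarrow> x \<le> L \<Longrightarrow> \<bar>u (t, x)\<bar> < 1"
    and t: "t \<in> {0..T}"
  shows "mean' t = c1 * L - \<kappa>2\<^sup>2 * integral {0..t} mean"
proof -
  have c: "continuous_on {0..T} mean" by (rule continuous_on_subset[OF mean_cont]) auto
  have "((\<lambda>a. (c0 + a * c1) * L - \<kappa>2\<^sup>2 * (a * integral {0..a} mean - integral {0..a} (\<lambda>t. t * mean t)))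
      has_real_derivative (1 * c1) * L - \<kappa>2\<^sup>2 * ((1 * integral {0..t} mean + mean t * t) - t * mean t)) (at t within {0..T})"
    by (intro DERIV_diff DERIV_cmult DERIV_cmult_right DERIV_mult DERIV_ident DERIV_add[of _ 0, simplified] DERIV_const
        integral_has_real_derivative c t continuous_intros)
  then have "(mean has_real_derivative (1 * c1) * L - \<kappa>2\<^sup>2 * ((1 * integral {0..t} mean + mean t * t) - t * mean t)) (at t within {0..T})"
    by (rule has_field_derivative_transform_within[OF _ zero_less_one t])
      (rule mean_eq_integral[symmetric]; use inside in auto)
  from real_deriv_unique_Icc[OF T t mean_deriv_within[OF order_refl t] this] show ?thesis by simp
qed

lemma mean_energy_inside:
  assumes T: "0 < T" and inside: "\<And>t x. 0 \<le> t \<Longrightarrow> t < T \<Longrightarrow> 0 \<le> x \<Longrightarrow> x \<le> L \<Longrightarrow> \<bar>u (t, x)\<bar> < 1"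
    and t: "t \<in> {0..T}"
  shows "(mean' t)\<^sup>2 + \<kappa>2\<^sup>2 * (mean t)\<^sup>2 = L\<^sup>2 * (c1\<^sup>2 + \<kappa>2\<^sup>2 * c0\<^sup>2)"
proof -
  have eq: "mean' t = c1 * L - \<kappa>2\<^sup>2 * integral {0..t} mean" if "t \<in> {0..T}" for t
    by (rule mean'_inside[OF T _ that]) (rule inside)
  have c: "continuous_on {0..T} mean" by (rule continuous_on_subset[OF mean_cont]) auto
  \<comment> \<open>\<open>mean'_inside\<close> presents \<open>mean'\<close> as an antiderivative,
    so the mean has a second time derivative although \<open>u\<close> is only known to be
    C1.\<close>
  have d': "(mean' has_real_derivative - \<kappa>2\<^sup>2 * mean s) (at s within {0..T})" if s: "s \<in> {0..T}" for s
  proof -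
    have "((\<lambda>a. c1 * L - \<kappa>2\<^sup>2 * integral {0..a} mean) has_real_derivative 0 - \<kappa>2\<^sup>2 * mean s) (at s within {0..T})"
      by (intro derivative_intros DERIV_cmult integral_has_real_derivative c s)
    then have "((\<lambda>a. c1 * L - \<kappa>2\<^sup>2 * integral {0..a} mean) has_real_derivative - \<kappa>2\<^sup>2 * mean s) (at s within {0..T})"
      by simp
    then show ?thesis
      by (rule has_field_derivative_transform_within[OF _ zero_less_one s]) (simp add: eq)
  qed
  have "\<exists>C. \<forall>s\<in>{0..T}. (mean' s)\<^sup>2 + \<kappa>2\<^sup>2 * (mean s)\<^sup>2 = C"
  proof (rule has_field_derivative_zero_constant)
    fix s assume s: "s \<in> {0..T}"
    show "((\<lambda>s. (mean' s)\<^sup>2 + \<kappa>2\<^sup>2 * (mean s)\<^sup>2) has_real_derivative 0) (at s within {0..T})"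
      by (rule derivative_eq_intros d'[OF s] mean_deriv_within[OF order_refl s] refl)+ (simp add: algebra_simps)
  qed simp
  then have "(mean' t)\<^sup>2 + \<kappa>2\<^sup>2 * (mean t)\<^sup>2 = (mean' 0)\<^sup>2 + \<kappa>2\<^sup>2 * (mean 0)\<^sup>2"
    using t T by fastforce
  then show ?thesis using eq[of 0] T by (simp add: mean_0 algebra_simps power_mult_distrib)
qed

lemma constant_inside:
  assumes T: "0 < T" and inside: "\<And>t x. 0 \<le> t \<Longrightarrow> t < T \<Longrightarrow> 0 \<le> x \<Longrightarrow> x \<le> L \<Longrightarrow> \<bar>u (t, x)\<bar> < 1"
    and t: "t \<in> {0..T}" and x: "x \<in> {0..L}"
  shows "u (t, x) = mean t / L" "ut (t, x) = mean' t / L" "\<bar>u (t, x)\<bar> \<le> 1"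
proof -
  \<comment> \<open>At time \<open>T\<close> the value \<open>|u| = 1\<close> may occur; the
    quadratic formula for the potential still holds there, so the closed time interval is
    admissible.\<close>
  have le1: "\<bar>u (s, y)\<bar> \<le> 1" if s: "s \<in> {0..T}" and y: "y \<in> {0..L}" for s y
  proof -
    have "continuous_on {0..T} (\<lambda>s. \<bar>u (s, y)\<bar>)"
      using y by (intro continuous_intros continuous_on_compose2[OF u_cont]) auto
    then show ?thesis
      using continuous_le_on_closure[of "{0..<T}" "\<lambda>s. \<bar>u (s, y)\<bar>" s 1] T s inside[of _ y] y by (auto intro: less_imp_le)
  qed
  then show "\<bar>u (t, x)\<bar> \<le> 1" using t x by blast
  have t0: "0 \<le> t" using t by simp
  note cs = slice_cont[OF t0]
  have "integral {0..L} (\<lambda>x. (ut (t, x))\<^sup>2 / 2 + Phi \<kappa>2 (u (t, x)))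
      = integral {0..L} (\<lambda>x. (ut (t, x))\<^sup>2 / 2 + \<kappa>2\<^sup>2 / 2 * (u (t, x))\<^sup>2)"
    by (intro Henstock_Kurzweil_Integration.integral_cong) (use le1 t in \<open>auto simp: Phi_def\<close>)
  also have "\<dots> = integral {0..L} (\<lambda>x. (ut (t, x))\<^sup>2) / 2 + \<kappa>2\<^sup>2 / 2 * integral {0..L} (\<lambda>x. (u (t, x))\<^sup>2)"
    by (subst Henstock_Kurzweil_Integration.integral_add)
      (auto intro!: integrable_continuous_real continuous_intros cs)
  finally have E: "integral {0..L} (\<lambda>x. (ut (t, x))\<^sup>2) + \<kappa>2\<^sup>2 * integral {0..L} (\<lambda>x. (u (t, x))\<^sup>2)
      \<le> L * (c1\<^sup>2 + \<kappa>2\<^sup>2 * c0\<^sup>2)"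
    using energy_le[OF t0] by simp
  have "L * (c1\<^sup>2 + \<kappa>2\<^sup>2 * c0\<^sup>2) = (mean' t)\<^sup>2 / L + \<kappa>2\<^sup>2 * ((mean t)\<^sup>2 / L)"
  proof -
    have "(mean' t)\<^sup>2 + \<kappa>2\<^sup>2 * (mean t)\<^sup>2 = L\<^sup>2 * (c1\<^sup>2 + \<kappa>2\<^sup>2 * c0\<^sup>2)"
      by (rule mean_energy_inside[OF T _ t]) (rule inside)
    then show ?thesis using L_pos by (simp add: field_simps power2_eq_square)
  qed
  \<comment> \<open>The weighted sum of the two square integrals is now bounded above by exactly
    what Cauchy-Schwarz gives as a lower bound, so neither inequality can be strict.\<close>
  note E = E[unfolded this]
  note CS1 = Cauchy_Schwarz_mean[OF L_pos cs(1), folded mean_def]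
  note CS2 = Cauchy_Schwarz_mean[OF L_pos cs(2), folded mean'_def]
  have k: "0 < \<kappa>2\<^sup>2" using \<kappa>2_nz by simp
  have a1: "\<kappa>2\<^sup>2 * ((mean t)\<^sup>2 / L) \<le> \<kappa>2\<^sup>2 * integral {0..L} (\<lambda>x. (u (t, x))\<^sup>2)"
    using CS1(1) k by (intro mult_left_mono) auto
  have "\<kappa>2\<^sup>2 * integral {0..L} (\<lambda>x. (u (t, x))\<^sup>2) \<le> \<kappa>2\<^sup>2 * ((mean t)\<^sup>2 / L)"
    using E CS2(1) by linarith
  then show "u (t, x) = mean t / L"
    using k by (intro CS1(2) x) (simp only: mult_le_cancel_left_pos)
  show "ut (t, x) = mean' t / L"
    using E a1 by (intro CS2(2) x) linarith
qed

end

section \<open>Leaving the reaction region\<close>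

text \<open>Second differences based at 0 give V(y) - V(0) = 2 (V(y/2) - V(0)). By iteration the
  difference quotient at 0 is the same for all points y/2^n, and flatness at 0 forces it to be
  zero.\<close>

lemma midpoint_affine_flat_imp_constant:
  fixes V :: "real \<Rightarrow> real"
  assumes L: "0 < L" and cont: "continuous_on {0..L} V"
    and second_diff: "\<And>c d. 0 < c \<Longrightarrow> 0 < d \<Longrightarrow> c + 2 * d < L \<Longrightarrow> V c - 2 * V (c + d) + V (c + 2 * d) = 0"
    and flat: "(V has_real_derivative 0) (at 0 within {0..L})"
    and x: "x \<in> {0..L}"
  shows "V x = V 0"
proof -
  have mid: "V y - V 0 = 2 * (V (y / 2) - V 0)" if y: "0 < y" "y < L" for y
  proof -
    let ?F = "\<lambda>c. V c - 2 * V (c + y / 2) + V (c + y)"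
    have cF: "continuous_on {0..L - y} ?F"
      using y by (intro continuous_intros continuous_on_compose2[OF cont]) auto
    have "closure {0<..<L - y} = {0..L - y}" using y by simp
    moreover have "?F c = 0" if "c \<in> {0<..<L - y}" for c
      using second_diff[of c "y / 2"] that y by simp
    \<comment> \<open>\<open>second_diff\<close> reaches only interior base points; the base point 0
      is added by continuity.\<close>
    ultimately have "?F 0 = 0"
      using continuous_constant_on_closure[of "{0<..<L - y}" ?F 0 0] cF y by auto
    then show ?thesis by simp
  qed
  have scale: "(V y - V 0) = 2 ^ n * (V (y / 2 ^ n) - V 0)" if y: "0 < y" "y < L" for y n
  proof (induction n)
    case (Suc n)
    have "y / 2 ^ n < L"
      using y by (smt (verit) divide_le_eq_1 le_divide_eq_1 one_le_power divide_left_mono div_by_1 mult_pos_pos zero_less_power)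
    then have "V (y / 2 ^ n) - V 0 = 2 * (V (y / 2 ^ n / 2) - V 0)"
      using y by (intro mid) auto
    then have "V y - V 0 = 2 ^ n * (2 * (V (y / 2 ^ n / 2) - V 0))" using Suc by (simp only:)
    then show ?case by (simp add: mult_ac)
  qed simp
  have eq0: "V y = V 0" if y: "0 < y" "y < L" for y
  proof -
    have lim: "((\<lambda>h. (V h - V 0) / h) \<longlongrightarrow> 0) (at 0 within {0..L})"
      using flat by (simp add: has_field_derivative_iff)
    have "(\<lambda>n. y * (1 / 2) ^ n) \<longlonglongrightarrow> y * 0"
      by (intro tendsto_intros LIMSEQ_realpow_zero) auto
    moreover have "y * (1 / 2) ^ n = y / 2 ^ n" for n by (simp add: power_one_over field_simps)
    ultimately have "(\<lambda>n. y / 2 ^ n) \<longlonglongrightarrow> 0" by simp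
    moreover have "y / 2 ^ n \<in> {0..L} \<and> y / 2 ^ n \<noteq> 0" for n
    proof -
      have "y / 2 ^ n \<le> y / 1" using y by (intro divide_left_mono) auto
      then show ?thesis using y by auto
    qed
    ultimately have "filterlim (\<lambda>n. y / 2 ^ n) (at 0 within {0..L}) sequentially"
      by (simp add: filterlim_at)
    from filterlim_compose[OF lim this]
    have "(\<lambda>n. (V (y / 2 ^ n) - V 0) / (y / 2 ^ n)) \<longlonglongrightarrow> 0" .
    moreover have "(V (y / 2 ^ n) - V 0) / (y / 2 ^ n) = (V y - V 0) / y" for n
      using scale[OF y, of n] by simp
    ultimately have "(\<lambda>n::nat. (V y - V 0) / y) \<longlonglongrightarrow> 0" by (simp only:)
    then have "(V y - V 0) / y = 0" by (simp only: LIMSEQ_const_iff)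
    then show ?thesis using y by simp
  qed
  have "closure {0<..<L} = {0..L}" using L by simp
  then show ?thesis
    using continuous_constant_on_closure[of "{0<..<L}" V "V 0" x] cont x eq0 by auto
qed

text \<open>The sublevel set is compact, so the time coordinate attains its minimum on it. This
  drives both the hitting time of \<open>|u| = 1\<close> and the continuation arguments.\<close>

lemma ex_first_time:
  fixes f :: "real \<times> real \<Rightarrow> real"
  assumes cont: "continuous_on ({a..b} \<times> {0..L}) f"
    and ex: "t \<in> {a..b}" "x \<in> {0..L}" "f (t, x) \<le> c"
  obtains s y where "s \<in> {a..b}" "y \<in> {0..L}" "f (s, y) \<le> c"
    "\<And>r z. a \<le> r \<Longrightarrow> r < s \<Longrightarrow> 0 \<le> z \<Longrightarrow> z \<le> L \<Longrightarrow> c < f (r, z)"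
proof -
  let ?K = "{p \<in> {a..b} \<times> {0..L}. f p \<le> c}"
  have box: "compact ({a..b} \<times> {0..L})" by (intro compact_Times compact_Icc)
  have "closed (({a..b} \<times> {0..L}) \<inter> f -` {..c})"
    by (intro continuous_closed_preimage cont compact_imp_closed[OF box] closed_atMost)
  then have "compact (({a..b} \<times> {0..L}) \<inter> (({a..b} \<times> {0..L}) \<inter> f -` {..c}))"
    by (rule compact_Int_closed[OF box])
  moreover have "({a..b} \<times> {0..L}) \<inter> (({a..b} \<times> {0..L}) \<inter> f -` {..c}) = ?K" by auto
  ultimately have "compact ?K" by simp
  moreover have "?K \<noteq> {}" using ex by auto
  ultimately obtain p where p: "p \<in> ?K" "\<And>q. q \<in> ?K \<Longrightarrow> fst p \<le> fst q"
    using continuous_attains_inf[of ?K fst] continuous_on_fst[OF continuous_on_id] by blast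
  show ?thesis
  proof (rule that[of "fst p" "snd p"])
    fix r z assume "a \<le> r" "r < fst p" "0 \<le> z" "z \<le> L"
    then show "c < f (r, z)" using p(1) p(2)[of "(r, z)"] by (force simp: not_le[symmetric])
  qed (use p(1) in auto)
qed

section \<open>Free motion and stationary states outside the reaction region\<close>

context plate
begin

lemma time_deriv_at:
  assumes "0 < t" "0 \<le> x" "x \<le> L"
  shows "((\<lambda>t. u (t, x)) has_real_derivative ut (t, x)) (at t)"
proof -
  have "at t within {0..} = at t" using assms(1) by (intro at_within_interior) auto
  then show ?thesis using u_deriv[of t x] assms by simp
qed

lemma time_slice_cont: "0 \<le> a \<Longrightarrow> 0 \<le> x \<Longrightarrow> x \<le> L \<Longrightarrow> continuous_on {a..b} (\<lambda>t. u (t, x))"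
  by (intro continuous_on_compose2[OF u_cont] continuous_intros) auto

lemma kinetic_outside:
  assumes t: "0 \<le> t" and out: "\<And>x. 0 \<le> x \<Longrightarrow> x \<le> L \<Longrightarrow> 1 < \<bar>u (t, x)\<bar>"
  shows "integral {0..L} (\<lambda>x. (ut (t, x))\<^sup>2 / 2 + Phi \<kappa>2 (u (t, x)))
    = integral {0..L} (\<lambda>x. (ut (t, x))\<^sup>2) / 2 + L * \<kappa>2\<^sup>2 / 2"
proof -
  have "integral {0..L} (\<lambda>x. (ut (t, x))\<^sup>2 / 2 + Phi \<kappa>2 (u (t, x)))
      = integral {0..L} (\<lambda>x. (ut (t, x))\<^sup>2 / 2 + \<kappa>2\<^sup>2 / 2)"
    using out by (intro Henstock_Kurzweil_Integration.integral_cong) (force simp: Phi_def)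
  also have "\<dots> = integral {0..L} (\<lambda>x. (ut (t, x))\<^sup>2) / 2 + L * \<kappa>2\<^sup>2 / 2"
    using L_pos by (subst Henstock_Kurzweil_Integration.integral_add)
      (auto intro!: integrable_continuous_real continuous_intros slice_cont t)
  finally show ?thesis .
qed

text \<open>After \<open>T\<close> the formula for the mean is affine in time, so
  \<open>mean'\<close> keeps its value. The potential energy is constant outside, and
  \<open>bound\<close> says that what is left of the energy is exactly the kinetic energy of a
  uniform motion with this momentum; equality in Cauchy-Schwarz for \<open>ut\<close>
  follows.\<close>

lemma constant_outside:
  assumes T: "0 < T" "T < b" and inside: "\<And>t x. 0 \<le> t \<Longrightarrow> t < T \<Longrightarrow> 0 \<le> x \<Longrightarrow> x \<le> L \<Longrightarrow> \<bar>u (t, x)\<bar> < 1"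
    and outside: "\<And>t x. T < t \<Longrightarrow> t \<le> b \<Longrightarrow> 0 \<le> x \<Longrightarrow> x \<le> L \<Longrightarrow> 1 < \<bar>u (t, x)\<bar>"
    and bound: "(mean' T)\<^sup>2 + L\<^sup>2 * \<kappa>2\<^sup>2 = L\<^sup>2 * (c1\<^sup>2 + \<kappa>2\<^sup>2 * c0\<^sup>2)"
    and x: "x \<in> {0..L}"
  shows "ut (b, x) = mean' T / L"
proof -
  let ?A = "\<lambda>a. (c0 + a * c1) * L - \<kappa>2\<^sup>2 * (a * integral {0..T} mean - integral {0..T} (\<lambda>t. t * mean t))"
  have eq: "mean a = ?A a" if "a \<in> {T..b}" for a
    by (rule mean_eq_integral) (use that T inside outside in auto)
  have m': "mean' a = c1 * L - \<kappa>2\<^sup>2 * integral {0..T} mean" if a: "a \<in> {T..b}" for a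
  proof -
    have "(?A has_real_derivative c1 * L - \<kappa>2\<^sup>2 * integral {0..T} mean) (at a within {T..b})"
      by (auto intro!: derivative_eq_intros)
    then have "(mean has_real_derivative c1 * L - \<kappa>2\<^sup>2 * integral {0..T} mean) (at a within {T..b})"
      by (rule has_field_derivative_transform_within[OF _ zero_less_one a]) (simp add: eq)
    moreover have "(mean has_real_derivative mean' a) (at a within {T..b})"
      using T a by (intro mean_deriv_within) auto
    ultimately show ?thesis using real_deriv_unique_Icc[OF T(2) a] by blast
  qed
  then have m: "mean' b = mean' T" using T by simp
  have b: "0 \<le> b" using T by simp
  have "integral {0..L} (\<lambda>x. (ut (b, x))\<^sup>2) / 2 + L * \<kappa>2\<^sup>2 / 2 \<le> L * (c1\<^sup>2 + \<kappa>2\<^sup>2 * c0\<^sup>2) / 2"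
    using energy_le[OF b] kinetic_outside[OF b] outside T by simp
  moreover have "L * (c1\<^sup>2 + \<kappa>2\<^sup>2 * c0\<^sup>2) = (mean' T)\<^sup>2 / L + L * \<kappa>2\<^sup>2"
    using bound L_pos by (simp add: field_simps power2_eq_square)
  ultimately have "integral {0..L} (\<lambda>x. (ut (b, x))\<^sup>2) \<le> (mean' b)\<^sup>2 / L"
    unfolding m by linarith
  then show ?thesis
    using Cauchy_Schwarz_mean(2)[OF L_pos slice_cont(2)[OF b], folded mean'_def, OF _ x] m by simp
qed

text \<open>Test functions whose second \<open>x\<close>-derivative tends to
  \<open>\<delta>\<^sub>c - 2 \<delta>\<^bsub>c+d\<^esub> + \<delta>\<^bsub>c+2d\<^esub>\<close>; this combination of ramps has compact support.\<close>

lemma weak_second_difference: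
  fixes V :: "real \<Rightarrow> real"
  assumes T: "0 < T" and V: "continuous_on {0..L} V"
    and stat: "\<And>t x. T \<le> t \<Longrightarrow> 0 \<le> x \<Longrightarrow> x \<le> L \<Longrightarrow> u (t, x) = V x"
    and g0: "AE p in lebesgue. p \<in> {T<..} \<times> {0<..<L} \<longrightarrow> g p = 0"
    and cd: "0 < c" "0 < d" "c + 2 * d < L"
  shows "V c - 2 * V (c + d) + V (c + 2 * d) = 0"
proof -
  obtain R R' \<beta> where "ramp R R' \<beta>" using ex_ramp by blast
  then interpret ramp R R' \<beta> .
  define N where "N n = real (Suc n)" for n
  have N0: "0 < N n" for n by (simp add: N_def)
  define \<rho> where "\<rho> n a t = R (N n * (t - a)) / N n" for n a t
  define \<rho>' where "\<rho>' n a t = R' (N n * (t - a))" for n a t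
  define k where "k n a t = N n * \<beta> (N n * (t - a))" for n a t
  define \<eta> where "\<eta> n x = \<rho> n c x - 2 * \<rho> n (c + d) x + \<rho> n (c + 2 * d) x" for n x
  define \<eta>' where "\<eta>' n x = \<rho>' n c x - 2 * \<rho>' n (c + d) x + \<rho>' n (c + 2 * d) x" for n x
  define \<eta>'' where "\<eta>'' n x = k n c x - 2 * k n (c + d) x + k n (c + 2 * d) x" for n x
  \<comment> \<open>Extension by the boundary values: the approximate identity is stated on
    \<open>{a..a + 1}\<close>, which may stick out of \<open>{0..L}\<close>.\<close>
  define W where "W x = V (max 0 (min L x))" for x
  have WV: "W x = V x" if "x \<in> {0..L}" for x using that by (simp add: W_def)
  have cW: "continuous_on A W" for A
    unfolding W_def[abs_def] using L_pos by (intro continuous_on_compose2[OF V] continuous_intros) auto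
  have ck: "continuous_on A (k n a)" for n a A
    unfolding k_def
    by (intro continuous_intros continuous_on_compose2[OF smooth_continuous_on[OF smooth_\<beta>, of UNIV]]) auto
  have lim: "(\<lambda>n. integral {a..a + 1} (\<lambda>t. k n a t * W t)) \<longlonglongrightarrow> W a" for a
    using scaled_approximates_identity[OF cW, of a] by (simp only: k_def N_def)
  have d\<eta>: "(\<eta> n has_real_derivative \<eta>' n x) (at x)" "(\<eta>' n has_real_derivative \<eta>'' n x) (at x)" for n x
    unfolding \<eta>_def \<eta>'_def \<eta>''_def \<rho>_def \<rho>'_def k_def
    by (intro DERIV_add DERIV_diff DERIV_cmult scaled_deriv N0)+
  have s\<eta>: "smooth (\<eta> n)" for n
  proof -
    have "smooth (\<lambda>x. \<rho> n c x + (- 2) * \<rho> n (c + d) x + \<rho> n (c + 2 * d) x)"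
      unfolding \<rho>_def by (intro smooth_add smooth_mult smooth_const smooth_scaled)
    then show ?thesis by (simp add: \<eta>_def[abs_def])
  qed
  \<comment> \<open>To the left of \<open>c\<close> all three ramps are affine in their nodes, and
    the weights 1, -2, 1 at equidistant nodes annihilate affine functions.\<close>
  have \<eta>_left: "\<eta> n x = 0" if "x \<le> c" for n x
  proof -
    have "R (N n * (x - a)) = R 0 - N n * (x - a)" if "x \<le> a" for a
      using N0[of n] that by (intro R_left) (simp add: mult_nonneg_nonpos)
    then have "\<rho> n a x = R 0 / N n - (x - a)" if "x \<le> a" for a
      using N0[of n] that by (simp add: \<rho>_def diff_divide_distrib)
    then show ?thesis using that cd by (simp add: \<eta>_def)
  qed
  have big: "1 \<le> N n * (x - a)" if "a + 1 / N n \<le> x" for a x n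
    using that N0[of n] by (simp add: field_simps)
  have \<eta>_right: "\<eta> n x = 0" if "c + 2 * d + 1 / N n \<le> x" for n x
    using that cd by (simp add: \<eta>_def \<rho>_def R_right big)
  have k_supp: "k n a x = 0" if "x \<notin> {a..a + 1 / N n}" for n a x
  proof (cases "x \<le> a")
    case True
    then show ?thesis using N0[of n] by (simp add: k_def \<beta>_left mult_nonneg_nonpos)
  next
    case False
    then show ?thesis using that by (simp add: k_def \<beta>_right big)
  qed

  \<comment> \<open>A factor in time, supported where \<open>u\<close> is stationary and
    \<open>g\<close> vanishes; its integral \<open>I\<close> is positive and is divided out at the
    end.\<close>
  define b where "b t = smooth_step (t - T) * smooth_step (T + 1 - t)" for t
  have sb: "smooth b"
    unfolding b_def[abs_def] using smooth_step_affine[of 1 "- T"] smooth_step_affine[of "-1" "T + 1"]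
    by (intro smooth_mult) simp_all
  define I where "I = integral {T..T + 1} b"
  have cb: "continuous_on A b" for A using sb by (rule smooth_continuous_on)
  have "0 \<le> I"
    unfolding I_def
    by (intro Henstock_Kurzweil_Integration.integral_nonneg integrable_continuous_real cb)
      (simp add: b_def smooth_step_bounds)
  moreover have "I \<noteq> 0"
  proof
    assume "I = 0"
    then have "\<forall>t\<in>{T..T + 1}. b t = 0"
      unfolding I_def by (subst (asm) integral_eq_0_iff[OF cb]) (auto simp: b_def smooth_step_bounds)
    then have "b (T + 1 / 2) = 0" by auto
    then show False by (simp add: b_def smooth_step_eq_0_iff)
  qed
  ultimately have I: "0 < I" by simp

  \<comment> \<open>For such \<open>n\<close> the test function is supported in the open strip, as
    \<open>weak_xx\<close> requires.\<close>
  have zero: "integral {0..L} (\<lambda>x. V x * \<eta>'' n x) = 0" if n: "c + 2 * d + 1 / N n < L" for n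
  proof -
    define \<psi> where "\<psi> = (\<lambda>p :: real \<times> real. b (fst p) * \<eta> n (snd p))"
    let ?c' = "c + 2 * d + 1 / N n"
    let ?K = "{T..T + 1} \<times> {c..?c'}"
    have K: "compact ?K" by (intro compact_Times compact_Icc)
    have \<psi>0: "\<psi> p = 0" if "p \<notin> ?K" for p
      using that \<eta>_left[of "snd p" n] \<eta>_right[of n "snd p"]
      by (cases p) (auto simp: \<psi>_def b_def smooth_step_eq_0_iff not_le)
    have s\<psi>: "smooth \<psi>" unfolding \<psi>_def by (rule smooth_tensor[OF sb s\<eta>])
    have sub: "?K \<subseteq> space_time L" using T cd n by (auto simp: space_time_def)
    have \<psi>_xx: "pderivs [e_x, e_x] \<psi> = (\<lambda>p. b (fst p) * \<eta>'' n (snd p))"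
    proof -
      have "pderiv_at e_x \<psi> = (\<lambda>p. b (fst p) * \<eta>' n (snd p))"
        unfolding \<psi>_def by (rule pderiv_at_tensor(2)[OF smooth_has_real_derivative[OF sb] d\<eta>(1)])
      then show ?thesis
        using pderiv_at_tensor(2)[OF smooth_has_real_derivative[OF sb] d\<eta>(2)] by (simp add: pderivs_def)
    qed
    let ?F = "\<lambda>p. u p * (b (fst p) * \<eta>'' n (snd p))"
    have cF: "continuous_on ({T..T + 1} \<times> {0..L}) ?F"
      unfolding \<eta>''_def
      by (intro continuous_intros continuous_on_compose2[OF cb[of UNIV]] continuous_on_compose2[OF ck[of UNIV]]
          continuous_on_subset[OF u_cont]) (use T in auto)
    have "(\<integral>p. u p * pderivs [e_x, e_x] \<psi> p \<partial>lebesgue_on (space_time L)) = (\<integral>p. g p * \<psi> p \<partial>lebesgue_on (space_time L))"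
    proof (rule weak_xx)
      show "\<psi> \<in> Cc_infinity" by (rule Cc_infinityI(1)[OF s\<psi> K]) (rule \<psi>0)
      have "closure {p. \<psi> p \<noteq> 0} \<subseteq> ?K" by (rule Cc_infinityI(2)[OF s\<psi> K]) (rule \<psi>0)
      then show "closure {p. \<psi> p \<noteq> 0} \<subseteq> space_time L" using sub by (rule order_trans)
    qed
    also have "\<dots> = 0"
    proof (rule integral_eq_zero_AE)
      have "AE p in lebesgue. p \<in> space_time L \<longrightarrow> g p * \<psi> p = 0"
        using g0
      proof eventually_elim
        case (elim p)
        obtain t x where p: "p = (t, x)" by (cases p)
        have "\<psi> p = 0" if "t \<le> T" using that by (simp add: p \<psi>_def b_def smooth_step_eq_0_iff)
        then show ?case using elim by (cases "t \<le> T") (auto simp: p space_time_def)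
      qed
      then show "AE p in lebesgue_on (space_time L). g p * \<psi> p = 0"
        by (simp only: AE_lebesgue_on_iff[OF space_time_lebesgue])
    qed
    finally have "integral\<^sup>L (lebesgue_on (space_time L)) ?F = 0" unfolding \<psi>_xx .
    moreover have "integral\<^sup>L (lebesgue_on (space_time L)) ?F = integral\<^sup>L (lebesgue_on (strip L T (T + 1))) ?F"
    proof (rule integrable_lebesgue_on_superset(2)[OF strip_lebesgue space_time_lebesgue strip_subset_space_time])
      fix p assume "p \<in> space_time L - strip L T (T + 1)"
      then have "b (fst p) = 0"
        by (cases p) (auto simp: space_time_def b_def smooth_step_eq_0_iff not_less)
      then show "?F p = 0" by simp
    qed (use T in simp)
    ultimately have "integral {T..T + 1} (\<lambda>t. integral {0..L} (\<lambda>x. u (t, x) * (b t * \<eta>'' n x))) = 0"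
      using strip_continuous(2)[OF cF] by simp
    also have "integral {T..T + 1} (\<lambda>t. integral {0..L} (\<lambda>x. u (t, x) * (b t * \<eta>'' n x)))
        = integral {T..T + 1} (\<lambda>t. b t * integral {0..L} (\<lambda>x. V x * \<eta>'' n x))"
    proof (rule Henstock_Kurzweil_Integration.integral_cong)
      fix t assume t: "t \<in> {T..T + 1}"
      have "integral {0..L} (\<lambda>x. u (t, x) * (b t * \<eta>'' n x)) = integral {0..L} (\<lambda>x. b t * (V x * \<eta>'' n x))"
        using stat t by (intro Henstock_Kurzweil_Integration.integral_cong) simp
      then show "integral {0..L} (\<lambda>x. u (t, x) * (b t * \<eta>'' n x)) = b t * integral {0..L} (\<lambda>x. V x * \<eta>'' n x)"
        by simp
    qed
    also have "\<dots> = I * integral {0..L} (\<lambda>x. V x * \<eta>'' n x)" by (simp add: I_def)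
    finally show ?thesis using I by simp
  qed

  \<comment> \<open>The kernel lives on \<open>{a..a + 1 / N n}\<close>, so the integrals over
    \<open>{0..L}\<close> and over \<open>{a..a + 1}\<close> agree once this short interval fits
    into \<open>{0..L}\<close>.\<close>
  have kV: "(\<lambda>x. k n a x * V x) integrable_on {0..L} \<and>
      integral {0..L} (\<lambda>x. k n a x * V x) = integral {a..a + 1} (\<lambda>t. k n a t * W t)"
    if a: "0 \<le> a" "a + 1 / N n \<le> L" for n a
  proof -
    have i: "(\<lambda>t. k n a t * W t) integrable_on {a..a + 1 / N n}"
      by (intro integrable_continuous_real continuous_intros ck cW)
    have z: "k n a t * W t = 0" if "t \<notin> {a..a + 1 / N n}" for t
      using k_supp[OF that] by simp
    have N1: "1 / N n \<le> 1" by (simp add: N_def)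
    have 1: "((\<lambda>t. k n a t * W t) has_integral integral {a..a + 1 / N n} (\<lambda>t. k n a t * W t)) {0..L}"
      by (rule has_integral_on_superset[OF integrable_integral[OF i] z]) (use a in auto)
    have 2: "((\<lambda>t. k n a t * W t) has_integral integral {a..a + 1 / N n} (\<lambda>t. k n a t * W t)) {a..a + 1}"
      by (rule has_integral_on_superset[OF integrable_integral[OF i] z]) (use N1 in auto)
    have 3: "((\<lambda>x. k n a x * V x) has_integral integral {a..a + 1 / N n} (\<lambda>t. k n a t * W t)) {0..L}"
      using 1 by (rule has_integral_eq[rotated]) (simp add: WV)
    show ?thesis using integral_unique[OF 2] integral_unique[OF 3] 3 by auto
  qed
  let ?J = "\<lambda>n a. integral {a..a + 1} (\<lambda>t. k n a t * W t)"
  have "eventually (\<lambda>n. 1 / N n < L - (c + 2 * d)) sequentially"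
    using order_tendstoD(2)[OF LIMSEQ_Suc[OF lim_1_over_n], of "L - (c + 2 * d)"] cd by (simp add: N_def)
  then have ev: "eventually (\<lambda>n. ?J n c - 2 * ?J n (c + d) + ?J n (c + 2 * d) = 0) sequentially"
  proof eventually_elim
    case (elim n)
    have "integral {0..L} (\<lambda>x. V x * \<eta>'' n x)
        = integral {0..L} (\<lambda>x. k n c x * V x - 2 * (k n (c + d) x * V x) + k n (c + 2 * d) x * V x)"
      by (simp add: \<eta>''_def algebra_simps)
    also have "\<dots> = ?J n c - 2 * ?J n (c + d) + ?J n (c + 2 * d)"
    proof -
      have h: "((\<lambda>x. k n a x * V x) has_integral ?J n a) {0..L}" if "a \<in> {c, c + d, c + 2 * d}" for a
        using kV[of a n] that elim cd by (auto simp: has_integral_iff)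
      show ?thesis
        by (intro integral_unique has_integral_add has_integral_diff has_integral_mult_right h) auto
    qed
    finally show ?case using zero[of n] elim by simp
  qed
  have "(\<lambda>n. ?J n c - 2 * ?J n (c + d) + ?J n (c + 2 * d)) \<longlonglongrightarrow> W c - 2 * W (c + d) + W (c + 2 * d)"
    by (intro tendsto_intros lim)
  from LIMSEQ_unique[OF this tendsto_eventually[OF ev]]
  have "W c - 2 * W (c + d) + W (c + 2 * d) = 0" .
  then show ?thesis using cd by (simp add: WV)
qed

end

text \<open>Tonelli's theorem for the non-negative function \<open>g^2\<close> turns vanishing on
  almost every time slice into vanishing almost everywhere in space-time, without integrability on
  the unbounded strip.\<close>

lemma (in plate) g_zero_AE:
  assumes "0 \<le> T" and "AE t in lebesgue. T < t \<longrightarrow>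
      integrable (lebesgue_on {0<..<L}) (\<lambda>x. (g (t, x))\<^sup>2) \<and>
      (\<integral>x. (g (t, x))\<^sup>2 \<partial>lebesgue_on {0<..<L}) \<le> 0"
  shows "AE p in lebesgue. p \<in> {T<..} \<times> {0<..<L} \<longrightarrow> g p = 0"
proof -
  let ?S = "{T<..} \<times> {0<..<L}"
  let ?F = "\<lambda>p. ennreal (indicator ?S p * (g p)\<^sup>2)"
  have gm [measurable]: "g \<in> borel_measurable borel" by (rule g_meas)
  have S [measurable]: "?S \<in> sets borel"
    by (intro borel_open open_Times) auto
  have Fm: "?F \<in> borel_measurable borel" by measurable
  have "AE t in lborel. (\<integral>\<^sup>+x. ?F (t, x) \<partial>lborel) = 0"
  proof -
    have "AE t in lebesgue. (\<integral>\<^sup>+x. ?F (t, x) \<partial>lborel) = 0"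
      using assms(2)
    proof eventually_elim
      case (elim t)
      show ?case
      proof (cases "T < t")
        case True
        then have i: "integrable (lebesgue_on {0<..<L}) (\<lambda>x. (g (t, x))\<^sup>2)"
          and "(\<integral>x. (g (t, x))\<^sup>2 \<partial>lebesgue_on {0<..<L}) \<le> 0" using elim by auto
        then have "(\<integral>x. (g (t, x))\<^sup>2 \<partial>lebesgue_on {0<..<L}) = 0"
          by (simp add: order_antisym)
        then have "AE x in lebesgue_on {0<..<L}. (g (t, x))\<^sup>2 = 0"
          using integral_nonneg_eq_0_iff_AE[OF i] by simp
        then have "AE x in lebesgue. x \<in> {0<..<L} \<longrightarrow> g (t, x) = 0"
          by (subst (asm) AE_lebesgue_on_iff) auto
        then have "AE x in lborel. x \<in> {0<..<L} \<longrightarrow> g (t, x) = 0"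
          by (simp only: AE_completion_iff)
        then have "AE x in lborel. ?F (t, x) = 0"
          by eventually_elim (auto simp: indicator_def)
        then show ?thesis
          by (subst nn_integral_0_iff_AE) auto
      qed (simp add: indicator_def)
    qed
    then show ?thesis by (simp only: AE_completion_iff)
  qed
  then have "(\<integral>\<^sup>+t. \<integral>\<^sup>+x. ?F (t, x) \<partial>lborel \<partial>lborel) = 0"
    by (subst nn_integral_0_iff_AE) auto
  moreover have "(\<integral>\<^sup>+t. \<integral>\<^sup>+x. ?F (t, x) \<partial>lborel \<partial>lborel) = integral\<^sup>N lborel ?F"
    using lborel.nn_integral_fst[of ?F lborel] Fm by (simp add: lborel_prod)
  ultimately have "AE p in lborel. ?F p = 0"
    using nn_integral_0_iff_AE[of ?F lborel] Fm by simp
  then have "AE p in lborel. p \<in> ?S \<longrightarrow> g p = 0"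
    by eventually_elim (auto simp: indicator_def split: if_splits)
  then show ?thesis by (rule AE_completion)
qed

lemma (in plate) eventually_constant_in_space:
  assumes c0: "\<bar>c0\<bar> < 1" and tbar: "0 < tbar" and out: "\<And>x. x \<in> {0..L} \<Longrightarrow> 1 < \<bar>u (tbar, x)\<bar>"
    and t: "tbar \<le> t" and x: "x \<in> {0..L}" and y: "y \<in> {0..L}"
  shows "u (t, x) = u (t, y)"
proof -
  have cont: "continuous_on ({a..b} \<times> {0..L}) f" if "continuous_on ({0..} \<times> {0..L}) f" "0 \<le> a"
    for a b and f :: "real \<times> real \<Rightarrow> real"
    by (rule continuous_on_subset[OF that(1)]) (use that(2) in auto)
  have L0: "0 \<in> {0..L}" using L_pos by simp
  \<comment> \<open>The hitting time of \<open>|u| = 1\<close>, found as the first time at which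
    \<open>- |u|\<close> is at most -1; by hypothesis this happens at \<open>tbar\<close> at the
    latest.\<close>
  obtain t0 x0 where t0: "t0 \<in> {0..tbar}" "x0 \<in> {0..L}" "- \<bar>u (t0, x0)\<bar> \<le> - 1"
    and before: "\<And>r z. 0 \<le> r \<Longrightarrow> r < t0 \<Longrightarrow> 0 \<le> z \<Longrightarrow> z \<le> L \<Longrightarrow> - 1 < - \<bar>u (r, z)\<bar>"
  proof (rule ex_first_time[of 0 tbar L "\<lambda>p. - \<bar>u p\<bar>" tbar 0 "- 1"])
    show "continuous_on ({0..tbar} \<times> {0..L}) (\<lambda>p. - \<bar>u p\<bar>)"
      by (intro continuous_intros cont u_cont order_refl)
  qed (use tbar out[OF L0] L0 in auto)
  have t0_pos: "0 < t0"
    using t0 initial_value[of x0] c0 by (cases "t0 = 0") auto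
  have inside: "\<bar>u (r, z)\<bar> < 1" if "0 \<le> r" "r < t0" "0 \<le> z" "z \<le> L" for r z
    using before[OF that] by simp
  have t0_in: "t0 \<in> {0..t0}" using t0_pos by simp
  define s where "s = mean t0 / L"
  define w where "w = mean' t0 / L"
  have u_t0: "u (t0, z) = s" and ut_t0: "ut (t0, z) = w" and le1: "\<bar>u (t0, z)\<bar> \<le> 1" if "z \<in> {0..L}" for z
    unfolding s_def w_def by (rule constant_inside[OF t0_pos _ t0_in that]; rule inside; assumption)+
  have s: "\<bar>s\<bar> = 1" using u_t0[OF t0(2)] le1[OF t0(2)] t0(3) by simp
  then have s2: "s\<^sup>2 = 1" using power2_abs[of s] by simp
  have ss: "s * s = 1" using s2 by (simp add: power2_eq_square)
  \<comment> \<open>The oscillator identity at \<open>t0\<close>, where the average of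
    \<open>u\<close> has modulus 1: it fixes how much energy is kinetic at that moment.\<close>
  have bound: "(mean' t0)\<^sup>2 + L\<^sup>2 * \<kappa>2\<^sup>2 = L\<^sup>2 * (c1\<^sup>2 + \<kappa>2\<^sup>2 * c0\<^sup>2)"
  proof -
    have "(mean' t0)\<^sup>2 + \<kappa>2\<^sup>2 * (mean t0)\<^sup>2 = L\<^sup>2 * (c1\<^sup>2 + \<kappa>2\<^sup>2 * c0\<^sup>2)"
      by (rule mean_energy_inside[OF t0_pos _ t0_in]) (rule inside)
    moreover have "(mean t0)\<^sup>2 = L\<^sup>2"
      using s2 L_pos by (simp add: s_def power_divide)
    ultimately show ?thesis by (simp add: mult.commute)
  qed
  \<comment> \<open>If \<open>s * w\<close> were negative, \<open>s * u\<close> would exceed its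
    value 1 shortly before \<open>t0\<close>, against \<open>|u| < 1\<close> there.\<close>
  have sw: "0 \<le> s * w"
  proof (rule ccontr)
    assume "\<not> 0 \<le> s * w"
    then have neg: "s * w < 0" by simp
    have "((\<lambda>t. s * u (t, 0)) has_real_derivative s * w) (at t0)"
      using time_deriv_at[of t0 0] t0_pos L_pos ut_t0[OF L0] by (auto intro!: DERIV_cmult)
    from DERIV_neg_dec_left[OF this neg] obtain d where
      d: "d > 0" "\<And>h. h > 0 \<Longrightarrow> h < d \<Longrightarrow> s * u (t0, 0) < s * u (t0 - h, 0)" by blast
    define h where "h = min (d / 2) (t0 / 2)"
    have h: "0 < h" "h < d" "h < t0" using d(1) t0_pos by (auto simp: h_def)
    have "1 < s * u (t0 - h, 0)" using d(2)[OF h(1,2)] u_t0[OF L0] ss by simp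
    moreover have "s * u (t0 - h, 0) \<le> \<bar>s\<bar> * \<bar>u (t0 - h, 0)\<bar>" by (simp flip: abs_mult)
    moreover have "\<bar>s\<bar> * \<bar>u (t0 - h, 0)\<bar> < 1" using inside[of "t0 - h" 0] h L_pos s by simp
    ultimately show False by linarith
  qed
  show ?thesis
  proof (cases "s * w = 0")
    case False
    with sw have sw: "0 < s * w" by linarith
    \<comment> \<open>While \<open>s * ut\<close> is positive, \<open>s * u\<close> increases from
      its value 1 at \<open>t0\<close>.\<close>
    have s_gt: "1 < \<bar>u (r, z)\<bar>"
      if r: "t0 < r" and z: "0 \<le> z" "z \<le> L" and pos: "\<And>q. t0 \<le> q \<Longrightarrow> q < r \<Longrightarrow> 0 < s * ut (q, z)" for r z
    proof -
      have "s * u (t0, z) < s * u (r, z)"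
      proof (rule DERIV_pos_imp_increasing_open[OF r, of "\<lambda>t. s * u (t, z)"])
        show "\<exists>y. ((\<lambda>t. s * u (t, z)) has_real_derivative y) (at q) \<and> 0 < y" if "t0 < q" "q < r" for q
          using time_deriv_at[of q z] z pos[of q] that t0_pos
          by (intro exI[of _ "s * ut (q, z)"]) (auto intro!: DERIV_cmult)
        show "continuous_on {t0..r} (\<lambda>t. s * u (t, z))"
          using t0_pos z by (intro continuous_intros time_slice_cont) auto
      qed
      also have "s * u (r, z) \<le> \<bar>s\<bar> * \<bar>u (r, z)\<bar>" by (simp flip: abs_mult)
      finally show ?thesis using u_t0[of z] z ss s by simp
    qed
    \<comment> \<open>Continuation: up to and including a first failure time \<open>t1\<close> the
      solution is outside, so \<open>constant_outside\<close> yields the velocity \<open>w\<close>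
      at \<open>t1\<close>, and \<open>s * w\<close> is positive.\<close>
    have pos: "0 < s * ut (r, z)" if r: "t0 \<le> r" and z: "z \<in> {0..L}" for r z
    proof (rule ccontr)
      assume neg: "\<not> 0 < s * ut (r, z)"
      obtain t1 x1 where t1: "t1 \<in> {t0..r}" "x1 \<in> {0..L}" "s * ut (t1, x1) \<le> 0"
        and pos: "\<And>q z. t0 \<le> q \<Longrightarrow> q < t1 \<Longrightarrow> 0 \<le> z \<Longrightarrow> z \<le> L \<Longrightarrow> 0 < s * ut (q, z)"
      proof (rule ex_first_time[of t0 r L "\<lambda>p. s * ut p" r z 0])
        show "continuous_on ({t0..r} \<times> {0..L}) (\<lambda>p. s * ut p)"
          using t0_pos by (intro continuous_intros cont ut_cont) simp
      qed (use r z neg in auto)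
      have "t1 \<noteq> t0" using t1 sw ut_t0[of x1] by auto
      then have lt: "t0 < t1" using t1 by simp
      have "ut (t1, x1) = mean' t0 / L"
      proof (rule constant_outside[OF t0_pos lt _ _ bound t1(2)])
        show "1 < \<bar>u (q, z)\<bar>" if "t0 < q" "q \<le> t1" "0 \<le> z" "z \<le> L" for q z
          by (rule s_gt) (use that pos in auto)
      qed (rule inside)
      then show False using t1(3) sw by (simp add: w_def)
    qed
    have out_all: "1 < \<bar>u (r, z)\<bar>" if "t0 < r" "0 \<le> z" "z \<le> L" for r z
      by (rule s_gt) (use that pos in auto)
    have ut_w: "ut (r, z) = w" if r: "t0 < r" and z: "z \<in> {0..L}" for r z
      unfolding w_def
      by (rule constant_outside[OF t0_pos r _ _ bound z]) (use inside out_all in auto)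
    \<comment> \<open>\<open>|u|\<close> is at most 1 at \<open>t0\<close> but exceeds 1 at
      \<open>tbar\<close>, so \<open>t0\<close> is strictly earlier than
      \<open>tbar\<close>.\<close>
    have "t0 < t"
      using u_t0[OF x] le1[OF x] out[OF x] t t0(1) by (cases "t0 = tbar") auto
    then have "(\<lambda>r. u (r, x) - u (r, y)) t = (\<lambda>r. u (r, x) - u (r, y)) t0"
    proof (rule DERIV_isconst_end)
      show "continuous_on {t0..t} (\<lambda>r. u (r, x) - u (r, y))"
        using x y t0_pos by (intro continuous_intros time_slice_cont) auto
      show "((\<lambda>r. u (r, x) - u (r, y)) has_real_derivative 0) (at r)" if "t0 < r" "r < t" for r
        using DERIV_diff[OF time_deriv_at[of r x] time_deriv_at[of r y]] ut_w[OF that(1)] x y that t0_pos by simp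
    qed
    then show ?thesis using u_t0[OF x] u_t0[OF y] by simp
  next
    case True
    then have "w = 0" using s by auto
    then have m0: "mean' t0 = 0" using L_pos by (simp add: w_def)
    \<comment> \<open>With zero velocity at \<open>t0\<close>, the available energy is exactly the
      potential energy of a state lying entirely outside the reaction region.\<close>
    have e0: "L * (c1\<^sup>2 + \<kappa>2\<^sup>2 * c0\<^sup>2) = L * \<kappa>2\<^sup>2"
      using bound L_pos by (simp add: m0)
    have ut0: "ut (r, z) = 0" if r: "0 \<le> r" and z: "z \<in> {0..L}"
      and o: "\<And>z. 0 \<le> z \<Longrightarrow> z \<le> L \<Longrightarrow> 1 < \<bar>u (r, z)\<bar>" for r z
    proof -
      have "integral {0..L} (\<lambda>x. (ut (r, x))\<^sup>2) \<le> 0"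
        using energy_le[OF r] kinetic_outside[OF r o] e0 by simp
      moreover have c: "continuous_on {0..L} (\<lambda>x. (ut (r, x))\<^sup>2)"
        by (intro continuous_intros slice_cont r)
      moreover have "0 \<le> integral {0..L} (\<lambda>x. (ut (r, x))\<^sup>2)"
        by (intro Henstock_Kurzweil_Integration.integral_nonneg integrable_continuous_real c) simp
      ultimately show ?thesis using integral_eq_0_iff[OF c L_pos] z by auto
    qed
    \<comment> \<open>Condition \<open>o\<close> is imposed only at times before \<open>r\<close>,
      so the conclusion still reaches a first return time and rules it out.\<close>
    have stay: "u (r, z) = u (tbar, z)"
      if r: "tbar \<le> r" and z: "z \<in> {0..L}"
        and o: "\<And>q z. tbar \<le> q \<Longrightarrow> q < r \<Longrightarrow> 0 \<le> z \<Longrightarrow> z \<le> L \<Longrightarrow> 1 < \<bar>u (q, z)\<bar>" for r z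
    proof (cases "r = tbar")
      case False
      with r have "tbar < r" by simp
      then show ?thesis
      proof (rule DERIV_isconst_end[of tbar r "\<lambda>q. u (q, z)"])
        show "continuous_on {tbar..r} (\<lambda>q. u (q, z))" using tbar z by (intro time_slice_cont) auto
        show "((\<lambda>q. u (q, z)) has_real_derivative 0) (at q)" if "tbar < q" "q < r" for q
          using time_deriv_at[of q z] ut0[of q z] o[of q] that tbar z by simp
      qed
    qed simp
    have out_all: "1 < \<bar>u (r, z)\<bar>" if r: "tbar \<le> r" and z: "z \<in> {0..L}" for r z
    proof (rule ccontr)
      assume neg: "\<not> 1 < \<bar>u (r, z)\<bar>"
      obtain t1 x1 where t1: "t1 \<in> {tbar..r}" "x1 \<in> {0..L}" "\<bar>u (t1, x1)\<bar> \<le> 1"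
        and o: "\<And>q z. tbar \<le> q \<Longrightarrow> q < t1 \<Longrightarrow> 0 \<le> z \<Longrightarrow> z \<le> L \<Longrightarrow> 1 < \<bar>u (q, z)\<bar>"
      proof (rule ex_first_time[of tbar r L "\<lambda>p. \<bar>u p\<bar>" r z 1])
        show "continuous_on ({tbar..r} \<times> {0..L}) (\<lambda>p. \<bar>u p\<bar>)"
          using tbar by (intro continuous_intros cont u_cont) simp
      qed (use r z neg in auto)
      have "u (t1, x1) = u (tbar, x1)" by (rule stay) (use t1 o in auto)
      then show False using out[OF t1(2)] t1(3) by simp
    qed
    define V where "V z = u (tbar, z)" for z
    have stat: "u (r, z) = V z" if "tbar \<le> r" "0 \<le> z" "z \<le> L" for r z
      unfolding V_def by (rule stay) (use that out_all in auto)
    have cV: "continuous_on {0..L} V" unfolding V_def[abs_def] using tbar by (intro slice_cont) simp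
    have "AE r in lebesgue. tbar < r \<longrightarrow>
      integrable (lebesgue_on {0<..<L}) (\<lambda>x. (g (r, x))\<^sup>2) \<and>
      (\<integral>x. (g (r, x))\<^sup>2 \<partial>lebesgue_on {0<..<L}) \<le> 0"
      using energy_bound
    proof eventually_elim
      case (elim r)
      show ?case
      proof
        assume r: "tbar < r"
        have r0: "0 \<le> r" using r tbar by simp
        have "integral {0..L} (\<lambda>x. (ut (r, x))\<^sup>2 / 2 + Phi \<kappa>2 (u (r, x)))
            = integral {0..L} (\<lambda>x. (ut (r, x))\<^sup>2) / 2 + L * \<kappa>2\<^sup>2 / 2"
          by (rule kinetic_outside[OF r0]) (use out_all r in auto)
        moreover have "0 \<le> integral {0..L} (\<lambda>x. (ut (r, x))\<^sup>2)"
          by (intro Henstock_Kurzweil_Integration.integral_nonneg integrable_continuous_real continuous_intros slice_cont r0) simp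
        ultimately have "\<kappa>1\<^sup>2 / 2 * (\<integral>x. (g (r, x))\<^sup>2 \<partial>lebesgue_on {0<..<L}) \<le> 0"
          using elim r tbar e0 by auto
        then show "integrable (lebesgue_on {0<..<L}) (\<lambda>x. (g (r, x))\<^sup>2) \<and>
            (\<integral>x. (g (r, x))\<^sup>2 \<partial>lebesgue_on {0<..<L}) \<le> 0"
          using elim r tbar \<kappa>1_pos by (auto simp: mult_le_0_iff)
      qed
    qed
    from g_zero_AE[OF _ this] tbar
    have g0: "AE p in lebesgue. p \<in> {tbar<..} \<times> {0<..<L} \<longrightarrow> g p = 0" by simp
    \<comment> \<open>\<open>V\<close> is the profile at every time from \<open>tbar\<close> on, so
      the Neumann condition at a single later time suffices; the exceptional times form a null set
      and cannot fill an interval.\<close>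
    have flat: "(V has_real_derivative 0) (at 0 within {0..L})"
    proof (rule ccontr)
      assume no: "\<not> (V has_real_derivative 0) (at 0 within {0..L})"
      have "AE r in lebesgue. r \<notin> {tbar<..<tbar + 1}"
        using neumann
      proof eventually_elim
        case (elim r)
        show ?case
        proof
          assume r: "r \<in> {tbar<..<tbar + 1}"
          then have "((\<lambda>z. u (r, z)) has_real_derivative 0) (at 0 within {0..L})"
            using elim tbar by simp
          then have "(V has_real_derivative 0) (at 0 within {0..L})"
            by (rule has_field_derivative_transform_within[OF _ zero_less_one L0]) (use stat r in auto)
          with no show False ..
        qed
      qed
      then have "{tbar<..<tbar + 1} \<in> null_sets lebesgue"
        by (subst AE_iff_null_sets) auto
      then show False by (auto simp: null_sets_def)
    qed
    have const: "V z = V 0" if "z \<in> {0..L}" for z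
      by (rule midpoint_affine_flat_imp_constant[OF L_pos cV _ flat that])
        (rule weak_second_difference[OF tbar cV stat g0])
    have "V x = V y" using const[OF x] const[OF y] by simp
    then show ?thesis using stat[OF t] x y by simp
  qed
qed

section \<open>Dissipative solutions with constant data\<close>

text \<open>Completeness of the Lebesgue measure makes measurability assumptions superfluous here.\<close>

lemma integral_lebesgue_on_cong_AE:
  fixes f g :: "'a::euclidean_space \<Rightarrow> real"
  assumes S: "S \<in> sets lebesgue" and ae: "AE x in lebesgue. x \<in> S \<longrightarrow> f x = g x"
  shows "integral\<^sup>L (lebesgue_on S) f = integral\<^sup>L (lebesgue_on S) g"
    and "integrable (lebesgue_on S) f \<longleftrightarrow> integrable (lebesgue_on S) g"
proof -
  let ?f = "\<lambda>x. indicator S x * f x" and ?g = "\<lambda>x. indicator S x * g x"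
  have eq: "AE x in lebesgue. ?f x = ?g x"
    using ae by eventually_elim (auto simp: indicator_def)
  then have eq': "AE x in lebesgue. ?g x = ?f x" by eventually_elim (rule sym)
  have "integral\<^sup>L lebesgue ?f = integral\<^sup>L lebesgue ?g \<and> (integrable lebesgue ?f \<longleftrightarrow> integrable lebesgue ?g)"
  proof (cases "?f \<in> borel_measurable lebesgue")
    case True
    then have "?g \<in> borel_measurable lebesgue" using eq by (rule borel_measurable_AE)
    then show ?thesis using True eq by (intro conjI integral_cong_AE integrable_cong_AE)
  next
    case False
    then have "?g \<notin> borel_measurable lebesgue" using borel_measurable_AE[OF _ eq'] by blast
    then have "\<not> integrable lebesgue ?g" "\<not> integrable lebesgue ?f"
      using False borel_measurable_integrable by blast+
    then show ?thesis by (simp add: not_integrable_integral_eq)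
  qed
  then show "integral\<^sup>L (lebesgue_on S) f = integral\<^sup>L (lebesgue_on S) g"
    "integrable (lebesgue_on S) f \<longleftrightarrow> integrable (lebesgue_on S) g"
    unfolding integral_lebesgue_on_eq[OF S] integrable_lebesgue_on_iff[OF S] by simp_all
qed

lemma AE_lebesgue_Pair:
  assumes "AE p in (lebesgue :: (real \<times> real) measure). P p"
  shows "AE t in lebesgue. AE x in lebesgue. P (t, x)"
proof -
  have "AE p in lborel \<Otimes>\<^sub>M lborel. P p"
    using assms by (simp only: AE_completion_iff lborel_prod)
  from lborel_pair.AE_pair[OF this] show ?thesis by (simp only: AE_completion_iff)
qed

lemma Ioo_lebesgue: "{a<..<b::real} \<in> sets lebesgue" "{a<..} \<in> sets lebesgue"
  by auto

text \<open>The integral of \<open>\<psi>''\<close> is a difference of boundary values of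
  \<open>\<psi>'\<close>, which are zero. This removes the bending term from the initial energy of
  constant data.\<close>

lemma has_weak_derivs_const:
  fixes v :: "real \<Rightarrow> real"
  assumes L: "0 < L" and v: "AE x in lebesgue_on {0<..<L}. v x = c" and li: "locally_integrable_on v {0<..<L}"
  shows "has_weak_derivs v [1, 1] (\<lambda>_. 0) {0<..<L}"
  unfolding has_weak_derivs_def
proof (intro conjI ballI impI li)
  show "locally_integrable_on (\<lambda>_. 0) {0<..<L}" by (simp add: locally_integrable_on_def)
  fix \<psi> :: "real \<Rightarrow> real" assume \<psi>: "\<psi> \<in> Cc_infinity" "closure {p. \<psi> p \<noteq> 0} \<subseteq> {0<..<L}"
  note s\<psi> = Cc_infinityD(1)[OF \<psi>(1)]
  define \<psi>' where "\<psi>' = pderiv_at 1 \<psi>"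
  define \<psi>'' where "\<psi>'' = pderiv_at 1 \<psi>'"
  have s\<psi>': "smooth \<psi>'" unfolding \<psi>'_def using s\<psi> by (rule smooth_pderiv_at) simp
  have s\<psi>'': "smooth \<psi>''" unfolding \<psi>''_def using s\<psi>' by (rule smooth_pderiv_at) simp
  have "(\<integral>x. v x * \<psi>'' x \<partial>lebesgue_on {0<..<L}) = (\<integral>x. c * \<psi>'' x \<partial>lebesgue_on {0<..<L})"
  proof (rule integral_lebesgue_on_cong_AE(1)[OF Ioo_lebesgue(1)])
    have "AE x in lebesgue. x \<in> {0<..<L} \<longrightarrow> v x = c"
      using v by (simp only: AE_lebesgue_on_iff[OF Ioo_lebesgue(1)])
    then show "AE x in lebesgue. x \<in> {0<..<L} \<longrightarrow> v x * \<psi>'' x = c * \<psi>'' x"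
      by eventually_elim simp
  qed
  also have "\<dots> = c * integral {0..L} \<psi>''"
    using lebesgue_on_interval_continuous(2)[OF smooth_continuous_on[OF s\<psi>'']] by simp
  also have "integral {0..L} \<psi>'' = \<psi>' L - \<psi>' 0"
    using L smooth_has_real_derivative[OF s\<psi>'] unfolding \<psi>''_def
    by (intro integral_unique fundamental_theorem_of_calculus)
      (auto simp flip: has_real_derivative_iff_has_vector_derivative intro: has_field_derivative_at_within)
  also have "\<psi>' L - \<psi>' 0 = 0"
  proof -
    have "0 \<notin> closure {p. \<psi> p \<noteq> 0}" "L \<notin> closure {p. \<psi> p \<noteq> 0}" using \<psi>(2) by auto
    then show ?thesis by (simp add: \<psi>'_def pderiv_at_outside_support[OF s\<psi>])
  qed
  finally show "(\<integral>x. v x * pderivs [1, 1] \<psi> x \<partial>lebesgue_on {0<..<L})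
      = (- 1) ^ length [1::real, 1] * (\<integral>x. 0 * \<psi> x \<partial>lebesgue_on {0<..<L})"
    by (simp add: pderivs_def \<psi>'_def \<psi>''_def)
qed

text \<open>Integration by parts in time: the integral of \<open>u * \<psi>\<close> over [0, L] has
  \<open>?G\<close> integrated in space as its time derivative, and it vanishes at time 0 and at
  times beyond the support. Thus the energy, written with weak derivatives, can be evaluated with
  the continuous \<open>ut\<close>.\<close>

lemma has_weak_derivs_time:
  fixes u ut :: "real \<times> real \<Rightarrow> real"
  assumes L: "0 < L" and u: "continuous_on ({0..} \<times> {0..L}) u" and ut: "continuous_on ({0..} \<times> {0..L}) ut"
    and d: "\<And>t x. 0 \<le> t \<Longrightarrow> 0 \<le> x \<Longrightarrow> x \<le> L \<Longrightarrow>
        ((\<lambda>t. u (t, x)) has_real_derivative ut (t, x)) (at t within {0..})"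
  shows "has_weak_derivs u [e_t] ut (space_time L)"
  unfolding has_weak_derivs_def
proof (intro conjI ballI impI)
  have sub: "space_time L \<subseteq> {0..} \<times> {0..L}" by (auto simp: space_time_def)
  show li: "locally_integrable_on u (space_time L)" "locally_integrable_on ut (space_time L)"
    by (intro continuous_imp_locally_integrable_on continuous_on_subset[OF _ sub] u ut)+
  fix \<psi> :: "real \<times> real \<Rightarrow> real"
  assume \<psi>: "\<psi> \<in> Cc_infinity" "closure {p. \<psi> p \<noteq> 0} \<subseteq> space_time L"
  note s\<psi> = Cc_infinityD(1)[OF \<psi>(1)]
  define \<psi>t where "\<psi>t = pderiv_at e_t \<psi>"
  have s\<psi>t: "smooth \<psi>t" unfolding \<psi>t_def using s\<psi> Basis_real_pair(1) by (rule smooth_pderiv_at)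
  let ?K = "closure {p. \<psi> p \<noteq> 0}"
  have K: "compact ?K" by (rule Cc_infinityD(2)[OF \<psi>(1)])
  have \<psi>0: "\<psi> p = 0" if "p \<notin> ?K" for p using that closure_subset[of "{p. \<psi> p \<noteq> 0}"] by auto
  have \<psi>t0: "\<psi>t p = 0" if "p \<notin> ?K" for p
  proof -
    have "((\<lambda>_. 0) has_derivative (\<lambda>_. 0)) (at p)" by simp
    then have "(\<psi> has_derivative (\<lambda>_. 0)) (at p)"
    proof (rule has_derivative_transform_within_open[where s="- ?K"])
      show "open (- ?K)" by (intro open_Compl closed_closure)
      show "p \<in> - ?K" using that by simp
      show "0 = \<psi> q" if "q \<in> - ?K" for q using \<psi>0[OF ComplD[OF that]] by (rule sym)
    qed
    then have "frechet_derivative \<psi> (at p) = (\<lambda>_. 0)" by (rule frechet_derivative_at[symmetric])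
    then show ?thesis by (simp add: \<psi>t_def pderiv_at_def)
  qed
  obtain T where T: "0 < T" "\<And>p. p \<in> ?K \<Longrightarrow> fst p < T"
  proof -
    obtain B where B: "\<forall>p\<in>?K. norm p \<le> B" using compact_imp_bounded[OF K] by (auto simp: bounded_iff)
    have "fst p < \<bar>B\<bar> + 1" if "p \<in> ?K" for p
      using B that norm_fst_le[of "fst p" "snd p"] by fastforce
    then show thesis by (intro that[of "\<bar>B\<bar> + 1"]) auto
  qed
  have \<psi>d: "((\<lambda>t. \<psi> (t, x)) has_real_derivative \<psi>t (t, x)) (at t)" for t x
  proof -
    have "(\<psi> has_derivative (\<lambda>b. pderiv_at b \<psi> (t, x))) (at (t, x))"
      by (rule pderiv_at_has_derivative[OF smooth_differentiable[OF s\<psi>]])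
    moreover have "((\<lambda>t. (t, x)) has_derivative (\<lambda>h. (h, 0))) (at t)"
      by (auto intro!: derivative_eq_intros)
    ultimately have hd: "((\<lambda>t. \<psi> (t, x)) has_derivative (\<lambda>h. pderiv_at (h, 0) \<psi> (t, x))) (at t)"
      using has_derivative_compose[of "\<lambda>t. (t, x)" "\<lambda>h. (h, 0)" t UNIV \<psi>] by simp
    have "pderiv_at (h, 0) \<psi> (t, x) = \<psi>t (t, x) * h" for h
      using linear_scale[OF has_derivative_linear[OF hd], of h 1] by (simp add: \<psi>t_def mult.commute)
    with hd show ?thesis by (simp add: has_field_derivative_def)
  qed
  let ?G = "\<lambda>p. u p * \<psi>t p + ut p * \<psi> p"
  have cG: "continuous_on ({0..T} \<times> {0..L}) ?G"
    by (intro continuous_intros continuous_on_subset[OF u] continuous_on_subset[OF ut] smooth_continuous_on s\<psi> s\<psi>t) auto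
  have ST: "p \<notin> ?K" if "p \<in> space_time L - strip L 0 T" for p
    using that T(2)[of p] by (cases p) (auto simp: space_time_def)
  have "integral\<^sup>L (lebesgue_on (space_time L)) ?G = integral\<^sup>L (lebesgue_on (strip L 0 T)) ?G"
    by (rule integrable_lebesgue_on_superset(2)[OF strip_lebesgue space_time_lebesgue strip_subset_space_time])
      (simp_all only: \<psi>0[OF ST] \<psi>t0[OF ST] order_refl mult_zero_right add_0_left)
  also have "\<dots> = integral {0..T} (\<lambda>t. integral {0..L} (\<lambda>x. ?G (t, x)))"
    by (rule strip_continuous(2)[OF cG])
  also have "\<dots> = integral {0..L} (\<lambda>x. u (T, x) * \<psi> (T, x)) - integral {0..L} (\<lambda>x. u (0, x) * \<psi> (0, x))"
  proof (rule integral_unique, rule fundamental_theorem_of_calculus)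
    fix t assume t: "t \<in> {0..T}"
    have "((\<lambda>t. integral (cbox 0 L) (\<lambda>x. u (t, x) * \<psi> (t, x))) has_field_derivative
        integral (cbox 0 L) (\<lambda>x. u (t, x) * \<psi>t (t, x) + ut (t, x) * \<psi> (t, x))) (at t within {0..T})"
    proof (rule leibniz_rule_field_derivative)
      show "((\<lambda>t. u (t, x) * \<psi> (t, x)) has_real_derivative u (r, x) * \<psi>t (r, x) + ut (r, x) * \<psi> (r, x)) (at r within {0..T})"
        if "r \<in> {0..T}" "x \<in> cbox 0 L" for r x
        using that DERIV_subset[OF d[of r x], of "{0..T}"] has_field_derivative_at_within[OF \<psi>d[of x r], of "{0..T}"]
        by (auto intro!: derivative_eq_intros)
      show "(\<lambda>x. u (r, x) * \<psi> (r, x)) integrable_on cbox 0 L" if "r \<in> {0..T}" for r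
        using that by (intro integrable_continuous continuous_intros continuous_on_compose2[OF u]
            continuous_on_compose2[OF smooth_continuous_on[OF s\<psi>, of UNIV]]) auto
      show "continuous_on ({0..T} \<times> cbox 0 L) (\<lambda>(r, x). u (r, x) * \<psi>t (r, x) + ut (r, x) * \<psi> (r, x))"
        using cG by (simp add: case_prod_unfold cbox_interval)
    qed (use t in auto)
    then show "((\<lambda>t. integral {0..L} (\<lambda>x. u (t, x) * \<psi> (t, x))) has_vector_derivative
        integral {0..L} (\<lambda>x. ?G (t, x))) (at t within {0..T})"
      by (simp add: has_real_derivative_iff_has_vector_derivative cbox_interval)
  qed (use T in simp)
  also have "\<dots> = 0"
  proof -
    have "\<psi> (T, x) = 0" "\<psi> (0, x) = 0" for x
      using \<psi>0 T(2)[of "(T, x)"] \<psi>(2) by (force simp: space_time_def)+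
    then show ?thesis by simp
  qed
  finally have 0: "integral\<^sup>L (lebesgue_on (space_time L)) ?G = 0" .
  have i1: "integrable (lebesgue_on (space_time L)) (\<lambda>p. u p * \<psi>t p)"
    by (rule locally_integrable_times_test_aux[OF space_time_open li(1) K \<psi>(2) smooth_continuous_on[OF s\<psi>t] \<psi>t0])
  have i2: "integrable (lebesgue_on (space_time L)) (\<lambda>p. ut p * \<psi> p)"
    by (rule locally_integrable_times_test[OF space_time_open li(2) \<psi>])
  show "(\<integral>p. u p * pderivs [e_t] \<psi> p \<partial>lebesgue_on (space_time L))
      = (- 1) ^ length [e_t] * (\<integral>p. ut p * \<psi> p \<partial>lebesgue_on (space_time L))"
    using 0 Bochner_Integration.integral_add[OF i1 i2] by (simp add: pderivs_def flip: \<psi>t_def)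
qed

lemma C1_on_time_derivative:
  assumes "C1_on ({0..} \<times> {0..L}) u"
  obtains ut where "continuous_on ({0..} \<times> {0..L}) ut"
    and "\<And>t x. 0 \<le> t \<Longrightarrow> 0 \<le> x \<Longrightarrow> x \<le> L \<Longrightarrow>
        ((\<lambda>t. u (t, x)) has_real_derivative ut (t, x)) (at t within {0..})"
proof -
  let ?S = "{0..} \<times> {0..L}"
  obtain f' :: "real \<times> real \<Rightarrow> (real \<times> real) \<Rightarrow>\<^sub>L real" where
    f': "\<And>p. p \<in> ?S \<Longrightarrow> (u has_derivative blinfun_apply (f' p)) (at p within ?S)" "continuous_on ?S f'"
    using assms unfolding C1_on_def by blast
  show thesis
  proof (rule that[of "\<lambda>p. blinfun_apply (f' p) e_t"])
    show "continuous_on ?S (\<lambda>p. blinfun_apply (f' p) e_t)"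
      by (intro continuous_intros f'(2))
    fix t x :: real assume tx: "0 \<le> t" "0 \<le> x" "x \<le> L"
    have "((\<lambda>t. (t, x)) has_derivative (\<lambda>h. (h, 0))) (at t within {0..})"
      by (auto intro!: derivative_eq_intros)
    moreover have "(u has_derivative blinfun_apply (f' (t, x))) (at (t, x) within (\<lambda>t. (t, x)) ` {0..})"
      by (rule has_derivative_subset[OF f'(1)]) (use tx in auto)
    ultimately have hd: "((\<lambda>t. u (t, x)) has_derivative (\<lambda>h. blinfun_apply (f' (t, x)) (h, 0))) (at t within {0..})"
      using has_derivative_in_compose by blast
    have "blinfun_apply (f' (t, x)) (h, 0) = blinfun_apply (f' (t, x)) e_t * h" for h
      using blinfun.scaleR_right[of "f' (t, x)" h "e_t"] by (simp add: mult.commute)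
    then have "(\<lambda>h. blinfun_apply (f' (t, x)) (h, 0)) = (*) (blinfun_apply (f' (t, x)) e_t)"
      by (rule ext)
    with hd show "((\<lambda>t. u (t, x)) has_real_derivative blinfun_apply (f' (t, x)) e_t) (at t within {0..})"
      unfolding has_field_derivative_def by metis
  qed
qed

section \<open>Borel versions and square-integrable slices\<close>

lemma lebesgue_on_ex_borel_version:
  fixes f :: "'a::euclidean_space \<Rightarrow> real"
  assumes S: "S \<in> sets lebesgue" and f: "f \<in> borel_measurable (lebesgue_on S)"
  obtains g where "g \<in> borel_measurable borel" "AE x in lebesgue. x \<in> S \<longrightarrow> f x = g x"
proof -
  have "(\<lambda>x. indicator S x * f x) \<in> borel_measurable lebesgue"
    using f S borel_measurable_restrict_space_iff[of S lebesgue f] by simp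
  then obtain g where g: "g \<in> borel_measurable lborel" "AE x in lborel. indicator S x * f x = g x"
    using completion_ex_borel_measurable_real by blast
  have "AE x in lborel. x \<in> S \<longrightarrow> f x = g x"
    using g(2) by eventually_elim auto
  then show thesis using g(1) by (intro that AE_completion) simp
qed

lemma L2_norm_on_le_imp:
  assumes "L2_norm_on S f \<le> C"
  shows "(\<integral>x. (f x)\<^sup>2 \<partial>lebesgue_on S) \<le> C\<^sup>2"
proof -
  have nn: "0 \<le> (\<integral>x. (f x)\<^sup>2 \<partial>lebesgue_on S)" by simp
  then have "(\<integral>x. (f x)\<^sup>2 \<partial>lebesgue_on S) = (L2_norm_on S f)\<^sup>2" by (simp add: L2_norm_on_def)
  also have "\<dots> \<le> C\<^sup>2" using assms nn by (intro power_mono) (simp_all add: L2_norm_on_def)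
  finally show ?thesis .
qed

text \<open>By Tonelli the uniform bound on slices makes \<open>g\<close> square integrable on the
  bounded strip, and on a set of finite measure this implies integrability.\<close>

lemma integrable_strip_of_slices:
  fixes g :: "real \<times> real \<Rightarrow> real"
  assumes g [measurable]: "g \<in> borel_measurable borel"
    and slices: "AE t in lebesgue. 0 < t \<longrightarrow>
      integrable (lebesgue_on {0<..<L}) (\<lambda>x. (g (t, x))\<^sup>2) \<and> (\<integral>x. (g (t, x))\<^sup>2 \<partial>lebesgue_on {0<..<L}) \<le> C"
  shows "integrable (lebesgue_on (strip L 0 T)) g"
proof -
  have S [measurable]: "strip L 0 T \<in> sets borel" by (intro borel_open open_Times) auto
  let ?f = "\<lambda>p. indicator (strip L 0 T) p * (g p)\<^sup>2"
  let ?F = "\<lambda>p. ennreal (?f p)"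
  have f: "?f \<in> borel_measurable borel" by measurable
  have "AE t in lebesgue. (\<integral>\<^sup>+x. ?F (t, x) \<partial>lborel) \<le> ennreal C * indicator {0<..<T} t"
    using slices
  proof eventually_elim
    case (elim t)
    show ?case
    proof (cases "t \<in> {0<..<T}")
      case True
      let ?h = "\<lambda>x. indicator {0<..<L} x * (g (t, x))\<^sup>2"
      have hm: "?h \<in> borel_measurable lborel" by measurable
      have "integrable lebesgue ?h" and le: "integral\<^sup>L lebesgue ?h \<le> C"
        using elim True by (auto simp: integrable_lebesgue_on_iff integral_lebesgue_on_eq)
      then have "integrable lborel ?h" "integral\<^sup>L lborel ?h \<le> C"
        using integrable_completion[OF hm] integral_completion[OF hm] by auto
      then have "(\<integral>\<^sup>+x. ennreal (?h x) \<partial>lborel) \<le> ennreal C"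
        by (subst nn_integral_eq_integral) (auto intro: ennreal_leI)
      moreover have "(\<lambda>x. ?F (t, x)) = (\<lambda>x. ennreal (?h x))"
        using True by (auto simp: indicator_def fun_eq_iff)
      ultimately show ?thesis using True by (simp only: indicator_simps mult_1_right)
    next
      case False
      then have "?F (t, x) = 0" for x by (auto simp: indicator_def)
      then show ?thesis by (simp only: nn_integral_const mult_zero_left zero_le)
    qed
  qed
  then have "AE t in lborel. (\<integral>\<^sup>+x. ?F (t, x) \<partial>lborel) \<le> ennreal C * indicator {0<..<T} t"
    by (simp only: AE_completion_iff)
  then have "(\<integral>\<^sup>+t. \<integral>\<^sup>+x. ?F (t, x) \<partial>lborel \<partial>lborel) \<le> (\<integral>\<^sup>+t. ennreal C * indicator {0<..<T} t \<partial>lborel)"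
    by (rule nn_integral_mono_AE)
  also have "\<dots> < \<infinity>"
    using emeasure_bounded_finite[OF bounded_box[of 0 T]]
    by (subst nn_integral_cmult_indicator) (auto simp: ennreal_mult_less_top box_real)
  finally have "(\<integral>\<^sup>+p. ?F p \<partial>lborel) < \<infinity>"
    using lborel.nn_integral_fst[of ?F lborel] f by (simp add: lborel_prod)
  then have "integrable lborel ?f"
    using f by (intro integrableI_bounded) auto
  then have "integrable lebesgue ?f"
    using integrable_completion[of ?f lborel] f by simp
  then have "integrable (lebesgue_on (strip L 0 T)) (\<lambda>p. (g p)\<^sup>2)"
    by (simp only: integrable_lebesgue_on_iff[OF strip_lebesgue])
  moreover have "g \<in> borel_measurable (lebesgue_on (strip L 0 T))"
    using g by (intro measurable_restrict_space1 measurable_completion) simp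
  ultimately show ?thesis
    using finite_measure.square_integrable_imp_integrable[OF finite_measure_lebesgue_on[OF strip_lmeasurable]] by blast
qed

lemma dissipative_solution_imp_plate:
  fixes L \<kappa>1 \<kappa>2 c0 c1 :: real
  assumes L: "0 < L" and \<kappa>: "0 < \<kappa>1" "\<kappa>2 \<noteq> 0" and v0: "v0 \<in> H2_space {0<..<L}"
    and u: "dissipative_solution \<kappa>1 \<kappa>2 L v0 v1 u"
    and c0: "AE x in lebesgue_on {0<..<L}. v0 x = c0" and c1: "AE x in lebesgue_on {0<..<L}. v1 x = c1"
    and C1: "C1_on ({0..} \<times> {0..L}) u"
  shows "\<exists>ut g h. plate L \<kappa>1 \<kappa>2 c0 c1 u ut g h"
proof -
  let ?ST = "space_time L"
  have ST: "?ST = {0<..} \<times> {0<..<L}" by (simp add: space_time_def)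
  note AE_ST = AE_lebesgue_on_iff[OF space_time_lebesgue]
  note AE_x = AE_lebesgue_on_iff[OF Ioo_lebesgue(1)]
  note AE_t = AE_lebesgue_on_iff[OF Ioo_lebesgue(2)]
  have u_cont: "continuous_on ({0..} \<times> {0..L}) u"
    using u by (simp add: dissipative_solution_def)
  obtain ut where ut: "continuous_on ({0..} \<times> {0..L}) ut"
    "\<And>t x. 0 \<le> t \<Longrightarrow> 0 \<le> x \<Longrightarrow> x \<le> L \<Longrightarrow>
        ((\<lambda>t. u (t, x)) has_real_derivative ut (t, x)) (at t within {0..})"
    using C1_on_time_derivative[OF C1] by blast
  \<comment> \<open>Three versions of the second space derivative meet here: \<open>gL\<close> with
    uniformly bounded slices, the chosen \<open>gx\<close> that occurs in the energy and in the weak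
    formulation, and the Borel function \<open>g\<close>. Uniqueness identifies them almost
    everywhere.\<close>
  obtain gL where gL: "gL \<in> Linf_L2 {0<..} {0<..<L}" "has_weak_derivs u [e_x, e_x] gL ?ST"
    using u unfolding dissipative_solution_def by blast
  define gx where "gx = weak_derivs ?ST [e_x, e_x] u"
  define gt where "gt = weak_derivs ?ST [e_t] u"
  have gx: "has_weak_derivs u [e_x, e_x] gx ?ST"
    unfolding gx_def by (rule has_weak_derivs_weak_derivs[OF gL(2)])
  have wt: "has_weak_derivs u [e_t] ut ?ST"
    by (rule has_weak_derivs_time[OF L u_cont ut(1) ut(2)])
  have gt: "has_weak_derivs u [e_t] gt ?ST"
    unfolding gt_def by (rule has_weak_derivs_weak_derivs[OF wt])
  have gL_meas: "gL \<in> borel_measurable (lebesgue_on ?ST)"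
    using gL(1) by (simp add: Linf_L2_def ST)
  obtain g where g_meas: "g \<in> borel_measurable borel" and gLg: "AE p in lebesgue. p \<in> ?ST \<longrightarrow> gL p = g p"
    using lebesgue_on_ex_borel_version[OF space_time_lebesgue gL_meas] by blast
  have gxg: "AE p in lebesgue. p \<in> ?ST \<longrightarrow> gx p = g p"
  proof -
    have "AE p in lebesgue. p \<in> ?ST \<longrightarrow> gx p = gL p"
      using weak_derivs_unique[OF space_time_open gx gL(2)] by (simp only: AE_ST)
    then show ?thesis using gLg by eventually_elim simp
  qed
  have gtut: "AE p in lebesgue. p \<in> ?ST \<longrightarrow> gt p = ut p"
    using weak_derivs_unique[OF space_time_open gt wt] by (simp only: AE_ST)
  obtain h where h: "h \<in> borel_measurable (lebesgue_on ?ST)"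
      "AE p in lebesgue_on ?ST. h p \<in> clarke_subdiff (Phi \<kappa>2) (u p)"
    and weak: "\<And>\<phi>. \<phi> \<in> Cc_infinity \<Longrightarrow> (\<forall>t. pderiv_at e_x \<phi> (t, 0) = 0 \<and> pderiv_at e_x \<phi> (t, L) = 0) \<Longrightarrow>
          (\<integral>p. u p * pderivs [e_t, e_t] \<phi> p
               + \<kappa>1\<^sup>2 * gx p * pderivs [e_x, e_x] \<phi> p + h p * \<phi> p \<partial>lebesgue_on ?ST)
          - (\<integral>x. v1 x * \<phi> (0, x) \<partial>lebesgue_on {0<..<L})
          + (\<integral>x. v0 x * pderiv_at e_t \<phi> (0, x) \<partial>lebesgue_on {0<..<L}) = 0"
    using u unfolding dissipative_solution_def weak_solution_def gx_def by blast

  have v0': "AE x in lebesgue. x \<in> {0<..<L} \<longrightarrow> v0 x = c0" using c0 by (simp only: AE_x)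
  have v1': "AE x in lebesgue. x \<in> {0<..<L} \<longrightarrow> v1 x = c1" using c1 by (simp only: AE_x)
  have init: "initial_energy \<kappa>1 \<kappa>2 L v0 v1 = L * ((c1\<^sup>2) / 2 + Phi \<kappa>2 c0)"
  proof -
    have "locally_integrable_on v0 {0<..<L}"
      using v0 by (auto simp: H2_space_def has_weak_derivs_def)
    note w0 = has_weak_derivs_const[OF L c0 this]
    have "AE x in lebesgue. x \<in> {0<..<L} \<longrightarrow> weak_derivs {0<..<L} [1, 1] v0 x = 0"
      using weak_derivs_unique[OF _ has_weak_derivs_weak_derivs[OF w0] w0] by (simp add: AE_x)
    then have "AE x in lebesgue. x \<in> {0<..<L} \<longrightarrow>
        ((v1 x)\<^sup>2 + \<kappa>1\<^sup>2 * (weak_derivs {0<..<L} [1, 1] v0 x)\<^sup>2) / 2 + Phi \<kappa>2 (v0 x) = (c1\<^sup>2) / 2 + Phi \<kappa>2 c0"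
      using v0' v1' by eventually_elim simp
    then have "initial_energy \<kappa>1 \<kappa>2 L v0 v1 = (\<integral>x. (c1\<^sup>2) / 2 + Phi \<kappa>2 c0 \<partial>lebesgue_on {0<..<L})"
      unfolding initial_energy_def by (rule integral_lebesgue_on_cong_AE(1)[OF Ioo_lebesgue(1)])
    also have "\<dots> = integral {0..L} (\<lambda>x. (c1\<^sup>2) / 2 + Phi \<kappa>2 c0)"
      by (intro lebesgue_on_interval_continuous continuous_intros)
    finally show ?thesis using L by simp
  qed
  \<comment> \<open>The quadratic bound on the initial potential energy puts the energy inequality
    into the form that is compared with the oscillator energy of the mean.\<close>
  have Phi_le: "Phi \<kappa>2 c0 \<le> \<kappa>2\<^sup>2 * c0\<^sup>2 / 2"
  proof -
    have "Phi \<kappa>2 \<bar>c0\<bar> = Phi \<kappa>2 c0" "Phi \<kappa>2 0 = 0" by (simp_all add: Phi_def)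
    then show ?thesis using Phi_diff_le[of 0 "\<bar>c0\<bar>" \<kappa>2] by simp
  qed

  \<comment> \<open>The energy is evaluated at fixed times, so equality almost everywhere in
    space-time is first turned into equality almost everywhere on almost every time slice.\<close>
  have slice: "AE t in lebesgue. AE x in lebesgue. (t, x) \<in> ?ST \<longrightarrow>
      gL (t, x) = g (t, x) \<and> gx (t, x) = g (t, x) \<and> gt (t, x) = ut (t, x)"
  proof (rule AE_lebesgue_Pair)
    show "AE p in lebesgue. p \<in> ?ST \<longrightarrow> gL p = g p \<and> gx p = g p \<and> gt p = ut p"
      using gLg gxg gtut by eventually_elim simp
  qed
  obtain C where "AE t in lebesgue_on {0<..}. (\<lambda>x. gL (t, x)) \<in> L2_space {0<..<L} \<and>
      L2_norm_on {0<..<L} (\<lambda>x. gL (t, x)) \<le> C"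
    using gL(1) unfolding Linf_L2_def by blast
  then have "AE t in lebesgue. t \<in> {0<..} \<longrightarrow> (\<lambda>x. gL (t, x)) \<in> L2_space {0<..<L} \<and>
      L2_norm_on {0<..<L} (\<lambda>x. gL (t, x)) \<le> C"
    by (simp only: AE_t)
  then have g_slices: "AE t in lebesgue. 0 < t \<longrightarrow>
      integrable (lebesgue_on {0<..<L}) (\<lambda>x. (g (t, x))\<^sup>2) \<and> (\<integral>x. (g (t, x))\<^sup>2 \<partial>lebesgue_on {0<..<L}) \<le> C\<^sup>2"
    using slice
  proof eventually_elim
    case (elim t)
    show ?case
    proof
      assume t: "0 < t"
      then have i: "integrable (lebesgue_on {0<..<L}) (\<lambda>x. (gL (t, x))\<^sup>2)"
        and le: "(\<integral>x. (gL (t, x))\<^sup>2 \<partial>lebesgue_on {0<..<L}) \<le> C\<^sup>2"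
        using elim(1) by (auto simp: L2_space_def intro: L2_norm_on_le_imp)
      have "AE x in lebesgue. x \<in> {0<..<L} \<longrightarrow> (gL (t, x))\<^sup>2 = (g (t, x))\<^sup>2"
        using elim(2) t by (auto simp: space_time_def elim!: eventually_mono)
      from integral_lebesgue_on_cong_AE[OF Ioo_lebesgue(1) this] i le
      show "integrable (lebesgue_on {0<..<L}) (\<lambda>x. (g (t, x))\<^sup>2) \<and>
          (\<integral>x. (g (t, x))\<^sup>2 \<partial>lebesgue_on {0<..<L}) \<le> C\<^sup>2" by simp
    qed
  qed

  have "plate L \<kappa>1 \<kappa>2 c0 c1 u ut g h"
  proof (unfold_locales)
    show "integrable (lebesgue_on (strip L 0 T)) g" for T
      by (rule integrable_strip_of_slices[OF g_meas g_slices])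
    show "(\<integral>p. u p * pderivs [e_x, e_x] \<psi> p \<partial>lebesgue_on ?ST) = (\<integral>p. g p * \<psi> p \<partial>lebesgue_on ?ST)"
      if "\<psi> \<in> Cc_infinity" "closure {p. \<psi> p \<noteq> 0} \<subseteq> ?ST" for \<psi>
    proof -
      have "(\<integral>p. u p * pderivs [e_x, e_x] \<psi> p \<partial>lebesgue_on ?ST) = (\<integral>p. gx p * \<psi> p \<partial>lebesgue_on ?ST)"
        using gx that by (simp add: has_weak_derivs_def)
      also have "\<dots> = (\<integral>p. g p * \<psi> p \<partial>lebesgue_on ?ST)"
        by (rule integral_lebesgue_on_cong_AE(1)[OF space_time_lebesgue])
          (use gxg in \<open>auto elim!: eventually_mono\<close>)
      finally show ?thesis .
    qed
    show "(\<integral>p. u p * pderivs [e_t, e_t] \<phi> p + \<kappa>1\<^sup>2 * g p * pderivs [e_x, e_x] \<phi> p + h p * \<phi> p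
            \<partial>lebesgue_on ?ST)
          - c1 * (\<integral>x. \<phi> (0, x) \<partial>lebesgue_on {0<..<L})
          + c0 * (\<integral>x. pderiv_at e_t \<phi> (0, x) \<partial>lebesgue_on {0<..<L}) = 0"
      if \<phi>: "\<phi> \<in> Cc_infinity" "\<And>t. pderiv_at e_x \<phi> (t, 0) = 0" "\<And>t. pderiv_at e_x \<phi> (t, L) = 0" for \<phi>
    proof -
      have "(\<integral>p. u p * pderivs [e_t, e_t] \<phi> p + \<kappa>1\<^sup>2 * gx p * pderivs [e_x, e_x] \<phi> p + h p * \<phi> p \<partial>lebesgue_on ?ST)
          = (\<integral>p. u p * pderivs [e_t, e_t] \<phi> p + \<kappa>1\<^sup>2 * g p * pderivs [e_x, e_x] \<phi> p + h p * \<phi> p \<partial>lebesgue_on ?ST)"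
        by (rule integral_lebesgue_on_cong_AE(1)[OF space_time_lebesgue])
          (use gxg in \<open>auto elim!: eventually_mono\<close>)
      moreover have "(\<integral>x. v1 x * \<phi> (0, x) \<partial>lebesgue_on {0<..<L}) = (\<integral>x. c1 * \<phi> (0, x) \<partial>lebesgue_on {0<..<L})"
        by (rule integral_lebesgue_on_cong_AE(1)[OF Ioo_lebesgue(1)])
          (use v1' in \<open>auto elim!: eventually_mono\<close>)
      moreover have "(\<integral>x. v0 x * pderiv_at e_t \<phi> (0, x) \<partial>lebesgue_on {0<..<L})
          = (\<integral>x. c0 * pderiv_at e_t \<phi> (0, x) \<partial>lebesgue_on {0<..<L})"
        by (rule integral_lebesgue_on_cong_AE(1)[OF Ioo_lebesgue(1)])
          (use v0' in \<open>auto elim!: eventually_mono\<close>)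
      ultimately show ?thesis using weak[OF \<phi>(1)] \<phi>(2,3) by simp
    qed
    show "AE t in lebesgue. 0 < t \<longrightarrow>
        integrable (lebesgue_on {0<..<L}) (\<lambda>x. (g (t, x))\<^sup>2) \<and>
        integral {0..L} (\<lambda>x. (ut (t, x))\<^sup>2 / 2 + Phi \<kappa>2 (u (t, x)))
          + \<kappa>1\<^sup>2 / 2 * (\<integral>x. (g (t, x))\<^sup>2 \<partial>lebesgue_on {0<..<L})
        \<le> L * (c1\<^sup>2 + \<kappa>2\<^sup>2 * c0\<^sup>2) / 2"
    proof -
      have "AE t in lebesgue. t \<in> {0<..} \<longrightarrow> energy \<kappa>1 \<kappa>2 L u t \<le> initial_energy \<kappa>1 \<kappa>2 L v0 v1"
        using u by (simp only: dissipative_solution_def AE_t)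
      then show ?thesis
        using slice g_slices
      proof eventually_elim
        case (elim t)
        show ?case
        proof
          assume t: "0 < t"
          let ?e = "\<lambda>x. (ut (t, x))\<^sup>2 / 2 + Phi \<kappa>2 (u (t, x))"
          have gi: "integrable (lebesgue_on {0<..<L}) (\<lambda>x. (g (t, x))\<^sup>2)" using elim(3) t by blast
          have ce: "continuous_on {0..L} ?e"
            using t by (intro continuous_intros continuous_on_compose2[OF ut(1)]
                continuous_on_compose2[OF Phi_continuous[of UNIV]] continuous_on_compose2[OF u_cont]) auto
          have "energy \<kappa>1 \<kappa>2 L u t = (\<integral>x. ?e x + \<kappa>1\<^sup>2 / 2 * (g (t, x))\<^sup>2 \<partial>lebesgue_on {0<..<L})"
            unfolding energy_def gt_def[symmetric] gx_def[symmetric]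
            by (rule integral_lebesgue_on_cong_AE(1)[OF Ioo_lebesgue(1)])
              (use elim(2) t in \<open>auto simp: space_time_def add_divide_distrib elim!: eventually_mono\<close>)
          also have "\<dots> = (\<integral>x. ?e x \<partial>lebesgue_on {0<..<L}) + \<kappa>1\<^sup>2 / 2 * (\<integral>x. (g (t, x))\<^sup>2 \<partial>lebesgue_on {0<..<L})"
            using gi lebesgue_on_interval_continuous(1)[OF ce] by (subst Bochner_Integration.integral_add) auto
          also have "(\<integral>x. ?e x \<partial>lebesgue_on {0<..<L}) = integral {0..L} ?e"
            by (rule lebesgue_on_interval_continuous(2)[OF ce])
          finally have "integral {0..L} ?e + \<kappa>1\<^sup>2 / 2 * (\<integral>x. (g (t, x))\<^sup>2 \<partial>lebesgue_on {0<..<L})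
              \<le> L * ((c1\<^sup>2) / 2 + Phi \<kappa>2 c0)"
            using elim(1) t init by simp
          also have "\<dots> \<le> L * ((c1\<^sup>2) / 2 + \<kappa>2\<^sup>2 * c0\<^sup>2 / 2)"
            using L Phi_le by (intro mult_left_mono add_left_mono) auto
          also have "\<dots> = L * (c1\<^sup>2 + \<kappa>2\<^sup>2 * c0\<^sup>2) / 2" by (simp add: algebra_simps add_divide_distrib)
          finally show "integrable (lebesgue_on {0<..<L}) (\<lambda>x. (g (t, x))\<^sup>2) \<and>
            integral {0..L} ?e + \<kappa>1\<^sup>2 / 2 * (\<integral>x. (g (t, x))\<^sup>2 \<partial>lebesgue_on {0<..<L})
            \<le> L * (c1\<^sup>2 + \<kappa>2\<^sup>2 * c0\<^sup>2) / 2"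
            using gi by blast
        qed
      qed
    qed
    have "AE t in lebesgue. t \<in> {0<..} \<longrightarrow>
        ((\<lambda>x. u (t, x)) has_real_derivative 0) (at 0 within {0..L}) \<and>
        ((\<lambda>x. u (t, x)) has_real_derivative 0) (at L within {0..L})"
      using u by (simp only: dissipative_solution_def AE_t)
    then show "AE t in lebesgue. 0 < t \<longrightarrow> ((\<lambda>x. u (t, x)) has_real_derivative 0) (at 0 within {0..L})"
      by eventually_elim simp
  qed (fact L \<kappa> u_cont ut g_meas h)+
  then show ?thesis by blast
qed

theorem theorem1p1:
  fixes L \<kappa>1 \<kappa>2 tbar :: real
    and v0 v1 :: "real \<Rightarrow> real"
    and u :: "real \<times> real \<Rightarrow> real"
  assumes "L > 0" and "\<kappa>1 > 0" and "\<kappa>2 \<noteq> 0"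
    and "v0 \<in> H2_space {0<..<L}" and "v1 \<in> L2_space {0<..<L}"
    and "dissipative_solution \<kappa>1 \<kappa>2 L v0 v1 u"
    and "\<exists>c. \<bar>c\<bar> < 1 \<and> (AE x in lebesgue_on {0<..<L}. v0 x = c)"
    and "\<exists>c. AE x in lebesgue_on {0<..<L}. v1 x = c"
    and "tbar > 0" and "\<forall>x\<in>{0..L}. \<bar>u (tbar, x)\<bar> > 1"
    and "C1_on ({0..} \<times> {0..L}) u"
    and "AE t in lebesgue_on {0<..}. energy \<kappa>1 \<kappa>2 L u t = initial_energy \<kappa>1 \<kappa>2 L v0 v1"
  shows "\<forall>t\<ge>tbar. (\<lambda>x. u (t, x)) constant_on {0..L}"
proof -
  obtain c0 where c0: "\<bar>c0\<bar> < 1" "AE x in lebesgue_on {0<..<L}. v0 x = c0" using assms(7) by blast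
  obtain c1 where c1: "AE x in lebesgue_on {0<..<L}. v1 x = c1" using assms(8) by blast
  obtain ut g h where "plate L \<kappa>1 \<kappa>2 c0 c1 u ut g h"
    using dissipative_solution_imp_plate[OF assms(1-4,6) c0(2) c1 assms(11)] by blast
  then interpret plate L \<kappa>1 \<kappa>2 c0 c1 u ut g h .
  show ?thesis
  proof (intro allI impI)
    fix t assume t: "tbar \<le> t"
    have "u (t, x) = u (t, 0)" if "x \<in> {0..L}" for x
      by (rule eventually_constant_in_space[OF c0(1) assms(9) _ t that]) (use assms(1,10) in auto)
    then show "(\<lambda>x. u (t, x)) constant_on {0..L}" unfolding constant_on_def by blast
  qed
qed

end
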